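(* Fix a constant $c>1$ and let $m=m(n)$ satisfy $n+2\le m\le cn$. Then the random balanced graph $\mathbf{H}(n,m)$ is asymmetric with probability tending to $1$ as $n\to\infty$ along even $n$.
   Context: Let $n$ be even and write $m=q\cdot\frac n2+r$ with integers $q\ge 2$, $0\le r<\frac n2$. For a cycle $C=(v_1,\dots,v_n,v_1)$ and $0\le r\le n$, $R(C,r)=\{v_i:\lfloor (i-1)r/n\rfloor<\lfloor ir/n\rfloor\}$. The random multigraph $\mathbf{H}^*(n,m)=\mathbf{H}_r+\mathbf{H}_h+\mathbf{H}_b$ on $[n]$ (sum of edge multisets) is defined by: $\mathbf{H}_r$ a uniformly random $(q-2)$-regular simple graph on $[n]$; $\mathbf{H}_h$ an independent uniformly random Hamilton cycle on $[n]$; with $\mathbf{R}=R(\mathbf{H}_h,r)$, vertices $(\mathbf{y}[x])_{x\in\mathbf{R}}$ independent of $\mathbf{H}_r,\mathbf{H}_h$ and uniform over all sequences of $r$ distinct vertices of $[n]$; $\mathbf{H}_b$ has edge multiset $\{\{x,\mathbf{y}[x]\}:x\in\mathbf{R}\}$ (loops and multiple edges allowed). The random balanced graph $\mathbf{H}(n,m)$ is distributed as $\mathbf{H}^*(n,m)$ conditioned on being a simple graph. A graph is asymmetric if its automorphism group is trivial. *)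

theory Defs
  imports
    "HOL-Probability.Probability"
    "HOL-Combinatorics.Permutations"
    "HOL-Combinatorics.Multiset_Permutations"
begin

text \<open>
  The vertex set is \<open>{1..n}\<close>. A simple graph is its set of edges (two-element sets); a multigraph is
  its multiset of edges, where a loop at \<open>x\<close> is the singleton \<open>{x, x} = {x}\<close>.
\<close>

definition simple_multigraph :: "'a set multiset \<Rightarrow> bool" where
  "simple_multigraph H \<longleftrightarrow> (\<forall>e\<in>#H. card e = 2 \<and> count H e = 1)"

definition regular_graphs :: "nat \<Rightarrow> nat \<Rightarrow> nat set set set" where
  "regular_graphs n d =
     {E. E \<subseteq> {e. e \<subseteq> {1..n} \<and> card e = 2} \<and> (\<forall>v\<in>{1..n}. card {e \<in> E. v \<in> e} = d)}"

definition automorphisms :: "'a set \<Rightarrow> 'a set set \<Rightarrow> ('a \<Rightarrow> 'a) set" where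
  "automorphisms V E =
     {\<pi>. \<pi> permutes V \<and> (\<forall>u\<in>V. \<forall>v\<in>V. {u, v} \<in> E \<longleftrightarrow> {\<pi> u, \<pi> v} \<in> E)}"

definition asymmetric :: "'a set \<Rightarrow> 'a set set \<Rightarrow> bool" where
  "asymmetric V E \<longleftrightarrow> automorphisms V E = {id}"

text \<open>
  The cycle \<open>(v\<^sub>1, \<dots>, v\<^sub>n, v\<^sub>1)\<close> is the list \<open>vs = [v\<^sub>1, \<dots>, v\<^sub>n]\<close>, so that \<open>v\<^sub>i = vs ! (i - 1)\<close>.
  Every Hamilton cycle on \<open>{1..n}\<close> with \<open>n \<ge> 3\<close> comes from exactly \<open>2 * n\<close> of the lists in
  \<open>permutations_of_set {1..n}\<close>, hence a uniform list gives a uniform Hamilton cycle.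
  The set \<open>R(C, r)\<close> depends on the starting vertex and the direction. By invariance of the other two
  components under relabelling, choosing them in any other way does not change the probability of an
  isomorphism-invariant property of the random graph below.
\<close>

definition cycle_edges :: "'a list \<Rightarrow> 'a set multiset" where
  "cycle_edges vs =
     image_mset (\<lambda>i. {vs ! i, vs ! (Suc i mod length vs)}) (mset_set {..<length vs})"

definition cycle_selection :: "'a list \<Rightarrow> nat \<Rightarrow> 'a set" where
  "cycle_selection vs r =
     {vs ! (i - 1) | i. i \<in> {1..length vs} \<and>
        \<lfloor>real ((i - 1) * r) / real (length vs)\<rfloor> < \<lfloor>real (i * r) / real (length vs)\<rfloor>}"

definition injections :: "'a set \<Rightarrow> 'b set \<Rightarrow> ('a \<Rightarrow> 'b) set" where
  "injections A B = {y \<in> A \<rightarrow>\<^sub>E B. inj_on y A}"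

definition balanced_multigraph :: "nat \<Rightarrow> nat \<Rightarrow> nat set multiset pmf" where
  "balanced_multigraph n m =
     (let q = m div (n div 2); r = m mod (n div 2) in
      do {
        Er \<leftarrow> pmf_of_set (regular_graphs n (q - 2));
        vs \<leftarrow> pmf_of_set (permutations_of_set {1..n});
        let R = cycle_selection vs r;
        y \<leftarrow> pmf_of_set (injections R {1..n});
        return_pmf (mset_set Er + cycle_edges vs + image_mset (\<lambda>x. {x, y x}) (mset_set R))
      })"

definition balanced_graph :: "nat \<Rightarrow> nat \<Rightarrow> nat set set pmf" where
  "balanced_graph n m =
     map_pmf set_mset (cond_pmf (balanced_multigraph n m) {H. simple_multigraph H})"

end

theory Submission
  imports Defs "HOL-Combinatorics.Cycles" "HOL-Real_Asymp.Real_Asymp"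
begin

text \<open>
  The random multigraph is a uniform choice of a triple consisting of a regular graph, a Hamilton
  cycle and an injection. Switchings show two things: the sum is simple with probability bounded away
  from \<open>0\<close>, and a prescribed set of \<open>k\<close> edges is present with probability at most \<open>(C / n) ^ k\<close>, where
  the exponent loses an arbitrarily small constant factor.

  If every degree is at least \<open>3\<close>, the second fact gives asymmetry by a first moment computation. A
  nontrivial automorphism may be taken of prime order \<open>p\<close>; let \<open>S\<close> be its support and \<open>s = card S\<close>. The
  edges meeting \<open>S\<close> form an invariant set in which the degrees of \<open>S\<close> add up to at least \<open>3 * s\<close>.
  Summing over all such sets, with each orbit of edges counted as one choice but paid for edge by edge,
  bounds the expected number of these automorphisms by \<open>(C * n powr (-1/8)) ^ s\<close>.

  This settles \<open>q > 2\<close>. For \<open>q = 2\<close> the graph is a cycle with \<open>r\<close> chords. When \<open>r\<close> is large, suppress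
  the vertices of degree \<open>2\<close> and apply the same computation to the resulting kernel, whose
  edges carry a colour recording whether they come from a suppressed path. When \<open>r < n powr (1/4)\<close>,
  typically no two chord ends are adjacent on the cycle, so that every automorphism is a rotation or a
  reflection of the cycle, and the chords are too irregular to be preserved by any of them.
\<close>

section \<open>Permutations of prime order\<close>

text \<open>Why degree \<open>3\<close>: up to factors \<open>C ^ s\<close> and small powers of
  \<open>N\<close>, a degree sum \<open>t\<close> on the support pays \<open>\<mu> ^ t\<close> with
  \<open>\<mu> = N powr (1/2) * s powr (-1/(2*p))\<close>, while the support and the permutation on
  it can be chosen in \<open>N ^ s * s powr (-s/p)\<close> ways. For \<open>t = 2 * s\<close> the
  two cancel exactly, so vertices of degree \<open>2\<close> have to be suppressed; a third edge
  gains one further \<open>\<mu>\<close>, at least about \<open>N powr (1/4)\<close>, per vertex.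
  This surplus pays for all losses: \<open>1/48\<close> of the exponent goes to edges left out in
  the switchings and another \<open>1/48\<close> absorbs the constants, whence
  \<open>-23/24\<close>.

  The first moments are computed without conditioning: symmetric simple configurations are counted
  against all configurations, and passing to the simple ones costs a constant factor.

  The kernel has at most \<open>2 * r\<close> vertices and fails with probability of order
  \<open>r powr (-1/4)\<close>, which says nothing for bounded \<open>r\<close>. Coincidences among
  few chords cost order \<open>r^2 / n\<close>. Hence the two cases, divided at
  \<open>n powr (1/4)\<close>. The lower limit \<open>n + 2\<close> is natural: a cycle with a
  single chord has a reflection.\<close>

lemma prime_order_orbit_inj:
  assumes "prime (p::nat)" "(f ^^ p) x = x" "f x \<noteq> x"
  shows "inj_on (\<lambda>i. (f ^^ i) x) {..<p}"
proof (rule inj_onI, rule ccontr)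
  have mult: "(f ^^ (k * m)) x = x" if "(f ^^ k) x = x" for k m
  proof (induction m)
    case (Suc m)
    then show ?case using that by (simp add: funpow_add)
  qed auto
  have main: False if "i < j" "j < p" "(f ^^ i) x = (f ^^ j) x" for i j
  proof -
    have "(f ^^ (p - j + i)) x = (f ^^ (p - j)) ((f ^^ i) x)" by (simp add: funpow_add)
    also have "\<dots> = (f ^^ (p - j + j)) x" unfolding that(3) funpow_add by simp
    also have "\<dots> = x" using that assms by simp
    finally have *: "(f ^^ (p - j + i)) x = x" .
    have "coprime (p - j + i) p"
    proof -
      have "\<not> p dvd p - j + i" using that by (intro nat_dvd_not_less) auto
      then show ?thesis using \<open>prime p\<close> prime_imp_coprime coprime_commute by blast
    qed
    \<comment> \<open>Both \<open>p - j + i\<close> and \<open>p\<close> are periods of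
      \<open>x\<close>. Being coprime they make \<open>1\<close> a period, so \<open>x\<close> would
      be fixed by \<open>f\<close>.\<close>
    then obtain a b where "(p - j + i) * a = p * b + 1"
      using coprime_bezout_strong[of "p - j + i" p] \<open>prime p\<close> prime_gt_1_nat by blast
    then have "(f ^^ (p * b + 1)) x = x" using mult[OF *, of a] by simp
    moreover have "(f ^^ (p * b + 1)) x = f x"
      using mult[OF assms(2), of b] by simp
    ultimately show False using assms by simp
  qed
  fix i j assume "i \<in> {..<p}" "j \<in> {..<p}" "(f ^^ i) x = (f ^^ j) x" "i \<noteq> j"
  then show False using main[of i j] main[of j i] by (cases "i < j") auto
qed

text \<open>If \<open>\<pi>\<close> has order \<open>n\<close> and \<open>p\<close> is a prime
  divisor of \<open>n\<close>, then \<open>n / p\<close> is a suitable exponent. Powers of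
  automorphisms are automorphisms, so only those of prime order have to be excluded, and all their
  nontrivial orbits have the same size \<open>p\<close>.\<close>

lemma exists_power_of_prime_order:
  assumes "finite V" "\<pi> permutes V" "\<pi> \<noteq> id"
  obtains p k where "prime (p::nat)" "(\<pi> ^^ k) \<noteq> id" "(\<pi> ^^ k) ^^ p = id"
proof -
  have "\<exists>n>0. \<pi> ^^ n = id"
    using permutation_is_nilpotent[of \<pi>] assms permutation_permutes by blast
  define n where "n = (LEAST n. n > 0 \<and> \<pi> ^^ n = id)"
  have n: "n > 0" "\<pi> ^^ n = id"
    using LeastI_ex[of "\<lambda>n. n > 0 \<and> \<pi> ^^ n = id"] \<open>\<exists>n>0. _\<close> by (auto simp: n_def)
  have least: "n \<le> k" if "k > 0" "\<pi> ^^ k = id" for k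
    unfolding n_def using that by (intro Least_le) auto
  have "n \<noteq> 1" using n assms by auto
  then obtain p where p: "prime p" "p dvd n" using prime_factor_nat by blast
  then obtain k where k: "n = p * k" by blast
  have "k < n" "k > 0" using k n prime_gt_1_nat[OF p(1)] by (cases "k = 0"; simp)+
  then have "\<pi> ^^ k \<noteq> id" using least[of k] by fastforce
  moreover have "(\<pi> ^^ k) ^^ p = id" using n k by (simp add: funpow_mult mult.commute)
  ultimately show ?thesis using that p by blast
qed

section \<open>Permutations of prime order without fixed points, counted orbit by orbit\<close>

definition free_perms :: "nat \<Rightarrow> 'a set \<Rightarrow> ('a \<Rightarrow> 'a) set" where
  "free_perms p S = {\<rho>. \<rho> permutes S \<and> \<rho> ^^ p = id \<and> (\<forall>x\<in>S. \<rho> x \<noteq> x)}"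

lemma finite_free_perms: "finite S \<Longrightarrow> finite (free_perms p S)"
  unfolding free_perms_def by (rule finite_subset[OF _ finite_permutations]) auto

text \<open>The induction step for the two results below. On the deleted orbit the permutation is
  replaced by the identity, so that it permutes the remaining set in the sense of
  \<open>permutes\<close>.\<close>

lemma free_perms_remove_orbit:
  assumes p: "prime p" and \<rho>: "\<rho> \<in> free_perms p S" and a: "a \<in> S"
  defines "O' \<equiv> (\<lambda>i. (\<rho> ^^ i) a) ` {..<p}"
  shows "(\<lambda>x. if x \<in> O' then x else \<rho> x) \<in> free_perms p (S - O')"
    and "card O' = p" and "O' \<subseteq> S"
proof -
  have \<rho>': "\<rho> permutes S" "\<rho> ^^ p = id" "\<rho> x \<noteq> x" if "x \<in> S" for x
    using \<rho> that by (auto simp: free_perms_def)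
  have perm: "\<rho> permutes S" and pw: "\<rho> ^^ p = id" using \<rho> by (auto simp: free_perms_def)
  have inj: "inj \<rho>" using perm permutes_inj by blast
  show "card O' = p"
    unfolding O'_def using prime_order_orbit_inj[OF p, of \<rho> a] pw \<rho>'(3)[OF a]
    by (simp add: card_image)
  have in_S: "(\<rho> ^^ i) a \<in> S" for i
    using a perm by (induction i) (auto simp: permutes_in_image)
  then show sub: "O' \<subseteq> S" by (auto simp: O'_def)
  have cl: "\<rho> x \<in> O'" if xO: "x \<in> O'" for x
  proof -
    obtain i where i: "i < p" "x = (\<rho> ^^ i) a" using xO by (auto simp: O'_def)
    show ?thesis
    proof (cases "Suc i < p")
      case True
      then show ?thesis using i by (auto simp: O'_def intro!: image_eqI[of _ _ "Suc i"])
    next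
      case False
      then have "Suc i = p" using i by simp
      then have "\<rho> x = a" using i pw by (metis funpow.simps(2) comp_apply id_apply)
      then show ?thesis using p prime_gt_0_nat by (auto simp: O'_def intro!: image_eqI[of _ _ 0])
    qed
  qed
  have cl2: "x \<in> O'" if "\<rho> x \<in> O'" for x
  proof -
    have "\<rho> ` O' = O'"
      using cl inj by (intro endo_inj_surj) (auto simp: O'_def intro: inj_on_subset)
    then show ?thesis using that inj by (metis imageE injD)
  qed
  let ?r = "\<lambda>x. if x \<in> O' then x else \<rho> x"
  have invr: "\<rho> ` (S - O') = S - O'"
  proof -
    have "\<rho> ` O' = O'"
      using cl inj by (intro endo_inj_surj) (auto simp: O'_def intro: inj_on_subset)
    then show ?thesis using perm inj by (simp add: image_set_diff permutes_image)
  qed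
  have "?r permutes (S - O')"
  proof (rule bij_imp_permutes)
    show "bij_betw ?r (S - O') (S - O')"
      unfolding bij_betw_def
    proof
      show "inj_on ?r (S - O')" using inj by (auto simp: inj_on_def inj_def)
      have "?r ` (S - O') = \<rho> ` (S - O')" by (intro image_cong) auto
      then show "?r ` (S - O') = S - O'" using invr by simp
    qed
    show "?r x = x" if "x \<notin> S - O'" for x
      using that perm by (auto simp: permutes_def)
  qed
  moreover have "?r ^^ p = id"
  proof
    fix x
    have "(?r ^^ i) x = x" if "x \<in> O'" for i using that by (induction i) auto
    moreover have "(?r ^^ i) x = (\<rho> ^^ i) x \<and> (\<rho> ^^ i) x \<notin> O'" if "x \<notin> O'" for i
      using that cl2 by (induction i) auto
    ultimately show "(?r ^^ p) x = id x" using pw by (cases "x \<in> O'") auto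
  qed
  moreover have "\<forall>x\<in>S - O'. ?r x \<noteq> x" using \<rho>'(3) by auto
  ultimately show "?r \<in> free_perms p (S - O')" by (simp add: free_perms_def)
qed

lemma free_perms_dvd_card:
  assumes "prime p" "finite S" "free_perms p S \<noteq> {}"
  shows "p dvd card S"
  using assms(2,3)
proof (induction "card S" arbitrary: S rule: less_induct)
  case less
  show ?case
  proof (cases "S = {}")
    case False
    then obtain a \<rho> where a: "a \<in> S" "\<rho> \<in> free_perms p S" using less by blast
    define O' where "O' = (\<lambda>i. (\<rho> ^^ i) a) ` {..<p}"
    note r = free_perms_remove_orbit[OF \<open>prime p\<close> a(2,1), folded O'_def]
    have fO: "finite O'" by (simp add: O'_def)
    have c: "card (S - O') = card S - p" using r fO by (simp add: card_Diff_subset)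
    have "p \<le> card S" using r less.prems card_mono by metis
    have "card (S - O') < card S"
      using c prime_gt_0_nat[OF \<open>prime p\<close>] \<open>p \<le> card S\<close> by linarith
    moreover have "free_perms p (S - O') \<noteq> {}" using r(1) by blast
    ultimately have "p dvd card (S - O')" using less.hyps[of "S - O'"] less.prems(1) by blast
    then have "p dvd card S - p + p" unfolding c by (intro dvd_add) auto
    then show ?thesis using \<open>p \<le> card S\<close> by simp
  qed auto
qed

text \<open>Fix a point \<open>a\<close>. The permutation is determined by the other
  \<open>p - 1\<close> points of the orbit of \<open>a\<close>, in order, and by its action off that
  orbit. One point of each orbit is thus never chosen, and this saves the
  \<open>card S div p\<close> in the exponent.\<close>

lemma card_free_perms_le:
  assumes p: "prime p" and "finite S"
  shows "card (free_perms p S) \<le> card S ^ (card S - card S div p)"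
  using assms(2)
proof (induction "card S" arbitrary: S rule: less_induct)
  case less
  show ?case
  proof (cases "S = {} \<or> free_perms p S = {}")
    case True
    then show ?thesis
    proof
      assume "S = {}"
      then have "free_perms p S \<subseteq> {id}" by (auto simp: free_perms_def)
      then have "card (free_perms p S) \<le> card {id :: 'a \<Rightarrow> 'a}"
        using card_mono[of "{id}" "free_perms p S"] by simp
      then show ?thesis using \<open>S = {}\<close> by simp
    qed auto
  next
    case False
    then obtain a where a: "a \<in> S" by auto
    let ?L = "{xs. set xs \<subseteq> S \<and> length xs = p - 1}"
    let ?L' = "{xs \<in> ?L. card (insert a (set xs)) = p}"
    let ?B = "\<lambda>xs. free_perms p (S - insert a (set xs))"
    let ?xs = "\<lambda>\<rho>. map (\<lambda>i. (\<rho> ^^ i) a) [1..<p]"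
    let ?O = "\<lambda>\<rho>. (\<lambda>i. (\<rho> ^^ i) a) ` {..<p}"
    \<comment> \<open>An injective encoding: the orbit of \<open>a\<close> as a list starting after
      \<open>a\<close>, together with the permutation that remains when this orbit is
      removed.\<close>
    let ?\<Phi> = "\<lambda>\<rho>. (?xs \<rho>, \<lambda>x. if x \<in> ?O \<rho> then x else \<rho> x)"
    have p1: "p > 1" using p prime_gt_1_nat by blast
    have ins: "insert a (set (?xs \<rho>)) = ?O \<rho>" for \<rho>
    proof -
      have "{..<p} = insert 0 {1..<p}" using p1 by auto
      then show ?thesis by auto
    qed
    have finL: "finite ?L" using finite_lists_length_eq[OF less.prems, of "p - 1"] by simp
    have finL': "finite ?L'" by (rule finite_subset[OF _ finL]) blast
    have inj: "inj_on ?\<Phi> (free_perms p S)"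
    proof (rule inj_onI)
      fix \<rho> \<tau> assume \<rho>: "\<rho> \<in> free_perms p S" and \<tau>: "\<tau> \<in> free_perms p S" and eq: "?\<Phi> \<rho> = ?\<Phi> \<tau>"
      have xs: "?xs \<rho> = ?xs \<tau>" using eq by simp
      have pw: "(\<rho> ^^ i) a = (\<tau> ^^ i) a" if "i < p" for i
      proof (cases "i = 0")
        case False
        then have "i \<in> set [1..<p]" using that by auto
        then show ?thesis using xs unfolding map_eq_conv by blast
      qed auto
      have pid: "\<rho> ^^ p = id" "\<tau> ^^ p = id" using \<rho> \<tau> by (auto simp: free_perms_def)
      have pw2: "(\<rho> ^^ i) a = (\<tau> ^^ i) a" if "i \<le> p" for i
        using pw[of i] that pid by (cases "i = p") auto
      have O: "?O \<rho> = ?O \<tau>" using pw by auto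
      show "\<rho> = \<tau>"
      proof
        fix x
        show "\<rho> x = \<tau> x"
        proof (cases "x \<in> ?O \<rho>")
          case True
          then obtain i where i: "i < p" "x = (\<rho> ^^ i) a" by auto
          then have "\<rho> x = (\<rho> ^^ Suc i) a" "\<tau> x = (\<tau> ^^ Suc i) a" using pw[of i] by auto
          then show ?thesis using pw2[of "Suc i"] i by simp
        next
          case False
          have "(if x \<in> ?O \<rho> then x else \<rho> x) = (if x \<in> ?O \<tau> then x else \<tau> x)"
            using arg_cong[OF eq, of "\<lambda>q. snd q x"] by simp
          then show ?thesis using False O by simp
        qed
      qed
    qed
    have sub: "?\<Phi> ` free_perms p S \<subseteq> Sigma ?L' ?B"
    proof (rule image_subsetI)
      fix \<rho> assume \<rho>: "\<rho> \<in> free_perms p S"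
      note r = free_perms_remove_orbit[OF p \<rho> a]
      have "?xs \<rho> \<in> ?L'" using r(2,3) ins[of \<rho>] by auto
      then show "?\<Phi> \<rho> \<in> Sigma ?L' ?B" using r(1) ins[of \<rho>] by simp
    qed
    let ?s = "card S"
    have dvd: "p dvd ?s" using free_perms_dvd_card[OF p less.prems] False by blast
    have sp: "p \<le> ?s" using dvd a less.prems by (metis card_eq_0_iff dvd_imp_le empty_iff gr0I)
    have s0: "?s > 0" using sp p1 by simp
    have Ble: "card (?B xs) \<le> ?s ^ (?s - p - (?s div p - 1))" if "xs \<in> ?L'" for xs
    proof -
      let ?S = "S - insert a (set xs)"
      have c: "card ?S = ?s - p" using that a by (subst card_Diff_subset) auto
      have "card (?B xs) \<le> card ?S ^ (card ?S - card ?S div p)"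
        using less.hyps[of ?S] c sp p1 less.prems by simp
      also have "\<dots> = (?s - p) ^ (?s - p - (?s div p - 1))"
        using c dvd sp p1 by (simp add: le_div_geq)
      also have "\<dots> \<le> ?s ^ (?s - p - (?s div p - 1))" by (intro power_mono) auto
      finally show ?thesis .
    qed
    have "card (free_perms p S) = card (?\<Phi> ` free_perms p S)" using inj by (simp add: card_image)
    also have "\<dots> \<le> card (Sigma ?L' ?B)"
      using sub finL' less.prems by (intro card_mono finite_SigmaI finite_free_perms) auto
    also have "\<dots> = (\<Sum>xs\<in>?L'. card (?B xs))"
      using less.prems by (intro card_SigmaI[OF finL'] ballI finite_free_perms) auto
    also have "\<dots> \<le> (\<Sum>xs\<in>?L'. ?s ^ (?s - p - (?s div p - 1)))"
      using Ble by (intro sum_mono) auto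
    also have "\<dots> = card ?L' * ?s ^ (?s - p - (?s div p - 1))" by simp
    also have "\<dots> \<le> card ?L * ?s ^ (?s - p - (?s div p - 1))"
      by (intro mult_right_mono card_mono[OF finL]) auto
    also have "card ?L = ?s ^ (p - 1)" using card_lists_length_eq[OF less.prems] by simp
    also have "?s ^ (p - 1) * ?s ^ (?s - p - (?s div p - 1)) = ?s ^ (?s - ?s div p)"
    proof -
      obtain l where l: "?s = p * l" using dvd by blast
      then have lp: "?s div p = l" "l > 0" using p1 s0 by auto
      obtain l' where l': "l = Suc l'" using lp gr0_implies_Suc by blast
      have "l' \<le> p * l'" using p1 by simp
      then have "p - 1 + (?s - p - (?s div p - 1)) = ?s - ?s div p"
        unfolding lp(1) using l l' p1 by simp
      then show ?thesis by (metis power_add)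
    qed
    finally show ?thesis .
  qed
qed

text \<open>An invariant set is a union of orbits, so the sum is the product of \<open>1 + W\<close>
  over all orbits, \<open>W\<close> being the weight product of an orbit, and
  \<open>1 + W \<le> exp W\<close>. Every orbit has size \<open>1\<close> or \<open>p\<close> and
  constant weight. In the second case \<open>W = w e ^ p\<close>, which is the sum of
  \<open>w e ^ p\<close> over the orbit divided by \<open>p\<close>.\<close>

lemma sum_invariant_subsets_le:
  fixes w :: "'e \<Rightarrow> real"
  assumes p: "prime p" and "finite U"
    and "\<And>x. x \<in> U \<Longrightarrow> f x \<in> U" "\<And>x. x \<in> U \<Longrightarrow> (f ^^ p) x = x"
    and "\<And>x. x \<in> U \<Longrightarrow> w (f x) = w x" "\<And>x. x \<in> U \<Longrightarrow> w x \<ge> 0"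
  shows "(\<Sum>T | T \<subseteq> U \<and> f ` T \<subseteq> T. \<Prod>e\<in>T. w e)
           \<le> exp ((\<Sum>e | e \<in> U \<and> f e = e. w e) + (\<Sum>e | e \<in> U \<and> f e \<noteq> e. w e ^ p) / real p)"
  using assms(2-)
proof (induction "card U" arbitrary: U rule: less_induct)
  case less
  have p0: "p > 0" using p prime_gt_0_nat by blast
  show ?case
  proof (cases "U = {}")
    case True
    then have "{T. T \<subseteq> U \<and> f ` T \<subseteq> T} = {{}}" by auto
    then show ?thesis using True by simp
  next
    case False
    then obtain x where x: "x \<in> U" by auto
    define O' where "O' = (\<lambda>i. (f ^^ i) x) ` {..<p}"
    have fO: "finite O'" by (simp add: O'_def)
    have itU: "(f ^^ i) x \<in> U" for i using x less.prems by (induction i) auto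
    have OU: "O' \<subseteq> U" using itU by (auto simp: O'_def)
    have xO: "x \<in> O'" using p0 by (auto simp: O'_def intro!: image_eqI[of _ _ 0])
    have cl: "f y \<in> O'" if yO: "y \<in> O'" for y
    proof -
      obtain i where i: "i < p" "y = (f ^^ i) x" using yO by (auto simp: O'_def)
      show ?thesis
      proof (cases "Suc i < p")
        case True
        then show ?thesis using i by (auto simp: O'_def intro!: image_eqI[of _ _ "Suc i"])
      next
        case False
        then have "Suc i = p" using i by simp
        then have "f y = x" using i less.prems(3)[OF x] by (metis funpow.simps(2) comp_apply)
        then show ?thesis using xO by simp
      qed
    qed
    \<comment> \<open>An invariant set that meets the orbit contains all of it: since
      \<open>f ^^ p\<close> fixes \<open>x\<close>, every point of the orbit is reached from
      \<open>y\<close> by forward iteration.\<close>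
    have whole: "O' \<subseteq> T" if "T \<subseteq> U" "f ` T \<subseteq> T" and yO: "y \<in> O'" and "y \<in> T" for T y
    proof -
      have it: "(f ^^ k) y \<in> T" for k using that by (induction k) auto
      obtain i where i: "i < p" "y = (f ^^ i) x" using yO by (auto simp: O'_def)
      have "(f ^^ j) x \<in> T" for j
      proof -
        have "(f ^^ (j + (p - i))) y = (f ^^ (j + (p - i) + i)) x" by (simp only: i(2) funpow_add comp_apply)
        also have "j + (p - i) + i = j + p" using i by simp
        also have "(f ^^ (j + p)) x = (f ^^ j) x" using less.prems(3)[OF x] by (simp add: funpow_add)
        finally show ?thesis using it by metis
      qed
      then show ?thesis by (auto simp: O'_def)
    qed
    define U' where "U' = U - O'"
    have bwd: "f y \<notin> O'" if "y \<in> U'" for y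
    proof
      assume "f y \<in> O'"
      then have it: "(f ^^ k) (f y) \<in> O'" for k using cl by (induction k) auto
      have "(f ^^ (p - 1)) (f y) = (f ^^ p) y" using p0
        by (metis Suc_diff_1 comp_apply funpow_Suc_right)
      then show False using it[of "p - 1"] less.prems(3)[of y] that by (auto simp: U'_def)
    qed
    have cU': "card U' < card U" unfolding U'_def using xO x less.prems(1)
      by (intro psubset_card_mono) auto
    have wO: "w y = w x" if "y \<in> O'" for y
    proof -
      have "w ((f ^^ i) x) = w x" for i using itU less.prems(4) by (induction i) auto
      then show ?thesis using that by (auto simp: O'_def)
    qed
    define W where "W = (\<Prod>e\<in>O'. w e)"
    have W0: "W \<ge> 0" unfolding W_def using OU less.prems(5) by (intro prod_nonneg) auto
    let ?I = "\<lambda>U. {T. T \<subseteq> U \<and> f ` T \<subseteq> T}"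
    have fI: "finite (?I U)" "finite (?I U')" using less.prems(1) by (auto simp: U'_def)
    \<comment> \<open>Invariant subsets either avoid the orbit or contain it. This is the factor
      \<open>1 + W\<close> of one orbit.\<close>
    have "?I U = ?I U' \<union> (\<lambda>T. T \<union> O') ` ?I U'"
    proof (intro equalityI subsetI)
      fix T assume T: "T \<in> ?I U"
      show "T \<in> ?I U' \<union> (\<lambda>T. T \<union> O') ` ?I U'"
      proof (cases "T \<inter> O' = {}")
        case True
        then show ?thesis using T by (auto simp: U'_def)
      next
        case False
        then have "O' \<subseteq> T" using whole T by blast
        then have "T = (T - O') \<union> O'" by auto
        moreover have "T - O' \<in> ?I U'" using T bwd by (auto simp: U'_def)
        ultimately show ?thesis by blast
      qed
    next
      fix T assume "T \<in> ?I U' \<union> (\<lambda>T. T \<union> O') ` ?I U'"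
      then show "T \<in> ?I U" using OU cl by (auto simp: U'_def)
    qed
    moreover have "?I U' \<inter> (\<lambda>T. T \<union> O') ` ?I U' = {}" using xO by (auto simp: U'_def)
    ultimately have "(\<Sum>T\<in>?I U. \<Prod>e\<in>T. w e)
        = (\<Sum>T\<in>?I U'. \<Prod>e\<in>T. w e) + (\<Sum>T\<in>(\<lambda>T. T \<union> O') ` ?I U'. \<Prod>e\<in>T. w e)"
      using fI(2) by (simp add: sum.union_disjoint)
    also have "(\<Sum>T\<in>(\<lambda>T. T \<union> O') ` ?I U'. \<Prod>e\<in>T. w e) = (\<Sum>T\<in>?I U'. \<Prod>e\<in>T \<union> O'. w e)"
      by (rule sum.reindex[unfolded comp_def]) (auto simp: inj_on_def U'_def)
    also have "\<dots> = (\<Sum>T\<in>?I U'. (\<Prod>e\<in>T. w e) * W)"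
    proof (rule sum.cong[OF refl])
      fix T assume "T \<in> ?I U'"
      then have "finite T" "T \<inter> O' = {}" using less.prems(1) by (auto simp: U'_def intro: finite_subset)
      then show "(\<Prod>e\<in>T \<union> O'. w e) = (\<Prod>e\<in>T. w e) * W"
        unfolding W_def using fO by (subst prod.union_disjoint) auto
    qed
    also have "(\<Sum>T\<in>?I U'. \<Prod>e\<in>T. w e) + \<dots> = (1 + W) * (\<Sum>T\<in>?I U'. \<Prod>e\<in>T. w e)"
      by (simp add: sum_distrib_right[symmetric] sum_distrib_left[symmetric] algebra_simps)
    also have "\<dots> \<le> exp W * exp ((\<Sum>e | e \<in> U' \<and> f e = e. w e) + (\<Sum>e | e \<in> U' \<and> f e \<noteq> e. w e ^ p) / real p)"
    proof (intro mult_mono)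
      show "(\<Sum>T\<in>?I U'. \<Prod>e\<in>T. w e) \<le> exp ((\<Sum>e | e \<in> U' \<and> f e = e. w e) + (\<Sum>e | e \<in> U' \<and> f e \<noteq> e. w e ^ p) / real p)"
        using less.prems bwd cU' by (intro less.hyps) (auto simp: U'_def)
      show "(\<Sum>T\<in>?I U'. \<Prod>e\<in>T. w e) \<ge> 0"
        using less.prems(5) by (intro sum_nonneg prod_nonneg) (auto simp: U'_def)
    qed (use W0 in \<open>auto simp: exp_ge_add_one_self\<close>)
    also have "\<dots> = exp ((\<Sum>e | e \<in> U \<and> f e = e. w e) + (\<Sum>e | e \<in> U \<and> f e \<noteq> e. w e ^ p) / real p)"
    proof (cases "f x = x")
      case True
      then have "(f ^^ i) x = x" for i by (induction i) auto
      then have Ox: "O' = {x}" using p0 by (auto simp: O'_def)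
      then have "W = w x" by (simp add: W_def)
      have "{e. e \<in> U \<and> f e = e} = insert x {e. e \<in> U' \<and> f e = e}" using x True Ox by (auto simp: U'_def)
      moreover have "{e. e \<in> U \<and> f e \<noteq> e} = {e. e \<in> U' \<and> f e \<noteq> e}" using True Ox by (auto simp: U'_def)
      ultimately show ?thesis using \<open>W = w x\<close> less.prems(1) Ox
        by (simp add: exp_add U'_def sum.insert)
    next
      case False
      have inj: "inj_on (\<lambda>i. (f ^^ i) x) {..<p}" using prime_order_orbit_inj[OF p less.prems(3)[OF x] False] .
      then have cO: "card O' = p" by (simp add: O'_def card_image)
      then have W: "W = w x ^ p" unfolding W_def using wO by simp
      have ne: "f y \<noteq> y" if yO: "y \<in> O'" for y
      proof
        assume fy: "f y = y"
        then have it: "(f ^^ k) y = y" for k by (induction k) auto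
        obtain i where i: "i < p" "y = (f ^^ i) x" using yO by (auto simp: O'_def)
        have "(f ^^ (p - i)) y = (f ^^ (p - i + i)) x" by (simp only: i(2) funpow_add comp_apply)
        then have "y = x" using i it less.prems(3)[OF x] by simp
        then show False using fy False by simp
      qed
      have "{e. e \<in> U \<and> f e = e} = {e. e \<in> U' \<and> f e = e}" using ne by (auto simp: U'_def)
      moreover have "{e. e \<in> U \<and> f e \<noteq> e} = O' \<union> {e. e \<in> U' \<and> f e \<noteq> e}" using ne OU by (auto simp: U'_def)
      moreover have "(\<Sum>e\<in>O' \<union> {e. e \<in> U' \<and> f e \<noteq> e}. w e ^ p) = (\<Sum>e\<in>O'. w e ^ p) + (\<Sum>e | e \<in> U' \<and> f e \<noteq> e. w e ^ p)"
        using fO less.prems(1) by (intro sum.union_disjoint) (auto simp: U'_def)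
      moreover have "(\<Sum>e\<in>O'. w e ^ p) = real p * W" using wO W cO by simp
      ultimately show ?thesis using p0 by (simp add: exp_add add_divide_distrib)
    qed
    finally show ?thesis .
  qed
qed

section \<open>A first moment bound for automorphisms\<close>

text \<open>The colour allows two parallel edges on the same pair, as they occur in the kernel of a
  chorded cycle. Graphs without such edges are embedded with the constant colour
  \<open>True\<close>.\<close>

definition coloured_pairs :: "'a set \<Rightarrow> (bool \<times> 'a set) set" where
  "coloured_pairs V = {ce. snd ce \<subseteq> V \<and> card (snd ce) = 2}"

definition coloured_auto :: "'a set \<Rightarrow> (bool \<times> 'a set) set \<Rightarrow> ('a \<Rightarrow> 'a) \<Rightarrow> bool" where
  "coloured_auto V E \<pi> \<longleftrightarrow> \<pi> permutes V \<and> (\<lambda>(c, e). (c, \<pi> ` e)) ` E \<subseteq> E"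

lemma finite_coloured_pairs: "finite V \<Longrightarrow> finite (coloured_pairs V)"
  by (rule finite_subset[of _ "UNIV \<times> Pow V"]) (auto simp: coloured_pairs_def)

lemma coloured_auto_funpow: "coloured_auto V E \<pi> \<Longrightarrow> coloured_auto V E (\<pi> ^^ k)"
proof (induction k)
  case 0
  then show ?case by (auto simp: coloured_auto_def permutes_id[unfolded id_def])
next
  case (Suc k)
  then have "\<pi> permutes V" "(\<pi> ^^ k) permutes V" by (auto simp: coloured_auto_def)
  then have "(\<pi> ^^ Suc k) permutes V" by (simp add: permutes_compose)
  moreover have "(c, (\<pi> ^^ Suc k) ` e) \<in> E" if "(c, e) \<in> E" for c e
  proof -
    have "(c, (\<pi> ^^ k) ` e) \<in> E" using Suc that by (auto simp: coloured_auto_def)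
    then have "(c, \<pi> ` (\<pi> ^^ k) ` e) \<in> E" using Suc by (auto simp: coloured_auto_def)
    then show ?thesis by (simp add: image_comp)
  qed
  ultimately show ?case by (auto simp: coloured_auto_def simp del: funpow.simps)
qed

text \<open>
  The factor \<open>\<mu> ^ (degree sum - 3 * s)\<close> is at least \<open>1\<close> for the sets of edges in question. Inserting it
  allows the sum to range over all invariant sets, where it factors over the orbits.
\<close>

lemma card_invariant_graphs_le:
  fixes E :: "'w \<Rightarrow> (bool \<times> 'a set) set" and z \<mu> :: real
  assumes fin: "finite V" "finite \<Omega>" and p: "prime p"
    and E: "\<And>\<omega>. \<omega> \<in> \<Omega> \<Longrightarrow> E \<omega> \<subseteq> coloured_pairs V"
    and prob: "\<And>T. T \<subseteq> coloured_pairs V \<Longrightarrow>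
                 real (card {\<omega> \<in> \<Omega>. T \<subseteq> E \<omega>}) \<le> z ^ card T * real (card \<Omega>)"
    and z: "z \<ge> 0" and \<mu>: "\<mu> \<ge> 1"
    and \<rho>: "\<rho> \<in> free_perms p S" and S: "S \<subseteq> V" "s = card S"
  shows "real (card {\<omega> \<in> \<Omega>. (\<forall>v\<in>V. 3 \<le> card {ce \<in> E \<omega>. v \<in> snd ce}) \<and> coloured_auto V (E \<omega>) \<rho>})
     \<le> real (card \<Omega>) * exp (2 * real s * (z * \<mu>\<^sup>2) + (2 * (real s)\<^sup>2 * (z * \<mu>\<^sup>2) ^ p + 2 * real s * real (card V) * (z * \<mu>) ^ p) / p) / \<mu> ^ (3 * s)"
proof -
  define f where "f = (\<lambda>(c :: bool, e). (c, \<rho> ` e))"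
  define U where "U = {ce \<in> coloured_pairs V. snd ce \<inter> S \<noteq> {}}"
  define w where "w = (\<lambda>ce :: bool \<times> 'a set. z * \<mu> ^ card (snd ce \<inter> S))"
  define I where "I = {T. T \<subseteq> U \<and> f ` T \<subseteq> T}"
  have finS: "finite S" using S fin finite_subset by blast
  have finU: "finite U" unfolding U_def using finite_coloured_pairs[OF fin(1)] by simp
  have perm: "\<rho> permutes S" and pw: "\<rho> ^^ p = id" and free: "\<And>x. x \<in> S \<Longrightarrow> \<rho> x \<noteq> x"
    using \<rho> by (auto simp: free_perms_def)
  have inj: "inj \<rho>" using perm permutes_inj by blast
  have permV: "\<rho> permutes V" using permutes_subset[OF perm S(1)] .
  have img_S: "\<rho> ` e \<inter> S = \<rho> ` (e \<inter> S)" for e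
    using perm inj by (metis image_Int permutes_image)
  have card_img: "card (\<rho> ` e) = card e" for e using inj by (meson card_image inj_on_subset subset_UNIV)
  have fU: "f ce \<in> U" if "ce \<in> U" for ce
    using that permV unfolding U_def f_def coloured_pairs_def
    by (auto simp: card_img img_S permutes_in_image split: prod.splits)
  have fp: "(f ^^ p) ce = ce" for ce
  proof -
    have "(f ^^ k) (c, e) = (c, (\<rho> ^^ k) ` e)" for k c e
      by (induction k) (auto simp: f_def image_comp)
    then show ?thesis using pw by (cases ce) simp
  qed
  have wf: "w (f ce) = w ce" for ce
    unfolding w_def f_def by (auto simp: img_S card_img split: prod.splits)
  have w0: "w ce \<ge> 0" for ce using z \<mu> by (simp add: w_def)
  let ?deg = "\<lambda>T. \<Sum>ce\<in>T. card (snd ce \<inter> S)"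
  let ?A = "{\<omega> \<in> \<Omega>. (\<forall>v\<in>V. 3 \<le> card {ce \<in> E \<omega>. v \<in> snd ce}) \<and> coloured_auto V (E \<omega>) \<rho>}"
  let ?J = "{T \<in> I. 3 * s \<le> ?deg T}"
  have finI: "finite I" using finU by (auto simp: I_def)
  \<comment> \<open>For a bad outcome take as \<open>T\<close> all edges meeting the support. It is
    invariant, and counting incidences shows that the degrees of the support inside \<open>T\<close>
    add up to at least \<open>3 * s\<close>.\<close>
  have "?A \<subseteq> (\<Union>T\<in>?J. {\<omega> \<in> \<Omega>. T \<subseteq> E \<omega>})"
  proof
    fix \<omega> assume \<omega>: "\<omega> \<in> ?A"
    define T where "T = E \<omega> \<inter> U"
    have finE: "finite (E \<omega>)"
      using \<omega> E finite_coloured_pairs[OF fin(1)] finite_subset by (metis (lifting) mem_Collect_eq)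
    have "f ` E \<omega> \<subseteq> E \<omega>" using \<omega> by (simp add: coloured_auto_def f_def)
    then have "T \<in> I" using fU by (auto simp: I_def T_def)
    moreover have "3 * s \<le> ?deg T"
    proof -
      have "3 * s = (\<Sum>v\<in>S. 3)" using S by simp
      also have "\<dots> \<le> (\<Sum>v\<in>S. card {ce \<in> T. v \<in> snd ce})"
      proof (rule sum_mono)
        fix v assume v: "v \<in> S"
        have "{ce \<in> T. v \<in> snd ce} = {ce \<in> E \<omega>. v \<in> snd ce}"
          using v E \<omega> by (auto simp: T_def U_def)
        then show "3 \<le> card {ce \<in> T. v \<in> snd ce}" using \<omega> v S by auto
      qed
      also have "\<dots> = (\<Sum>ce\<in>T. card {v \<in> S. v \<in> snd ce})"
        using finS finE by (intro sum_multicount_gen) (auto simp: T_def)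
      also have "\<dots> = ?deg T" by (intro sum.cong refl arg_cong[where f = card]) auto
      finally show ?thesis .
    qed
    ultimately show "\<omega> \<in> (\<Union>T\<in>?J. {\<omega> \<in> \<Omega>. T \<subseteq> E \<omega>})"
      using \<omega> by (auto simp: T_def)
  qed
  then have "card ?A \<le> card (\<Union>T\<in>?J. {\<omega> \<in> \<Omega>. T \<subseteq> E \<omega>})"
    using fin finI by (intro card_mono) auto
  also have "\<dots> \<le> (\<Sum>T\<in>?J. card {\<omega> \<in> \<Omega>. T \<subseteq> E \<omega>})"
    using finI by (intro card_UN_le) auto
  finally have "real (card ?A) \<le> real (\<Sum>T\<in>?J. card {\<omega> \<in> \<Omega>. T \<subseteq> E \<omega>})"
    by (rule of_nat_mono)
  also have "\<dots> = (\<Sum>T\<in>?J. real (card {\<omega> \<in> \<Omega>. T \<subseteq> E \<omega>}))" by simp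
  also have "\<dots> \<le> (\<Sum>T\<in>?J. (\<Prod>ce\<in>T. w ce) * real (card \<Omega>) / \<mu> ^ (3 * s))"
  proof (rule sum_mono)
    fix T assume T: "T \<in> ?J"
    then have "T \<subseteq> coloured_pairs V" by (auto simp: I_def U_def)
    have "(\<Prod>ce\<in>T. w ce) = z ^ card T * \<mu> ^ ?deg T"
      by (simp add: w_def prod.distrib power_sum)
    moreover have "\<mu> ^ (3 * s) \<le> \<mu> ^ ?deg T" using T \<mu> by (intro power_increasing) auto
    then have "1 \<le> \<mu> ^ ?deg T / \<mu> ^ (3 * s)" using \<mu> by simp
    ultimately have "(\<Prod>ce\<in>T. w ce) * real (card \<Omega>) / \<mu> ^ (3 * s)
        = (z ^ card T * real (card \<Omega>)) * (\<mu> ^ ?deg T / \<mu> ^ (3 * s))" by simp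
    also have "\<dots> \<ge> (z ^ card T * real (card \<Omega>)) * 1"
      using z \<open>1 \<le> \<mu> ^ ?deg T / \<mu> ^ (3 * s)\<close> by (intro mult_left_mono) auto
    finally show "real (card {\<omega> \<in> \<Omega>. T \<subseteq> E \<omega>}) \<le> (\<Prod>ce\<in>T. w ce) * real (card \<Omega>) / \<mu> ^ (3 * s)"
      using prob[OF \<open>T \<subseteq> coloured_pairs V\<close>] by simp
  qed
  also have "\<dots> \<le> (\<Sum>T\<in>I. (\<Prod>ce\<in>T. w ce) * real (card \<Omega>) / \<mu> ^ (3 * s))"
    using finI w0 \<mu> by (intro sum_mono2) (auto intro!: prod_nonneg divide_nonneg_nonneg mult_nonneg_nonneg)
  also have "\<dots> = real (card \<Omega>) * (\<Sum>T\<in>I. \<Prod>ce\<in>T. w ce) / \<mu> ^ (3 * s)"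
    by (simp add: sum_distrib_left sum_divide_distrib mult.commute)
  also have "\<dots> \<le> real (card \<Omega>) * exp (2 * real s * (z * \<mu>\<^sup>2) + (2 * (real s)\<^sup>2 * (z * \<mu>\<^sup>2) ^ p + 2 * real s * real (card V) * (z * \<mu>) ^ p) / p) / \<mu> ^ (3 * s)"
  proof (intro divide_right_mono mult_left_mono)
    have "(\<Sum>T\<in>I. \<Prod>ce\<in>T. w ce)
        \<le> exp ((\<Sum>e | e \<in> U \<and> f e = e. w e) + (\<Sum>e | e \<in> U \<and> f e \<noteq> e. w e ^ p) / real p)"
      unfolding I_def by (rule sum_invariant_subsets_le[OF p finU]) (use fU fp wf w0 in auto)
    also have "\<dots> \<le> exp (2 * real s * (z * \<mu>\<^sup>2) + (2 * (real s)\<^sup>2 * (z * \<mu>\<^sup>2) ^ p + 2 * real s * real (card V) * (z * \<mu>) ^ p) / p)"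
    proof -
      have pair: "\<exists>u v. e = {u, v} \<and> u \<noteq> v \<and> u \<in> V \<and> v \<in> V" if "(c, e) \<in> coloured_pairs V" for c e
        using that by (auto simp: coloured_pairs_def card_2_iff)
      have "(\<Sum>e | e \<in> U \<and> f e = e. w e) \<le> 2 * real s * (z * \<mu>\<^sup>2)"
      proof -
        \<comment> \<open>An edge fixed by \<open>\<rho>\<close> that meets the support contains
          some \<open>u\<close> with \<open>\<rho> u \<noteq> u\<close>, so it equals
          \<open>{u, \<rho> u}\<close>. There are at most \<open>s\<close> such pairs, in two
          colours, and both ends lie in the support, hence the weight
          \<open>z * \<mu>\<^sup>2\<close>.\<close>
        have sub: "{e. e \<in> U \<and> f e = e} \<subseteq> (\<lambda>(c, u). (c, {u, \<rho> u})) ` (UNIV \<times> S)"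
        proof
          fix ce assume "ce \<in> {e. e \<in> U \<and> f e = e}"
          then obtain c e where ce: "ce = (c, e)" "(c, e) \<in> coloured_pairs V" "e \<inter> S \<noteq> {}" "\<rho> ` e = e"
            by (cases ce) (auto simp: U_def f_def)
          then obtain u where u: "u \<in> e" "u \<in> S" by blast
          then have "\<rho> u \<in> e" "\<rho> u \<noteq> u" using ce free by auto
          then have "e = {u, \<rho> u}" using pair[OF ce(2)] u by auto
          then show "ce \<in> (\<lambda>(c, u). (c, {u, \<rho> u})) ` (UNIV \<times> S)" using u ce by force
        qed
        have "(\<Sum>e | e \<in> U \<and> f e = e. w e) = (\<Sum>e | e \<in> U \<and> f e = e. z * \<mu>\<^sup>2)"
        proof (rule sum.cong[OF refl])
          fix ce assume "ce \<in> {e. e \<in> U \<and> f e = e}"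
          then obtain c u where cu: "ce = (c, {u, \<rho> u})" "u \<in> S" using sub by force
          then have "\<rho> u \<in> S" "\<rho> u \<noteq> u" using perm free by (auto simp: permutes_in_image)
          then have "card ({u, \<rho> u} \<inter> S) = 2" using cu by simp
          then show "w ce = z * \<mu>\<^sup>2" using cu by (simp add: w_def)
        qed
        also have "\<dots> = real (card {e. e \<in> U \<and> f e = e}) * (z * \<mu>\<^sup>2)" by simp
        also have "card {e. e \<in> U \<and> f e = e} \<le> card ((UNIV :: bool set) \<times> S)"
          using surj_card_le[OF _ sub] finS by simp
        then have "real (card {e. e \<in> U \<and> f e = e}) * (z * \<mu>\<^sup>2) \<le> real (card ((UNIV :: bool set) \<times> S)) * (z * \<mu>\<^sup>2)"
          using z by (intro mult_right_mono) auto
        finally show ?thesis using S by (simp add: card_cartesian_product)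
      qed
      moreover have "(\<Sum>e | e \<in> U \<and> f e \<noteq> e. w e ^ p) \<le> 2 * (real s)\<^sup>2 * (z * \<mu>\<^sup>2) ^ p + 2 * real s * real (card V) * (z * \<mu>) ^ p"
      proof -
        \<comment> \<open>The other edges either lie inside the support and have weight
          \<open>z * \<mu>\<^sup>2\<close>, or have exactly one end in it and weight
          \<open>z * \<mu>\<close>. The factor \<open>2\<close> in the counts is the number of
          colours.\<close>
        let ?U1 = "(\<lambda>(c :: bool, u, v). (c, {u, v})) ` (UNIV \<times> S \<times> S)"
        let ?U2 = "(\<lambda>(c :: bool, u, v). (c, {u, v})) ` (UNIV \<times> S \<times> V)"
        have cU1: "card ?U1 \<le> 2 * s\<^sup>2"
          using card_image_le[of "(UNIV :: bool set) \<times> S \<times> S" "\<lambda>(c :: bool, u, v). (c, {u, v})"] finS S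
          by (simp add: card_cartesian_product power2_eq_square)
        have cU2: "card ?U2 \<le> 2 * (s * card V)"
          using card_image_le[of "(UNIV :: bool set) \<times> S \<times> V" "\<lambda>(c :: bool, u, v). (c, {u, v})"] finS fin S
          by (simp add: card_cartesian_product)
        have "(\<Sum>e | e \<in> U \<and> f e \<noteq> e. w e ^ p) \<le> (\<Sum>e\<in>U. w e ^ p)"
          using finU w0 by (intro sum_mono2) auto
        also have "\<dots> \<le> (\<Sum>e\<in>U. (if e \<in> ?U1 then (z * \<mu>\<^sup>2) ^ p else 0) + (if e \<in> ?U2 then (z * \<mu>) ^ p else 0))"
        proof (rule sum_mono)
          fix ce assume ceU: "ce \<in> U"
          obtain c e where ce: "ce = (c, e)" "(c, e) \<in> coloured_pairs V" "e \<inter> S \<noteq> {}"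
            using ceU by (cases ce) (auto simp: U_def)
          obtain u v where uv: "e = {u, v}" "u \<noteq> v" "u \<in> V" "v \<in> V" using pair[OF ce(2)] by blast
          have nn: "0 \<le> (z * \<mu>\<^sup>2) ^ p" "0 \<le> (z * \<mu>) ^ p" using z \<mu> by auto
          show "w ce ^ p \<le> (if ce \<in> ?U1 then (z * \<mu>\<^sup>2) ^ p else 0) + (if ce \<in> ?U2 then (z * \<mu>) ^ p else 0)"
          proof (cases "u \<in> S \<and> v \<in> S")
            case True
            then have "w ce = z * \<mu>\<^sup>2" using ce uv by (simp add: w_def power2_eq_square)
            moreover have "ce \<in> ?U1" using True ce uv by force
            ultimately show ?thesis using nn by auto
          next
            case False
            then have "e \<inter> S = {u} \<and> u \<in> S \<or> e \<inter> S = {v} \<and> v \<in> S" using uv ce by auto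
            then have "w ce = z * \<mu>" using ce by (auto simp: w_def)
            moreover have "ce \<in> ?U2"
            proof (cases "u \<in> S")
              case True
              then show ?thesis using ce uv by (intro image_eqI[of _ _ "(c, u, v)"]) auto
            next
              case False
              then have "v \<in> S" using ce uv by auto
              then show ?thesis using ce uv by (intro image_eqI[of _ _ "(c, v, u)"]) auto
            qed
            ultimately show ?thesis using nn by auto
          qed
        qed
        also have "\<dots> = real (card (U \<inter> ?U1)) * (z * \<mu>\<^sup>2) ^ p + real (card (U \<inter> ?U2)) * (z * \<mu>) ^ p"
          using finU by (simp add: sum.distrib sum.If_cases Int_def)
        also have "\<dots> \<le> real (2 * s\<^sup>2) * (z * \<mu>\<^sup>2) ^ p + real (2 * (s * card V)) * (z * \<mu>) ^ p"
        proof (intro add_mono mult_right_mono of_nat_mono)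
          show "card (U \<inter> ?U1) \<le> 2 * s\<^sup>2"
            by (rule order_trans[OF card_mono cU1]) (use finS in auto)
          show "card (U \<inter> ?U2) \<le> 2 * (s * card V)"
            by (rule order_trans[OF card_mono cU2]) (use finS fin in auto)
        qed (use z \<mu> in auto)
        finally show ?thesis by (simp add: mult.assoc)
      qed
      ultimately show ?thesis using p prime_gt_0_nat by (auto intro!: add_mono divide_right_mono)
    qed
    finally show "(\<Sum>T\<in>I. \<Prod>ce\<in>T. w ce) \<le> exp (2 * real s * (z * \<mu>\<^sup>2) + (2 * (real s)\<^sup>2 * (z * \<mu>\<^sup>2) ^ p + 2 * real s * real (card V) * (z * \<mu>) ^ p) / p)" .
  qed (use \<mu> in auto)
  finally show ?thesis .
qed

text \<open>A single term of the exponential series. It takes the place of Stirling's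
  formula.\<close>

lemma power_le_exp_fact: "real s ^ s \<le> exp s * fact s"
proof -
  have "(\<lambda>n. real s ^ n / fact n) sums exp (real s)"
    using exp_converges[of "real s"] by (simp add: field_simps)
  then have sm: "summable (\<lambda>n. real s ^ n / fact n)" and "(\<Sum>n. real s ^ n / fact n) = exp (real s)"
    by (auto simp: sums_iff)
  then have "(\<Sum>n\<in>{s}. real s ^ n / fact n) \<le> exp (real s)"
    using sum_le_suminf[OF sm, of "{s}"] by simp
  then show ?thesis by (simp add: field_simps)
qed

text \<open>
  This \<open>\<mu>\<close> is, up to a small power of \<open>N\<close>, the largest one for which the orbits inside the support, the
  orbits leaving it and the edges fixed by the automorphism each contribute \<open>O(s)\<close> to the exponent.
\<close>

lemma binomial_free_perms_bound:
  fixes N s p :: nat and \<mu> :: real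
  assumes p: "2 \<le> p" "p dvd s" and s: "0 < s" "s \<le> N"
  defines "\<mu> \<equiv> exp (11 / 24 * ln N - ln s / (2 * p))"
  shows "real (N choose s) * real s ^ (s - s div p) * (exp (4 * s) / \<mu> ^ (3 * s))
           \<le> (exp 5 * real N powr (-1/8)) ^ s"
proof -
  define a b where "a = ln (real N)" and "b = ln (real s)"
  have ab: "0 \<le> b" "b \<le> a" using s by (auto simp: a_def b_def)
  have N: "real N = exp a" and S: "real s = exp b" using s by (auto simp: a_def b_def)
  have pw: "exp x ^ k = exp (real k * x)" for x :: real and k by (simp add: exp_of_nat_mult)
  have "real (N choose s) * fact s \<le> real N ^ s"
    using binomial_fact_pow[of N s] by (metis of_nat_fact of_nat_le_iff of_nat_mult of_nat_power)
  then have "real (N choose s) * fact s * exp s \<le> real N ^ s * exp s"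
    by (intro mult_right_mono) auto
  moreover have "real (N choose s) * real s ^ s \<le> real (N choose s) * (exp s * fact s)"
    using power_le_exp_fact by (intro mult_left_mono) auto
  ultimately have "real (N choose s) * real s ^ s \<le> real N ^ s * exp s"
    by (smt (verit, best) mult.assoc mult.commute)
  then have "real (N choose s) * exp (s * b) \<le> exp (s * a + s)"
    unfolding N S pw by (simp add: exp_add)
  then have c: "real (N choose s) \<le> exp (s * a + s - s * b)"
    by (simp add: exp_diff field_simps)
  have "s div p \<le> s" by simp
  have "real s ^ (s - s div p) = exp ((real s - real s / p) * b)"
  proof -
    have "real s ^ (s - s div p) = exp (real (s - s div p) * b)" using S pw by metis
    also have "real (s - s div p) = real s - real s / p"
      using \<open>s div p \<le> s\<close> p(2) by (simp add: of_nat_diff real_of_nat_div)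
    finally show ?thesis .
  qed
  moreover have "\<mu> ^ (3 * s) = exp (3 * s * (11 / 24 * a - b / (2 * p)))"
    unfolding \<mu>_def pw a_def b_def by (simp add: mult_ac)
  ultimately have "real (N choose s) * real s ^ (s - s div p) * (exp (4 * s) / \<mu> ^ (3 * s))
     \<le> exp (s * a + s - s * b) * exp ((real s - real s / p) * b) * (exp (4 * s) / exp (3 * s * (11 / 24 * a - b / (2 * p))))"
    using c by (auto intro!: mult_right_mono divide_right_mono)
  also have "\<dots> = exp (s * a + s - s * b + (real s - real s / p) * b + 4 * s - 3 * s * (11 / 24 * a - b / (2 * p)))"
    by (simp only: exp_add exp_diff) simp
  also have "\<dots> \<le> exp (s * (5 - a / 8))"
  proof -
    have "b / (2 * p) \<le> a / 4"
    proof -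
      have "b / (2 * p) \<le> b / 4" using p ab by (intro divide_left_mono) auto
      then show ?thesis using ab by simp
    qed
    then have "s * (b / (2 * p)) \<le> s * (a / 4)" by (intro mult_left_mono) auto
    \<comment> \<open>The coefficient of \<open>s * a\<close> is
      \<open>1 - 3 * 11/24 = -9/24\<close>. The remaining positive term is at most
      \<open>s * a / 4\<close> because \<open>p \<ge> 2\<close> and \<open>s \<le> N\<close>, which
      leaves \<open>-1/8\<close>.\<close>
    moreover have "s * a + s - s * b + (real s - real s / p) * b + 4 * s - 3 * s * (11 / 24 * a - b / (2 * p))
       = 5 * s - 9 / 24 * (s * a) + s * (b / (2 * p))"
      using p by (simp add: field_simps)
    ultimately show ?thesis by (simp add: algebra_simps)
  qed
  also have "\<dots> = (exp (5 - a / 8)) ^ s" by (simp add: pw)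
  also have "exp (5 - a / 8) = exp 5 * real N powr (-1/8)"
    using s by (simp add: powr_def a_def exp_add[symmetric])
  finally show ?thesis .
qed

text \<open>The three requirements on \<open>\<mu>\<close>. Here \<open>z * \<mu>\<^sup>2\<close> is
  \<open>N powr (-1/24) * s powr (-1/p)\<close>, so it is at most \<open>1\<close> and its power
  \<open>p\<close> is at most \<open>1 / s\<close>. Moreover
  \<open>z * \<mu> \<le> N powr (-1/2)\<close>, whose power \<open>p\<close> is at most
  \<open>1 / N\<close>; the constant \<open>11/24\<close> is \<open>23/24 - 1/2\<close>.\<close>

lemma orbit_exponent_bound:
  fixes N s p :: nat and \<mu> z :: real
  assumes p: "2 \<le> p" and s: "0 < s" "s \<le> N"
  defines "\<mu> \<equiv> exp (11 / 24 * ln N - ln s / (2 * p))" and "z \<equiv> real N powr (-23/24)"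
  shows "\<mu> \<ge> 1"
    and "2 * real s * (z * \<mu>\<^sup>2) + (2 * (real s)\<^sup>2 * (z * \<mu>\<^sup>2) ^ p + 2 * real s * real N * (z * \<mu>) ^ p) / p \<le> 4 * s"
proof -
  define a b where "a = ln (real N)" and "b = ln (real s)"
  have ab: "0 \<le> b" "b \<le> a" using s by (auto simp: a_def b_def)
  have N: "real N = exp a" and S: "real s = exp b" using s by (auto simp: a_def b_def)
  have pw: "exp x ^ k = exp (real k * x)" for x :: real and k by (simp add: exp_of_nat_mult)
  have z: "z = exp (-23/24 * a)" using s by (simp add: z_def powr_def a_def)
  have bp: "b / (2 * p) \<le> a / 4"
  proof -
    have "b / (2 * p) \<le> b / 4" using p ab by (intro divide_left_mono) auto
    then show ?thesis using ab by simp
  qed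
  have mu: "\<mu> = exp (11 / 24 * a - b / (2 * p))" by (simp add: \<mu>_def a_def b_def)
  show "\<mu> \<ge> 1" using bp ab by (simp add: mu)
  have z2: "z * \<mu>\<^sup>2 = exp (- a / 24 - b / p)"
    unfolding z mu pw by (simp add: exp_add[symmetric] field_simps)
  have "z * \<mu>\<^sup>2 \<le> 1"
  proof -
    have "0 \<le> b / p" using ab by simp
    then have "- a / 24 - b / p \<le> 0" using ab by linarith
    then show ?thesis unfolding z2 by (simp only: exp_le_one_iff)
  qed
  moreover have "s * (z * \<mu>\<^sup>2) ^ p \<le> 1"
    unfolding z2 S pw using p ab by (simp add: exp_add[symmetric] field_simps)
  moreover have "N * (z * \<mu>) ^ p \<le> 1"
  proof -
    have "z * \<mu> = exp (- a / 2 - b / (2 * p))" unfolding z mu by (simp add: exp_add[symmetric] field_simps)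
    also have "\<dots> \<le> exp (- a / 2)" using ab by simp
    finally have "(z * \<mu>) ^ p \<le> exp (- a / 2) ^ p" using z mu by (intro power_mono) auto
    also have "\<dots> \<le> exp (- a)"
      unfolding pw using mult_left_mono[of 2 "real p" a] p ab by (simp add: field_simps)
    finally have "N * (z * \<mu>) ^ p \<le> N * exp (- a)" by (intro mult_left_mono) auto
    also have "\<dots> = 1" by (simp add: N exp_minus)
    finally show ?thesis .
  qed
  ultimately have le: "2 * real s * (z * \<mu>\<^sup>2) \<le> 2 * real s * 1" "2 * real s * (real s * (z * \<mu>\<^sup>2) ^ p) \<le> 2 * real s * 1" "2 * real s * (real N * (z * \<mu>) ^ p) \<le> 2 * real s * 1"
    by (intro mult_left_mono; simp)+
  have "(2 * (real s)\<^sup>2 * (z * \<mu>\<^sup>2) ^ p + 2 * real s * real N * (z * \<mu>) ^ p) / p \<le> (4 * s) / p"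
    using le(2,3) by (intro divide_right_mono) (simp_all add: power2_eq_square algebra_simps)
  also have "\<dots> \<le> (4 * s) / 2" using p by (intro divide_left_mono) auto
  finally show "2 * real s * (z * \<mu>\<^sup>2) + (2 * (real s)\<^sup>2 * (z * \<mu>\<^sup>2) ^ p + 2 * real s * real N * (z * \<mu>) ^ p) / p \<le> 4 * s"
    using le(1) by simp
qed

text \<open>Since \<open>s \<le> 2 ^ s\<close>, the sum is dominated by a geometric series in
  \<open>2 * x \<le> 1/2\<close>. The sum starts at \<open>2\<close> because a nontrivial
  permutation moves at least two points; this gives the square of \<open>x\<close> on the
  right.\<close>

lemma sum_index_times_power_le:
  fixes x :: real
  assumes "0 \<le> x" "x \<le> 1 / 4"
  shows "(\<Sum>s = 2..N. real s * x ^ s) \<le> 8 * x\<^sup>2"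
proof -
  have le: "real s * x ^ s \<le> (2 * x)\<^sup>2 * (1 / 2) ^ (s - 2)" if "s \<ge> 2" for s :: nat
  proof -
    have "real s \<le> 2 ^ s" using of_nat_less_two_power[of s, where ?'a = real] by simp
    then have "real s * x ^ s \<le> 2 ^ s * x ^ s" using assms by (intro mult_right_mono) auto
    also have "\<dots> = (2 * x) ^ s" by (simp add: power_mult_distrib)
    also have "\<dots> = (2 * x) ^ (2 + (s - 2))" by (simp only: le_add_diff_inverse[OF that])
    also have "\<dots> = (2 * x)\<^sup>2 * (2 * x) ^ (s - 2)" by (simp only: power_add)
    also have "\<dots> \<le> (2 * x)\<^sup>2 * (1 / 2) ^ (s - 2)" using assms by (intro mult_left_mono power_mono) auto
    finally show ?thesis .
  qed
  have "(\<Sum>s = 2..N. real s * x ^ s) \<le> (\<Sum>s = 2..N. (2 * x)\<^sup>2 * (1 / 2) ^ (s - 2))"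
    using le by (intro sum_mono) auto
  also have "\<dots> = (2 * x)\<^sup>2 * (\<Sum>s = 2..N. (1 / 2) ^ (s - 2))" by (simp add: sum_distrib_left)
  also have "(\<Sum>s = 2..N. (1 / 2 :: real) ^ (s - 2)) = (\<Sum>s\<in>(\<lambda>s. s - 2) ` {2..N}. (1 / 2) ^ s)"
    by (rule sum.reindex[symmetric, unfolded comp_def]) (auto simp: inj_on_def)
  also have "\<dots> \<le> (\<Sum>s. (1 / 2 :: real) ^ s)"
    by (rule sum_le_suminf) (auto intro: summable_geometric)
  also have "\<dots> = 2" by (simp add: suminf_geometric)
  finally show ?thesis by (simp add: power_mult_distrib mult_left_mono)
qed

text \<open>A union bound over the size of the support, the prime, the support and the permutation.
  The terms for one \<open>s\<close> and \<open>p\<close> contribute at most \<open>x ^ s\<close>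
  with \<open>x = exp 5 * N powr (-1/8)\<close>, and the sum is of the order of its first term
  \<open>s = 2\<close>, whence \<open>exp 10\<close> and \<open>-1/4\<close>.\<close>

lemma first_moment_automorphisms:
  fixes E :: "'w \<Rightarrow> (bool \<times> 'a set) set"
  assumes fin: "finite V" "finite \<Omega>"
    and E: "\<And>\<omega>. \<omega> \<in> \<Omega> \<Longrightarrow> E \<omega> \<subseteq> coloured_pairs V"
    and prob: "\<And>T. T \<subseteq> coloured_pairs V \<Longrightarrow>
                 real (card {\<omega> \<in> \<Omega>. T \<subseteq> E \<omega>}) \<le> (real (card V) powr (-23/24)) ^ card T * real (card \<Omega>)"
    and V: "V \<noteq> {}"
  shows "real (card {\<omega> \<in> \<Omega>. (\<forall>v\<in>V. 3 \<le> card {ce \<in> E \<omega>. v \<in> snd ce}) \<and> (\<exists>\<pi>. coloured_auto V (E \<omega>) \<pi> \<and> \<pi> \<noteq> id)})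
     \<le> 16 * exp 10 * real (card V) powr (-1/4) * real (card \<Omega>)"
    (is "real (card ?Bad) \<le> _")
proof -
  define N where "N = card V"
  have N0: "N > 0" using V fin by (simp add: N_def card_gt_0_iff)
  define x where "x = exp 5 * real N powr (-1/8)"
  have x2: "x\<^sup>2 = exp 10 * real N powr (-1/4)"
  proof -
    have "x\<^sup>2 = (exp 5 * exp 5) * (real N powr (-1/8) * real N powr (-1/8))"
      by (simp add: x_def power2_eq_square)
    also have "exp 5 * exp 5 = (exp 10 :: real)" by (simp add: exp_add[symmetric])
    also have "real N powr (-1/8) * real N powr (-1/8) = real N powr (-1/4)"
      by (simp add: powr_add[symmetric])
    finally show ?thesis .
  qed
  show ?thesis
  proof (cases "x \<le> 1 / 4")
    \<comment> \<open>For \<open>x > 1/4\<close> the right-hand side already exceeds the total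
      number of outcomes.\<close>
    case False
    then have "1 \<le> 16 * x\<^sup>2"
      using power_mono[of "1/4" x 2] by (simp add: power2_eq_square)
    then have "1 * real (card \<Omega>) \<le> (16 * x\<^sup>2) * real (card \<Omega>)" by (intro mult_right_mono) auto
    moreover have "card ?Bad \<le> card \<Omega>" using fin by (intro card_mono) auto
    ultimately show ?thesis by (simp add: x2 N_def mult.assoc)
  next
    case True
    let ?A = "\<lambda>\<rho>. {\<omega> \<in> \<Omega>. (\<forall>v\<in>V. 3 \<le> card {ce \<in> E \<omega>. v \<in> snd ce}) \<and> coloured_auto V (E \<omega>) \<rho>}"
    let ?P = "\<lambda>s. {p :: nat. prime p \<and> p dvd s \<and> p \<le> s}"
    let ?S = "\<lambda>s. {S. S \<subseteq> V \<and> card S = s}"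
    have fP: "finite (?P s)" for s by (rule finite_subset[of _ "{..s}"]) auto
    have fS: "finite (?S s)" for s using fin by simp
    have fF: "finite (free_perms p S)" if "S \<in> ?S s" for p s S
      using that fin finite_subset by (auto intro!: finite_free_perms)
    have sub: "?Bad \<subseteq> (\<Union>s\<in>{2..N}. \<Union>p\<in>?P s. \<Union>S\<in>?S s. \<Union>\<rho>\<in>free_perms p S. ?A \<rho>)"
    proof
      fix \<omega> assume \<omega>: "\<omega> \<in> ?Bad"
      then obtain \<pi> where \<pi>: "coloured_auto V (E \<omega>) \<pi>" "\<pi> \<noteq> id" by auto
      then have "\<pi> permutes V" by (simp add: coloured_auto_def)
      then obtain p k where pk: "prime p" "(\<pi> ^^ k) \<noteq> id" "(\<pi> ^^ k) ^^ p = id"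
        using exists_power_of_prime_order[OF fin(1) _ \<pi>(2)] by blast
      define \<rho> where "\<rho> = \<pi> ^^ k"
      have \<rho>: "coloured_auto V (E \<omega>) \<rho>" using coloured_auto_funpow[OF \<pi>(1)] by (simp add: \<rho>_def)
      then have perm: "\<rho> permutes V" by (simp add: coloured_auto_def)
      define S where "S = {x. \<rho> x \<noteq> x}"
      have SV: "S \<subseteq> V" using perm by (auto simp: S_def permutes_def)
      have "\<rho> permutes S" using perm by (auto simp: S_def permutes_def)
      then have free: "\<rho> \<in> free_perms p S" using pk by (auto simp: free_perms_def S_def \<rho>_def)
      have finS: "finite S" using SV fin finite_subset by blast
      have "S \<noteq> {}" using pk(2) by (auto simp: S_def \<rho>_def fun_eq_iff)
      then have c0: "card S > 0" using finS by (simp add: card_gt_0_iff)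
      have "p dvd card S" using free_perms_dvd_card[OF pk(1) finS] free by blast
      moreover from this have "p \<le> card S" using c0 by (simp add: dvd_imp_le)
      moreover have "2 \<le> p" using pk(1) prime_ge_2_nat by blast
      moreover have "card S \<le> N" using SV fin by (simp add: N_def card_mono)
      ultimately have "card S \<in> {2..N}" "p \<in> ?P (card S)" using pk by auto
      moreover have "S \<in> ?S (card S)" using SV by simp
      moreover have "\<omega> \<in> ?A \<rho>" using \<omega> \<rho> by simp
      ultimately show "\<omega> \<in> (\<Union>s\<in>{2..N}. \<Union>p\<in>?P s. \<Union>S\<in>?S s. \<Union>\<rho>\<in>free_perms p S. ?A \<rho>)"
        using free by blast
    qed
    have inner: "(\<Sum>S\<in>?S s. \<Sum>\<rho>\<in>free_perms p S. real (card (?A \<rho>))) \<le> x ^ s * real (card \<Omega>)"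
      if s: "s \<in> {2..N}" and p: "p \<in> ?P s" for s p
    proof -
      define \<mu> where "\<mu> = exp (11 / 24 * ln N - ln s / (2 * p))"
      have p2: "2 \<le> p" using p prime_ge_2_nat by auto
      have sN: "0 < s" "s \<le> N" using s by auto
      note mu = orbit_exponent_bound[OF p2 sN, folded \<mu>_def]
      have A: "real (card (?A \<rho>)) \<le> real (card \<Omega>) * (exp (4 * s) / \<mu> ^ (3 * s))"
        if S: "S \<in> ?S s" and \<rho>: "\<rho> \<in> free_perms p S" for S \<rho>
      proof -
        have pp: "prime p" using p by simp
        have SV: "S \<subseteq> V" and sS: "s = card S" using S by auto
        have "real (card (?A \<rho>)) \<le> real (card \<Omega>) * exp (2 * real s * ((real (card V) powr (-23/24)) * \<mu>\<^sup>2)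
            + (2 * (real s)\<^sup>2 * ((real (card V) powr (-23/24)) * \<mu>\<^sup>2) ^ p + 2 * real s * real (card V) * ((real (card V) powr (-23/24)) * \<mu>) ^ p) / p) / \<mu> ^ (3 * s)"
          by (rule card_invariant_graphs_le[OF fin pp E prob _ mu(1) \<rho> SV sS]) auto
        also have "\<dots> \<le> real (card \<Omega>) * exp (4 * s) / \<mu> ^ (3 * s)"
          using mu by (intro divide_right_mono mult_left_mono) (auto simp: N_def)
        finally show ?thesis by simp
      qed
      have "(\<Sum>S\<in>?S s. \<Sum>\<rho>\<in>free_perms p S. real (card (?A \<rho>)))
          \<le> (\<Sum>S\<in>?S s. \<Sum>\<rho>\<in>free_perms p S. real (card \<Omega>) * (exp (4 * s) / \<mu> ^ (3 * s)))"
        using A by (intro sum_mono) auto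
      also have "\<dots> = (\<Sum>S\<in>?S s. real (card (free_perms p S)) * (real (card \<Omega>) * (exp (4 * s) / \<mu> ^ (3 * s))))"
        by simp
      also have "\<dots> \<le> (\<Sum>S\<in>?S s. real (s ^ (s - s div p)) * (real (card \<Omega>) * (exp (4 * s) / \<mu> ^ (3 * s))))"
      proof (intro sum_mono mult_right_mono of_nat_mono)
        fix S assume "S \<in> ?S s"
        then show "card (free_perms p S) \<le> s ^ (s - s div p)"
          using card_free_perms_le[of p S] p fin finite_subset by fastforce
      qed (use mu in auto)
      also have "\<dots> = real (N choose s) * real s ^ (s - s div p) * (exp (4 * s) / \<mu> ^ (3 * s)) * real (card \<Omega>)"
        using n_subsets[OF fin(1), of s] by (simp add: N_def)
      also have "\<dots> \<le> x ^ s * real (card \<Omega>)"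
        unfolding x_def using binomial_free_perms_bound[OF p2 _ sN] p
        by (intro mult_right_mono) (auto simp: \<mu>_def)
      finally show ?thesis .
    qed
    have "card ?Bad \<le> card (\<Union>s\<in>{2..N}. \<Union>p\<in>?P s. \<Union>S\<in>?S s. \<Union>\<rho>\<in>free_perms p S. ?A \<rho>)"
      using sub fin fP fF by (intro card_mono finite_UN_I) auto
    also have "\<dots> \<le> (\<Sum>s\<in>{2..N}. \<Sum>p\<in>?P s. \<Sum>S\<in>?S s. \<Sum>\<rho>\<in>free_perms p S. card (?A \<rho>))"
      using fF
      by (intro order_trans[OF card_UN_le] sum_mono order_refl fP fS) auto
    finally have "real (card ?Bad) \<le> real (\<Sum>s\<in>{2..N}. \<Sum>p\<in>?P s. \<Sum>S\<in>?S s. \<Sum>\<rho>\<in>free_perms p S. card (?A \<rho>))"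
      by (rule of_nat_mono)
    also have "\<dots> = (\<Sum>s\<in>{2..N}. \<Sum>p\<in>?P s. \<Sum>S\<in>?S s. \<Sum>\<rho>\<in>free_perms p S. real (card (?A \<rho>)))"
      by simp
    also have "\<dots> \<le> (\<Sum>s\<in>{2..N}. \<Sum>p\<in>?P s. x ^ s * real (card \<Omega>))"
      using inner by (intro sum_mono) auto
    also have "\<dots> \<le> (\<Sum>s\<in>{2..N}. (real s * x ^ s) * real (card \<Omega>))"
    proof (rule sum_mono)
      fix s assume "s \<in> {2..N}"
      \<comment> \<open>At most \<open>s\<close> primes can occur as orbit size for a support of
        size \<open>s\<close>. This is the origin of the factor \<open>s\<close> in the
        series.\<close>
      have "card (?P s) \<le> card {1..s}" by (intro card_mono) (auto dest: prime_ge_1_nat)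
      then have "real (card (?P s)) * (x ^ s * real (card \<Omega>)) \<le> real s * (x ^ s * real (card \<Omega>))"
        by (intro mult_right_mono) (auto simp: x_def)
      then show "(\<Sum>p\<in>?P s. x ^ s * real (card \<Omega>)) \<le> (real s * x ^ s) * real (card \<Omega>)" by (simp add: mult_ac)
    qed
    also have "\<dots> = (\<Sum>s\<in>{2..N}. real s * x ^ s) * real (card \<Omega>)" by (simp add: sum_distrib_right)
    also have "\<dots> \<le> (8 * x\<^sup>2) * real (card \<Omega>)"
      using True by (intro mult_right_mono sum_index_times_power_le) (auto simp: x_def)
    also have "\<dots> \<le> (16 * x\<^sup>2) * real (card \<Omega>)" by (intro mult_right_mono) auto
    finally show ?thesis by (simp add: x2 N_def mult.assoc)
  qed
qed

section \<open>Switchings in Hamilton cycles\<close>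

text \<open>Double counting of the pairs of an element of \<open>A\<close> and a move. The result
  \<open>b\<close> of a move has to restrict the pair to at most \<open>L\<close> candidates, listed
  in \<open>Dec b\<close>; recording the pair next to \<open>b\<close> makes the counting map
  injective.\<close>

lemma switching_card_le:
  assumes "finite A" "finite B"
    and "\<And>a. a \<in> A \<Longrightarrow> finite (K a) \<and> D \<le> card (K a)"
    and "\<And>a k. a \<in> A \<Longrightarrow> k \<in> K a \<Longrightarrow> sw a k \<in> B \<and> (a, k) \<in> Dec (sw a k)"
    and "\<And>b. b \<in> B \<Longrightarrow> finite (Dec b) \<and> card (Dec b) \<le> L"
  shows "card A * D \<le> card B * L"
proof -
  let ?f = "\<lambda>(a, k). (sw a k, (a, k))"
  have "card A * D = (\<Sum>a\<in>A. D)" by simp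
  also have "\<dots> \<le> (\<Sum>a\<in>A. card (K a))" using assms by (intro sum_mono) auto
  also have "\<dots> = card (Sigma A K)" using assms by (subst card_SigmaI) auto
  also have "\<dots> = card (?f ` Sigma A K)" by (rule card_image[symmetric]) (auto simp: inj_on_def)
  also have "\<dots> \<le> card (Sigma B Dec)" using assms by (intro card_mono finite_SigmaI) auto
  also have "\<dots> = (\<Sum>b\<in>B. card (Dec b))" using assms by (subst card_SigmaI) auto
  also have "\<dots> \<le> (\<Sum>b\<in>B. L)" using assms by (intro sum_mono) auto
  finally show ?thesis by simp
qed

text \<open>
  One edge in \<open>48\<close> is left out so that a positive fraction of the \<open>M\<close> edges remains available as
  switching partners, however large \<open>T\<close> is.
\<close>

lemma card_containing_le_of_switching:
  fixes \<rho> :: real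
  assumes fin: "finite \<Omega>" "finite T" and \<rho>: "\<rho> \<ge> 0"
    and E: "\<And>\<omega>. \<omega> \<in> \<Omega> \<Longrightarrow> finite (E \<omega>) \<and> card (E \<omega>) \<le> M"
    and step: "\<And>X e. finite X \<Longrightarrow> e \<notin> X \<Longrightarrow> M \<le> 48 * (M - card X) \<Longrightarrow>
       real (card {\<omega> \<in> \<Omega>. insert e X \<subseteq> E \<omega>}) \<le> \<rho> * real (card {\<omega> \<in> \<Omega>. X \<subseteq> E \<omega>})"
  shows "real (card {\<omega> \<in> \<Omega>. T \<subseteq> E \<omega>}) \<le> \<rho> ^ (card T - card T div 48) * real (card \<Omega>)"
proof (cases "card T \<le> M")
  case False
  have "{\<omega> \<in> \<Omega>. T \<subseteq> E \<omega>} = {}"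
  proof (rule ccontr)
    assume "{\<omega> \<in> \<Omega>. T \<subseteq> E \<omega>} \<noteq> {}"
    then obtain \<omega> where "\<omega> \<in> \<Omega>" "T \<subseteq> E \<omega>" by auto
    then have "card T \<le> M" using E card_mono[of "E \<omega>" T] by fastforce
    then show False using False by simp
  qed
  then have c0: "card {\<omega> \<in> \<Omega>. T \<subseteq> E \<omega>} = 0" by (simp only: card.empty)
  show ?thesis unfolding c0 using \<rho> by simp
next
  case True
  \<comment> \<open>Only \<open>j\<close> of the edges are inserted one by one. Since
    \<open>card T \<le> M\<close>, at each of these insertions at least a fraction
    \<open>1/48\<close> of the \<open>M\<close> edges lies outside the current set.\<close>
  define j where "j = card T - card T div 48"
  have "j \<le> card T" by (simp add: j_def)
  then obtain Y where Y: "Y \<subseteq> T" "card Y = j" "finite Y" using obtain_subset_with_card_n by metis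
  have ind: "real (card {\<omega> \<in> \<Omega>. X \<subseteq> E \<omega>}) \<le> \<rho> ^ card X * real (card \<Omega>)"
    if "finite X" "card X \<le> j" for X
    using that
  proof (induction X rule: finite_induct)
    case empty
    then show ?case by simp
  next
    case (insert e X)
    have lt: "card X < j" using insert by simp
    have "M \<le> 48 * (M - card X)"
    proof -
      have "card X + card T div 48 + 1 \<le> card T" using lt j_def by linarith
      moreover have "card T \<le> 48 * (card T div 48) + 47" by presburger
      ultimately have "card X \<le> card T" "48 * card X \<le> 47 * card T" by linarith+
      then show ?thesis using True by linarith
    qed
    then have "real (card {\<omega> \<in> \<Omega>. insert e X \<subseteq> E \<omega>}) \<le> \<rho> * real (card {\<omega> \<in> \<Omega>. X \<subseteq> E \<omega>})"
      using step insert by simp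
    also have "\<dots> \<le> \<rho> * (\<rho> ^ card X * real (card \<Omega>))" using insert \<rho> by (intro mult_left_mono) auto
    finally show ?case using insert by simp
  qed
  have "card {\<omega> \<in> \<Omega>. T \<subseteq> E \<omega>} \<le> card {\<omega> \<in> \<Omega>. Y \<subseteq> E \<omega>}" using Y fin by (intro card_mono) auto
  then show ?thesis using ind[of Y] Y by (simp add: j_def)
qed

definition cycle_edge :: "'a list \<Rightarrow> nat \<Rightarrow> 'a set" where
  "cycle_edge vs i = {vs ! i, vs ! (Suc i mod length vs)}"

definition cycle_set :: "'a list \<Rightarrow> 'a set set" where
  "cycle_set vs = cycle_edge vs ` {..<length vs}"

lemma set_mset_cycle_edges: "set_mset (cycle_edges vs) = cycle_set vs"
  by (auto simp: cycle_edges_def cycle_set_def cycle_edge_def)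

text \<open>Two positions can carry the same edge only if each is the successor of the other, which
  would force the length to divide \<open>2\<close>.\<close>

lemma cycle_edge_eq_iff:
  assumes "distinct vs" "length vs \<ge> 3" "i < length vs" "j < length vs"
  shows "cycle_edge vs i = cycle_edge vs j \<longleftrightarrow> i = j"
proof
  let ?n = "length vs"
  assume eq: "cycle_edge vs i = cycle_edge vs j"
  have "0 < ?n" using assms(3) by linarith
  then have lt: "Suc i mod ?n < ?n" "Suc j mod ?n < ?n" by simp_all
  have nth: "vs ! a = vs ! b \<longleftrightarrow> a = b" if "a < ?n" "b < ?n" for a b
    using that assms nth_eq_iff_index_eq by blast
  have "i = j \<or> (i = Suc j mod ?n \<and> Suc i mod ?n = j)"
    using eq lt assms by (auto simp: cycle_edge_def doubleton_eq_iff nth)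
  moreover have False if ij: "i = Suc j mod ?n" "Suc i mod ?n = j"
  proof (cases "Suc i < ?n")
    case True
    then have j: "j = Suc i" using ij by simp
    then show False using ij assms by (cases "Suc j < ?n") (auto simp: mod_Suc)
  next
    case False
    then have "Suc i = ?n" using assms by simp
    then have "j = 0" using ij by simp
    then show False using ij \<open>Suc i = ?n\<close> assms by (cases "Suc j < ?n") auto
  qed
  ultimately show "i = j" by blast
qed auto

lemma inj_on_cycle_edge:
  assumes "distinct vs" "length vs \<ge> 3"
  shows "inj_on (cycle_edge vs) {..<length vs}"
  using cycle_edge_eq_iff[OF assms] by (auto simp: inj_on_def)

lemma card_cycle_set: "distinct vs \<Longrightarrow> length vs \<ge> 3 \<Longrightarrow> card (cycle_set vs) = length vs"
  using inj_on_cycle_edge[of vs] by (simp add: cycle_set_def card_image)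

lemma finite_cycle_set: "finite (cycle_set vs)"
  by (simp add: cycle_set_def)

lemma card_cycle_edge:
  assumes "distinct vs" "length vs \<ge> 3" "i < length vs"
  shows "card (cycle_edge vs i) = 2"
proof -
  have "i \<noteq> Suc i mod length vs" using assms by (cases "Suc i < length vs") (auto simp: mod_Suc)
  moreover have "Suc i mod length vs < length vs" using assms(3) by (intro mod_less_divisor) linarith
  ultimately have "vs ! i \<noteq> vs ! (Suc i mod length vs)" using assms nth_eq_iff_index_eq by blast
  then show ?thesis by (simp add: cycle_edge_def)
qed

text \<open>This reverses the positions \<open>i + 1, ..., j\<close> and fixes all others. It is an
  involution, so the same pair of indices undoes the switching.\<close>

definition rev_index :: "nat \<Rightarrow> nat \<Rightarrow> nat \<Rightarrow> nat" where
  "rev_index i j k = (if i < k \<and> k \<le> j then i + 1 + j - k else k)"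

definition rev_segment :: "nat \<Rightarrow> nat \<Rightarrow> 'a list \<Rightarrow> 'a list" where
  "rev_segment i j vs = map (\<lambda>k. vs ! rev_index i j k) [0..<length vs]"

lemma rev_index_rev_index: "rev_index i j (rev_index i j k) = k"
  by (auto simp: rev_index_def)

lemma rev_index_less: "j < n \<Longrightarrow> k < n \<Longrightarrow> rev_index i j k < n"
  by (auto simp: rev_index_def)

lemma length_rev_segment [simp]: "length (rev_segment i j vs) = length vs"
  by (simp add: rev_segment_def)

lemma nth_rev_segment: "k < length vs \<Longrightarrow> rev_segment i j vs ! k = vs ! rev_index i j k"
  by (simp add: rev_segment_def)

lemma rev_segment_rev_segment: "j < length vs \<Longrightarrow> rev_segment i j (rev_segment i j vs) = vs"
  by (rule nth_equalityI) (auto simp: nth_rev_segment rev_index_less rev_index_rev_index)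

lemma rev_segment_permutations:
  assumes "vs \<in> permutations_of_set V" "j < length vs"
  shows "rev_segment i j vs \<in> permutations_of_set V"
proof (rule permutations_of_setI)
  have vs: "set vs = V" "distinct vs" using assms by (auto simp: permutations_of_set_def)
  show "distinct (rev_segment i j vs)"
    unfolding distinct_conv_nth using vs assms
    by (auto simp: nth_rev_segment nth_eq_iff_index_eq rev_index_less)
      (metis rev_index_rev_index)
  have "set (rev_segment i j vs) \<subseteq> V" 
    using vs assms by (auto simp: rev_segment_def rev_index_less)
  moreover have "vs ! k \<in> set (rev_segment i j vs)" if "k < length vs" for k
    using that assms nth_rev_segment[of "rev_index i j k" vs i j] rev_index_less[of j "length vs" k i]
    by (metis length_rev_segment nth_mem rev_index_rev_index)
  ultimately show "set (rev_segment i j vs) = V" using vs by (metis in_set_conv_nth subsetI subset_antisym)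
qed

text \<open>Only the edges at the two boundaries \<open>i\<close> and \<open>j\<close> of the
  reversed segment change. An inner edge is traversed backwards and moves from position
  \<open>k\<close> to \<open>i + j - k\<close>.\<close>

lemma cycle_edge_rev_segment:
  assumes "i < j" "j < length vs" "k < length vs"
  shows "cycle_edge (rev_segment i j vs) k =
     (if k = i then {vs ! i, vs ! j}
      else if k = j then {vs ! Suc i, vs ! (Suc j mod length vs)}
      else if i < k \<and> k < j then cycle_edge vs (i + j - k) else cycle_edge vs k)"
proof -
  have lt: "Suc k mod length vs < length vs" using assms(3) by (intro mod_less_divisor) linarith
  have m: "Suc k mod length vs = (if Suc k < length vs then Suc k else 0)"
    using assms by (auto simp: mod_Suc)
  have mj: "Suc j mod length vs = (if Suc j < length vs then Suc j else 0)"
    using assms by (auto simp: mod_Suc)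
  have "i + 1 + j - k = Suc (i + j - k)" if "k \<le> j" using that by simp
  then show ?thesis
    using assms unfolding cycle_edge_def nth_rev_segment[OF assms(3)] length_rev_segment nth_rev_segment[OF lt]
    by (auto simp: rev_index_def m mj insert_commute)
qed

lemma cycle_set_rev_segment:
  assumes "i < j" "j < length vs"
  shows "\<And>k. k < length vs \<Longrightarrow> k \<noteq> i \<Longrightarrow> k \<noteq> j \<Longrightarrow> cycle_edge vs k \<in> cycle_set (rev_segment i j vs)"
    and "cycle_set (rev_segment i j vs) \<subseteq> cycle_edge vs ` ({..<length vs} - {i, j})
            \<union> {{vs ! i, vs ! j}, {vs ! Suc i, vs ! (Suc j mod length vs)}}"
proof -
  fix k assume k: "k < length vs" "k \<noteq> i" "k \<noteq> j"
  show "cycle_edge vs k \<in> cycle_set (rev_segment i j vs)"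
  proof (cases "i < k \<and> k < j")
    case True
    then have "cycle_edge (rev_segment i j vs) (i + j - k) = cycle_edge vs k"
      using assms by (subst cycle_edge_rev_segment) auto
    moreover have "i + j - k < length vs" using True assms by linarith
    ultimately show ?thesis by (auto simp: cycle_set_def intro!: image_eqI[of _ _ "i + j - k"])
  next
    case False
    then have "cycle_edge (rev_segment i j vs) k = cycle_edge vs k"
      using assms k by (subst cycle_edge_rev_segment) auto
    then show ?thesis using k by (auto simp: cycle_set_def intro!: image_eqI[of _ _ k])
  qed
next
  show "cycle_set (rev_segment i j vs) \<subseteq> cycle_edge vs ` ({..<length vs} - {i, j})
            \<union> {{vs ! i, vs ! j}, {vs ! Suc i, vs ! (Suc j mod length vs)}}"
    using assms by (auto simp: cycle_set_def cycle_edge_rev_segment)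
qed

text \<open>
  Reversing a segment replaces two edges of the cycle and keeps all others. The reversed segment can be
  recovered from the positions of the ends of \<open>e\<close> in the new cycle.
\<close>

lemma cycle_switching_card_le:
  assumes n: "n = card V" "n \<ge> 3" and A: "A \<subseteq> permutations_of_set V" and B: "B \<subseteq> permutations_of_set V"
    and e: "\<And>vs. vs \<in> A \<Longrightarrow> e \<in> cycle_set vs"
    and sw: "\<And>vs i. vs \<in> A \<Longrightarrow> i < n \<Longrightarrow> cycle_edge vs i = e \<Longrightarrow>
        D \<le> card {k. k < n \<and> k \<noteq> i \<and> rev_segment (min i k) (max i k) vs \<in> B}"
  shows "card A * D \<le> card B * 16"
proof -
  have perm: "length vs = n \<and> distinct vs" if "vs \<in> permutations_of_set V" for vs
    using that n by (auto simp: permutations_of_set_def distinct_card)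
  have finV: "finite V" using n by (simp add: card_ge_0_finite)
  then have finAB: "finite A" "finite B" using A B finite_subset finite_permutations_of_set by blast+
  define pos where "pos = (\<lambda>vs. THE i. i < n \<and> cycle_edge vs i = e)"
  have pos: "pos vs < n \<and> cycle_edge vs (pos vs) = e" if vs: "vs \<in> A" for vs
  proof -
    have p: "length vs = n" "distinct vs" using perm vs A by auto
    obtain i where i: "i < n" "cycle_edge vs i = e" using e[OF vs] p by (auto simp: cycle_set_def)
    have "pos vs = i" unfolding pos_def
      by (rule the_equality) (use i cycle_edge_eq_iff[of vs] p n in auto)
    then show ?thesis using i by simp
  qed
  define K where "K = (\<lambda>vs. {k. k < n \<and> k \<noteq> pos vs \<and> rev_segment (min (pos vs) k) (max (pos vs) k) vs \<in> B})"
  \<comment> \<open>If \<open>e\<close> was at position \<open>i\<close>, its ends now stand at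
    \<open>i\<close> and \<open>j\<close>; if it was at \<open>j\<close>, they stand at the
    successors of \<open>i\<close> and \<open>j\<close>. Each case leaves \<open>2 * 2\<close> pairs
    of indices, and a truth value tells which of the two was the partner \<open>k\<close>:
    altogether \<open>2 * (4 + 4) = 16\<close>.\<close>
  define Q1 where "Q1 = (\<lambda>vs :: 'a list. {p. p < n \<and> vs ! p \<in> e})"
  define Q2 where "Q2 = (\<lambda>vs :: 'a list. {p. p < n \<and> vs ! (Suc p mod n) \<in> e})"
  define Dec where "Dec = (\<lambda>vs. (\<lambda>(b, i, j). (rev_segment i j vs, if b then i else j)) `
       ((UNIV :: bool set) \<times> (Q1 vs \<times> Q1 vs \<union> Q2 vs \<times> Q2 vs)))"
  show ?thesis
  proof (cases "A = {}")
    case False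
    then obtain vs0 where "vs0 \<in> A" by auto
    then have ce: "card e = 2"
      using pos[of vs0] perm[of vs0] A n card_cycle_edge[of vs0 "pos vs0"] by auto
    then have fe: "finite e" by (metis card.infinite zero_neq_numeral)
    show ?thesis
    proof (rule switching_card_le[OF finAB, of K D "\<lambda>vs k. rev_segment (min (pos vs) k) (max (pos vs) k) vs" Dec])
      fix vs assume vs: "vs \<in> A"
      show "finite (K vs) \<and> D \<le> card (K vs)"
        using sw[OF vs] pos[OF vs] by (auto simp: K_def)
    next
      fix vs k assume vs: "vs \<in> A" and k: "k \<in> K vs"
      define i j where "i = min (pos vs) k" and "j = max (pos vs) k"
      define us where "us = rev_segment i j vs"
      have p: "length vs = n" "distinct vs" using perm vs A by auto
      have ij: "i < j" "j < n" using k pos[OF vs] by (auto simp: K_def i_def j_def min_def max_def)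
      have "us \<in> B" using k by (simp add: K_def us_def i_def j_def)
      have inv: "rev_segment i j us = vs" using ij p by (simp add: us_def rev_segment_rev_segment)
      have kb: "k = (if k = i then i else j)" by (auto simp: i_def j_def)
      have uij: "us ! i = vs ! i" "us ! j = vs ! Suc i" "us ! Suc i = vs ! j" "us ! (Suc j mod n) = vs ! (Suc j mod n)"
      proof -
        have "Suc j mod n < n" using ij by simp
        then show "us ! (Suc j mod n) = vs ! (Suc j mod n)"
          using ij p by (cases "Suc j < n") (auto simp: us_def nth_rev_segment rev_index_def mod_Suc)
        show "us ! i = vs ! i" "us ! j = vs ! Suc i" "us ! Suc i = vs ! j"
          using ij p by (auto simp: us_def nth_rev_segment rev_index_def)
      qed
      have "(i, j) \<in> Q1 us \<times> Q1 us \<union> Q2 us \<times> Q2 us"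
      proof (cases "pos vs = i")
        case True
        then have "e = {vs ! i, vs ! Suc i}" using pos[OF vs] p ij by (simp add: cycle_edge_def)
        then show ?thesis using uij ij by (auto simp: Q1_def)
      next
        case False
        then have "pos vs = j" by (auto simp: i_def j_def min_def max_def split: if_splits)
        then have "e = {vs ! j, vs ! (Suc j mod n)}" using pos[OF vs] p ij by (simp add: cycle_edge_def)
        then show ?thesis using uij ij by (auto simp: Q2_def)
      qed
      then have "(rev_segment i j us, if k = i then i else j) \<in> Dec us" unfolding Dec_def
        by (intro image_eqI[of _ _ "(k = i, i, j)"]) auto
      then have "(vs, k) \<in> Dec us" using inv kb by simp
      then show "rev_segment (min (pos vs) k) (max (pos vs) k) vs \<in> B \<and> (vs, k) \<in> Dec (rev_segment (min (pos vs) k) (max (pos vs) k) vs)"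
        using \<open>us \<in> B\<close> by (simp add: us_def i_def j_def)
    next
      fix us assume us: "us \<in> B"
      have p: "length us = n" "distinct us" using perm us B by auto
      have fQ: "finite (Q1 us)" "finite (Q2 us)" by (auto simp: Q1_def Q2_def)
      have "card (Q1 us) \<le> card e"
        by (rule card_inj_on_le[of "\<lambda>p. us ! p"]) (use p fe in \<open>auto simp: inj_on_def Q1_def nth_eq_iff_index_eq\<close>)
      moreover have "card (Q2 us) \<le> card e"
      proof (rule card_inj_on_le[of "\<lambda>p. us ! (Suc p mod n)"])
        show "inj_on (\<lambda>p. us ! (Suc p mod n)) (Q2 us)"
        proof (rule inj_onI)
          fix a b assume ab: "a \<in> Q2 us" "b \<in> Q2 us" "us ! (Suc a mod n) = us ! (Suc b mod n)"
          then have "Suc a mod n = Suc b mod n" using p n by (simp add: nth_eq_iff_index_eq)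
          then show "a = b" using ab by (auto simp: Q2_def mod_Suc split: if_splits)
        qed
      qed (use fe in \<open>auto simp: Q2_def\<close>)
      ultimately have "card (Q1 us \<times> Q1 us \<union> Q2 us \<times> Q2 us) \<le> 2 * 2 + 2 * 2"
        unfolding ce by (intro order_trans[OF card_Un_le] add_mono)
          (auto simp only: card_cartesian_product intro!: mult_le_mono)
      then have "card ((UNIV :: bool set) \<times> (Q1 us \<times> Q1 us \<union> Q2 us \<times> Q2 us)) \<le> 16"
        by (simp add: card_cartesian_product)
      then have "card (Dec us) \<le> 16" unfolding Dec_def
        using fQ by (intro order_trans[OF card_image_le]) auto
      then show "finite (Dec us) \<and> card (Dec us) \<le> 16" using fQ by (auto simp: Dec_def)
    qed
  qed auto
qed

text \<open>The edge \<open>e\<close> is switched away together with an edge outside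
  \<open>X\<close>, so that \<open>X\<close> survives. The hypotheses leave at least
  \<open>n - 1 - card X \<ge> n / 96\<close> partners, and each result has at most \<open>16\<close>
  origins: \<open>1536 = 16 * 96\<close>.\<close>

lemma card_cycles_containing_insert_le:
  assumes n: "n = card V" "n \<ge> 96" and X: "finite X" "e \<notin> X" "n \<le> 48 * (n - card X)"
  shows "real (card {vs \<in> permutations_of_set V. insert e X \<subseteq> cycle_set vs})
     \<le> 1536 / n * real (card {vs \<in> permutations_of_set V. X \<subseteq> cycle_set vs})"
proof -
  let ?A = "{vs \<in> permutations_of_set V. insert e X \<subseteq> cycle_set vs}"
  let ?B = "{vs \<in> permutations_of_set V. X \<subseteq> cycle_set vs}"
  have n3: "n \<ge> 3" using n by simp
  have "card ?A * (n - 1 - card X) \<le> card ?B * 16"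
  proof (rule cycle_switching_card_le[OF n(1) n3])
    fix vs i assume vs: "vs \<in> ?A" and i: "i < n" "cycle_edge vs i = e"
    have p: "length vs = n" "distinct vs" using vs n by (auto simp: permutations_of_set_def distinct_card)
    let ?G = "{k. k < n \<and> k \<noteq> i \<and> cycle_edge vs k \<notin> X}"
    have "card {k. k < n \<and> cycle_edge vs k \<in> X} \<le> card X"
      by (rule card_inj_on_le[of "cycle_edge vs"])
        (use inj_on_cycle_edge[of vs] p n3 X in \<open>auto simp: inj_on_def\<close>)
    moreover have "card ({..<n} - {i}) \<le> card ?G + card {k. k < n \<and> cycle_edge vs k \<in> X}"
      by (rule order_trans[OF card_mono card_Un_le]) auto
    ultimately have "n - 1 - card X \<le> card ?G" using i by simp
    also have "\<dots> \<le> card {k. k < n \<and> k \<noteq> i \<and> rev_segment (min i k) (max i k) vs \<in> ?B}"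
    proof (rule card_mono)
      show "?G \<subseteq> {k. k < n \<and> k \<noteq> i \<and> rev_segment (min i k) (max i k) vs \<in> ?B}"
      proof
        fix k assume k: "k \<in> ?G"
        have ij: "min i k < max i k" "max i k < length vs" using k i p by auto
        have "X \<subseteq> cycle_set (rev_segment (min i k) (max i k) vs)"
        proof
          fix x assume x: "x \<in> X"
          then obtain l where l: "l < n" "x = cycle_edge vs l" using vs p by (auto simp: cycle_set_def)
          then have "l \<noteq> i" "l \<noteq> k" using x k i X by auto
          then have "l \<noteq> min i k" "l \<noteq> max i k" by (auto simp: min_def max_def)
          then show "x \<in> cycle_set (rev_segment (min i k) (max i k) vs)"
            using cycle_set_rev_segment(1)[OF ij] l p by simp
        qed
        then show "k \<in> {k. k < n \<and> k \<noteq> i \<and> rev_segment (min i k) (max i k) vs \<in> ?B}"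
          using k vs ij by (auto intro!: rev_segment_permutations)
      qed
    qed auto
    finally show "n - 1 - card X \<le> card {k. k < n \<and> k \<noteq> i \<and> rev_segment (min i k) (max i k) vs \<in> ?B}" .
  qed auto
  then have "real (card ?A) * real (n - 1 - card X) \<le> real (card ?B) * 16"
    using of_nat_mono[of "card ?A * (n - 1 - card X)" "card ?B * 16", where ?'a = real]
    by (simp only: of_nat_mult of_nat_numeral)
  moreover have "real n / 96 \<le> real (n - 1 - card X)" using X n by linarith
  then have "real (card ?A) * (real n / 96) \<le> real (card ?A) * real (n - 1 - card X)" by (intro mult_left_mono) auto
  ultimately have "real (card ?A) * (real n / 96) \<le> real (card ?B) * 16" by linarith
  then show ?thesis using n by (simp add: field_simps)
qed

lemma card_cycles_containing_le:
  assumes n: "n = card V" "n \<ge> 96" and T: "finite T"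
  shows "real (card {vs \<in> permutations_of_set V. T \<subseteq> cycle_set vs})
     \<le> (1536 / n) ^ (card T - card T div 48) * real (card (permutations_of_set V))"
proof (rule card_containing_le_of_switching[OF _ T, where M = n])
  fix X :: "'a set set" and e assume X: "finite X" "e \<notin> X" "n \<le> 48 * (n - card X)"
  show "real (card {vs \<in> permutations_of_set V. insert e X \<subseteq> cycle_set vs})
      \<le> 1536 / n * real (card {vs \<in> permutations_of_set V. X \<subseteq> cycle_set vs})"
    using card_cycles_containing_insert_le[OF n X] .
next
  fix vs assume "vs \<in> permutations_of_set V"
  then have "length vs = n" "distinct vs" using n by (auto simp: permutations_of_set_def distinct_card)
  then show "finite (cycle_set vs) \<and> card (cycle_set vs) \<le> n"
    using card_cycle_set[of vs] n finite_cycle_set by auto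
qed (use n in auto)

lemma card_neighbours_le:
  assumes "finite F" "card {e \<in> F. v \<in> e} \<le> d" "distinct vs"
  shows "card {k. k < length vs \<and> {v, vs ! k} \<in> F} \<le> d"
proof -
  have "card {k. k < length vs \<and> {v, vs ! k} \<in> F} \<le> card {e \<in> F. v \<in> e}"
    by (rule card_inj_on_le[of "\<lambda>k. {v, vs ! k}"])
      (use assms in \<open>auto simp: inj_on_def doubleton_eq_iff nth_eq_iff_index_eq\<close>)
  then show ?thesis using assms by linarith
qed

text \<open>An edge of \<open>F\<close> is switched out of the cycle without letting another one in.
  Each of the two new edges excludes at most \<open>d\<close> partners, leaving
  \<open>n - 1 - 2 * d \<ge> n / 2\<close>. So each \<open>e\<close> costs \<open>32 / n\<close>,
  and there are at most \<open>d * n\<close> edges in \<open>F\<close>.\<close>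

lemma card_cycles_avoiding_step:
  fixes F :: "'a set set" and V :: "'a set"
  assumes n: "n = card V" "n \<ge> 3" "n \<ge> 4 * d + 2"
    and F: "finite F" "\<And>v. v \<in> V \<Longrightarrow> card {e \<in> F. v \<in> e} \<le> d" "card F \<le> d * n"
  defines "h \<equiv> \<lambda>vs. card (cycle_set vs \<inter> F)"
  shows "card {vs \<in> permutations_of_set V. h vs = Suc k}
           \<le> 32 * d * card {vs \<in> permutations_of_set V. h vs \<le> k}"
proof -
  let ?P = "permutations_of_set V"
  let ?B = "{vs \<in> ?P. h vs \<le> k}"
  have one: "card {vs \<in> ?P. h vs = Suc k \<and> e \<in> cycle_set vs} * n \<le> 32 * card ?B" if e: "e \<in> F" for e
  proof -
    let ?A = "{vs \<in> ?P. h vs = Suc k \<and> e \<in> cycle_set vs}"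
    have "card ?A * (n - 1 - 2 * d) \<le> card ?B * 16"
    proof (rule cycle_switching_card_le[OF n(1,2)])
      fix vs i assume vs: "vs \<in> ?A" and i: "i < n" "cycle_edge vs i = e"
      have p: "length vs = n" "distinct vs" "set vs = V"
        using vs n by (auto simp: permutations_of_set_def distinct_card)
      define i' where "i' = Suc i mod n"
      have i': "i' < n" using i by (simp add: i'_def)
      let ?X1 = "{j. j < n \<and> {vs ! i, vs ! j} \<in> F}"
      let ?X2 = "{j. j < n \<and> {vs ! i', vs ! (Suc j mod n)} \<in> F}"
      let ?G = "{..<n} - {i} - ?X1 - ?X2"
      have X1: "card ?X1 \<le> d"
        using card_neighbours_le[OF F(1), of "vs ! i" d vs] F(2) p i by auto
      have X2: "card ?X2 \<le> d"
      proof -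
        have "card ?X2 \<le> card {j. j < n \<and> {vs ! i', vs ! j} \<in> F}"
        proof (rule card_inj_on_le[of "\<lambda>j. Suc j mod n"])
          show "inj_on (\<lambda>j. Suc j mod n) ?X2" by (auto simp: inj_on_def mod_Suc split: if_splits)
        qed (use n in auto)
        also have "\<dots> \<le> d" using card_neighbours_le[OF F(1), of "vs ! i'" d vs] F(2) p i' by auto
        finally show ?thesis .
      qed
      have "card {..<n} \<le> card ?G + card {i} + card ?X1 + card ?X2"
      proof -
        have "card {..<n} \<le> card (?G \<union> {i} \<union> ?X1 \<union> ?X2)" by (intro card_mono) auto
        also have "\<dots> \<le> card ?G + card {i} + card ?X1 + card ?X2"
          by (intro order_trans[OF card_Un_le] add_mono order_refl)
        finally show ?thesis .
      qed
      then have "n - 1 - 2 * d \<le> card ?G" using X1 X2 by simp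
      also have "\<dots> \<le> card {j. j < n \<and> j \<noteq> i \<and> rev_segment (min i j) (max i j) vs \<in> ?B}"
      proof (rule card_mono)
        show "?G \<subseteq> {j. j < n \<and> j \<noteq> i \<and> rev_segment (min i j) (max i j) vs \<in> ?B}"
        proof
          fix j assume j: "j \<in> ?G"
          define a b where "a = min i j" and "b = max i j"
          have ab: "a < b" "b < length vs" using j i p by (auto simp: a_def b_def)
          have ij: "{a, b} = {i, j}" by (auto simp: a_def b_def min_def max_def)
          define us where "us = rev_segment a b vs"
          have new1: "{vs ! a, vs ! b} \<notin> F" using j by (auto simp: a_def b_def min_def max_def insert_commute)
          have "Suc a = Suc a mod n" using ab p by simp
          then have "{vs ! Suc a, vs ! (Suc b mod n)} = {vs ! i', vs ! (Suc j mod n)}"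
            by (auto simp: a_def b_def min_def max_def i'_def insert_commute)
          then have new2: "{vs ! Suc a, vs ! (Suc b mod length vs)} \<notin> F" using j p by auto
          have "cycle_set us \<inter> F \<subseteq> (cycle_set vs \<inter> F) - {e}"
          proof
            fix x assume x: "x \<in> cycle_set us \<inter> F"
            then have "x \<in> cycle_edge vs ` ({..<length vs} - {a, b})"
              using cycle_set_rev_segment(2)[OF ab] new1 new2 by (auto simp: us_def)
            then obtain l where l: "l < n" "l \<notin> {a, b}" "x = cycle_edge vs l" using p by auto
            then have "l \<noteq> i" using ij by blast
            then have "x \<noteq> e" using cycle_edge_eq_iff[of vs l i] l i p n by auto
            then show "x \<in> (cycle_set vs \<inter> F) - {e}" using x l p by (auto simp: cycle_set_def)
          qed
          then have "h us \<le> card ((cycle_set vs \<inter> F) - {e})"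
            unfolding h_def using F by (intro card_mono) auto
          also have "\<dots> = h vs - 1" unfolding h_def using vs e F by (subst card_Diff_singleton) auto
          finally have "h us \<le> k" using vs by simp
          then show "j \<in> {j. j < n \<and> j \<noteq> i \<and> rev_segment (min i j) (max i j) vs \<in> ?B}"
            using j vs ab by (auto simp: us_def a_def[symmetric] b_def[symmetric] intro!: rev_segment_permutations)
        qed
      qed auto
      finally show "n - 1 - 2 * d \<le> card {j. j < n \<and> j \<noteq> i \<and> rev_segment (min i j) (max i j) vs \<in> ?B}" .
    qed auto
    moreover have "card ?A * n \<le> card ?A * (2 * (n - 1 - 2 * d))" using n by (intro mult_left_mono) auto
    ultimately show ?thesis by linarith
  qed
  let ?A = "{vs \<in> ?P. h vs = Suc k}"
  have "?A \<subseteq> (\<Union>e\<in>F. {vs \<in> ?P. h vs = Suc k \<and> e \<in> cycle_set vs})"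
  proof
    fix vs assume vs: "vs \<in> ?A"
    then have "cycle_set vs \<inter> F \<noteq> {}" by (auto simp: h_def)
    then show "vs \<in> (\<Union>e\<in>F. {vs \<in> ?P. h vs = Suc k \<and> e \<in> cycle_set vs})" using vs by auto
  qed
  moreover have finP: "finite ?P" by simp
  ultimately have "card ?A \<le> (\<Sum>e\<in>F. card {vs \<in> ?P. h vs = Suc k \<and> e \<in> cycle_set vs})"
    using F by (intro order_trans[OF card_mono card_UN_le]) auto
  then have "card ?A * n \<le> (\<Sum>e\<in>F. card {vs \<in> ?P. h vs = Suc k \<and> e \<in> cycle_set vs} * n)"
    using mult_le_mono1[of "card ?A" _ n] by (simp only: sum_distrib_right[symmetric])
  also have "\<dots> \<le> (\<Sum>e\<in>F. 32 * card ?B)" using one by (intro sum_mono) auto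
  also have "\<dots> = card F * (32 * card ?B)" by simp
  also have "\<dots> \<le> (d * n) * (32 * card ?B)" using F by (intro mult_right_mono) auto
  finally have "card ?A * n \<le> (32 * d * card ?B) * n" by (simp add: mult_ac)
  then show ?thesis using n by simp
qed

text \<open>A cycle has on average at most \<open>1536 * d\<close> edges in \<open>F\<close>, so by
  Markov's inequality at least half of all cycles have at most \<open>3072 * d\<close>. From there
  one descends to \<open>0\<close> edges in at most \<open>3072 * d\<close> steps, each at the cost
  of a factor \<open>1 + 32 * d\<close>.\<close>

lemma card_cycles_avoiding_ge:
  fixes F :: "'a set set" and V :: "'a set"
  assumes n: "n = card V" "n \<ge> 96" "n \<ge> 4 * d + 2"
    and F: "finite F" "\<And>v. v \<in> V \<Longrightarrow> card {e \<in> F. v \<in> e} \<le> d" "card F \<le> d * n"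
  shows "card (permutations_of_set V)
           \<le> 2 * (1 + 32 * d) ^ (3072 * d) * card {vs \<in> permutations_of_set V. cycle_set vs \<inter> F = {}}"
proof -
  let ?P = "permutations_of_set V"
  define h where "h = (\<lambda>vs. card (cycle_set vs \<inter> F))"
  define N where "N = (\<lambda>k. card {vs \<in> ?P. h vs \<le> k})"
  have n3: "n \<ge> 3" using n by simp
  have finP: "finite ?P" by simp
  have NS: "N (Suc k) \<le> (1 + 32 * d) * N k" for k
  proof -
    have "{vs \<in> ?P. h vs \<le> Suc k} = {vs \<in> ?P. h vs \<le> k} \<union> {vs \<in> ?P. h vs = Suc k}" by auto
    then have "N (Suc k) \<le> N k + card {vs \<in> ?P. h vs = Suc k}"
      unfolding N_def by (simp only: card_Un_le)
    also have "\<dots> \<le> N k + 32 * d * N k"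
      unfolding N_def h_def using card_cycles_avoiding_step[OF n(1) n3 n(3) F] by simp
    finally show ?thesis by simp
  qed
  have Nk: "N k \<le> (1 + 32 * d) ^ k * N 0" for k
  proof (induction k)
    case (Suc k)
    have "N (Suc k) \<le> (1 + 32 * d) * N k" by (rule NS)
    also have "\<dots> \<le> (1 + 32 * d) * ((1 + 32 * d) ^ k * N 0)" using Suc by (intro mult_left_mono) auto
    finally show ?case by (simp only: power_Suc mult.assoc)
  qed simp
  let ?K = "3072 * d"
  have "real (\<Sum>vs\<in>?P. h vs) \<le> 1536 * d * real (card ?P)"
  proof -
    have "(\<Sum>vs\<in>?P. h vs) = (\<Sum>vs\<in>?P. card {e \<in> F. e \<in> cycle_set vs})"
      unfolding h_def by (intro sum.cong refl arg_cong[where f = card]) auto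
    also have "\<dots> = (\<Sum>e\<in>F. card {vs \<in> ?P. e \<in> cycle_set vs})"
      using F finP by (intro sum_multicount_gen) auto
    finally have "real (\<Sum>vs\<in>?P. h vs) = (\<Sum>e\<in>F. real (card {vs \<in> ?P. e \<in> cycle_set vs}))" by simp
    also have "\<dots> \<le> (\<Sum>e\<in>F. 1536 / n * real (card ?P))"
      using card_cycles_containing_insert_le[OF n(1,2), of "{}"] by (intro sum_mono) simp
    also have "\<dots> = real (card F) * (1536 / n * real (card ?P))" by simp
    also have "\<dots> \<le> real (d * n) * (1536 / n * real (card ?P))"
      using F by (intro mult_right_mono of_nat_mono) auto
    finally show ?thesis using n by simp
  qed
  moreover have "real (card {vs \<in> ?P. \<not> h vs \<le> ?K}) * real (?K + 1) \<le> real (\<Sum>vs\<in>?P. h vs)"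
  proof -
    have "card {vs \<in> ?P. \<not> h vs \<le> ?K} * (?K + 1) = (\<Sum>vs\<in>{vs \<in> ?P. \<not> h vs \<le> ?K}. ?K + 1)" by simp
    also have "\<dots> \<le> (\<Sum>vs\<in>{vs \<in> ?P. \<not> h vs \<le> ?K}. h vs)" by (intro sum_mono) auto
    also have "\<dots> \<le> (\<Sum>vs\<in>?P. h vs)" using finP by (intro sum_mono2) auto
    finally have "real (card {vs \<in> ?P. \<not> h vs \<le> ?K} * (?K + 1)) \<le> real (\<Sum>vs\<in>?P. h vs)"
      by (rule of_nat_mono)
    then show ?thesis by (simp only: of_nat_mult)
  qed
  ultimately have "real (card {vs \<in> ?P. \<not> h vs \<le> ?K}) * real (?K + 1) \<le> 1536 * d * real (card ?P)" by linarith
  also have "\<dots> \<le> real (card ?P) / 2 * real (?K + 1)" by (simp add: algebra_simps)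
  finally have "real (card {vs \<in> ?P. \<not> h vs \<le> ?K}) \<le> real (card ?P) / 2"
    by (subst (asm) mult_le_cancel_right) auto
  moreover have "card ?P = N ?K + card {vs \<in> ?P. \<not> h vs \<le> ?K}"
  proof -
    have "?P = {vs \<in> ?P. h vs \<le> ?K} \<union> {vs \<in> ?P. \<not> h vs \<le> ?K}" by auto
    moreover have "card ({vs \<in> ?P. h vs \<le> ?K} \<union> {vs \<in> ?P. \<not> h vs \<le> ?K})
        = N ?K + card {vs \<in> ?P. \<not> h vs \<le> ?K}"
      unfolding N_def using finP by (intro card_Un_disjoint) auto
    ultimately show ?thesis by (simp only:)
  qed
  ultimately have "card ?P \<le> 2 * N ?K" by linarith
  also have "\<dots> \<le> 2 * ((1 + 32 * d) ^ ?K * N 0)" using Nk[of ?K] by (intro mult_left_mono) auto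
  also have "N 0 = card {vs \<in> ?P. cycle_set vs \<inter> F = {}}"
    unfolding N_def h_def using F by (auto intro!: arg_cong[where f = card])
  finally show ?thesis by (simp add: mult.assoc)
qed

section \<open>Switchings in random injections\<close>

definition chord_set :: "'a set \<Rightarrow> ('a \<Rightarrow> 'a) \<Rightarrow> 'a set set" where
  "chord_set R y = (\<lambda>x. {x, y x}) ` R"

lemma finite_injections: "finite A \<Longrightarrow> finite B \<Longrightarrow> finite (injections A B)"
  unfolding injections_def by (rule finite_subset[OF _ finite_PiE[of A "\<lambda>_. B"]]) auto

text \<open>
  Distinct \<open>x\<close> and \<open>x'\<close> may give the same chord, hence one source is fixed for every chord in \<open>X\<close>.
\<close>

lemma card_injections_containing_insert_le:
  fixes A B :: "'a set"
  assumes fin: "finite A" "finite B" "finite X" and e: "e \<notin> X"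
  shows "card {y \<in> injections A B. insert e X \<subseteq> chord_set A y} * (card B - card X)
           \<le> card {y \<in> injections A B. X \<subseteq> chord_set A y} * 2"
proof -
  let ?A = "{y \<in> injections A B. insert e X \<subseteq> chord_set A y}"
  let ?B = "{y \<in> injections A B. X \<subseteq> chord_set A y}"
  define src where "src = (\<lambda>y f. SOME x. x \<in> A \<and> f = {x, y x})"
  have src: "src y f \<in> A \<and> f = {src y f, y (src y f)}" if "f \<in> chord_set A y" for y f
    using that someI_ex[of "\<lambda>x. x \<in> A \<and> f = {x, y x}"] by (auto simp: chord_set_def src_def)
  define K where "K = (\<lambda>y. B - y ` src y ` X)"
  \<comment> \<open>The values \<open>y x\<close> and \<open>v\<close> are exchanged throughout the
    range. This keeps \<open>y\<close> injective whether or not \<open>v\<close> is already a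
    value.\<close>
  define sw where "sw = (\<lambda>(y :: 'a \<Rightarrow> 'a) v. restrict (\<lambda>a. Transposition.transpose (y (src y e)) v (y a)) A)"
  \<comment> \<open>After the switching \<open>v\<close> is the value at \<open>x\<close>, and the
    old value is the other end of \<open>e\<close>. Hence only the order of the two ends of
    \<open>e\<close> is lost.\<close>
  define Dec where "Dec = (\<lambda>y'. (\<lambda>(x, w). (restrict (\<lambda>a. Transposition.transpose w (y' x) (y' a)) A, y' x)) ` {(x, w). e = {x, w}})"
  have fI: "finite (injections A B)" using fin finite_injections by blast
  show ?thesis
  proof (rule switching_card_le[of ?A ?B K "card B - card X" sw Dec])
    show "finite ?A" "finite ?B" using fI by auto
    fix y assume y: "y \<in> ?A"
    have "card (y ` src y ` X) \<le> card X"
      using fin by (intro order_trans[OF card_image_le card_image_le]) auto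
    moreover have "card B \<le> card (K y) + card (y ` src y ` X)"
      unfolding K_def using fin by (intro order_trans[OF card_mono card_Un_le]) auto
    ultimately show "finite (K y) \<and> card B - card X \<le> card (K y)" using fin by (auto simp: K_def)
  next
    fix y v assume y: "y \<in> ?A" and v: "v \<in> K y"
    define x where "x = src y e"
    have x: "x \<in> A" "e = {x, y x}" using src[of e y] y by (auto simp: x_def)
    have yI: "y \<in> A \<rightarrow>\<^sub>E B" "inj_on y A" using y by (auto simp: injections_def)
    have yB: "y a \<in> B" if "a \<in> A" for a using yI that by auto
    have vB: "v \<in> B" using v by (auto simp: K_def)
    let ?y = "sw y v"
    have y'[simp]: "?y a = Transposition.transpose (y x) v (y a)" if "a \<in> A" for a using that by (simp add: sw_def x_def)
    have "?y \<in> injections A B"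
      unfolding injections_def
    proof (intro CollectI conjI)
      show "?y \<in> A \<rightarrow>\<^sub>E B"
        unfolding sw_def x_def[symmetric] using yB vB x by (auto simp: Transposition.transpose_def)
      show "inj_on ?y A"
      proof (rule inj_onI)
        fix p q assume pq: "p \<in> A" "q \<in> A" "?y p = ?y q"
        then have "Transposition.transpose (y x) v (Transposition.transpose (y x) v (y p))
            = Transposition.transpose (y x) v (Transposition.transpose (y x) v (y q))" by simp
        then have "y p = y q" by (simp only: transpose_involutory)
        then show "p = q" using yI(2) pq by (auto simp: inj_on_def)
      qed
    qed
    moreover have "X \<subseteq> chord_set A ?y"
    proof
      fix f assume f: "f \<in> X"
      define a where "a = src y f"
      have a: "a \<in> A" "f = {a, y a}" using src[of f y] y f by (auto simp: a_def)
      have "a \<noteq> x" using a x f e by auto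
      then have "y a \<noteq> y x" using yI(2) a x by (auto simp: inj_on_def)
      moreover have "y a \<noteq> v" using v f by (auto simp: K_def a_def)
      ultimately have "?y a = y a" using a by simp
      then show "f \<in> chord_set A ?y" using a by (auto simp: chord_set_def)
    qed
    moreover have "(y, v) \<in> Dec ?y"
    proof -
      have "?y x = v" using x by simp
      moreover have "restrict (\<lambda>a. Transposition.transpose (y x) v (?y a)) A = y"
      proof
        fix a show "restrict (\<lambda>a. Transposition.transpose (y x) v (?y a)) A a = y a"
        proof (cases "a \<in> A")
          case True
          then show ?thesis by (simp only: restrict_apply' y' transpose_involutory)
        next
          case False
          then show ?thesis using PiE_arb[OF yI(1) False] by simp
        qed
      qed
      ultimately have "(\<lambda>(x, w). (restrict (\<lambda>a. Transposition.transpose w (?y x) (?y a)) A, ?y x)) (x, y x) = (y, v)"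
        by (simp only: prod.case)
      then show ?thesis unfolding Dec_def using x(2) by (intro image_eqI[of _ _ "(x, y x)"]) auto
    qed
    ultimately show "sw y v \<in> ?B \<and> (y, v) \<in> Dec (sw y v)" by simp
  next
    fix y' assume "y' \<in> ?B"
    have ex: "finite {(x, w). e = {x, w}} \<and> card {(x, w). e = {x, w}} \<le> 2"
    proof (cases "\<exists>p q. e = {p, q}")
      case True
      then obtain p q where "e = {p, q}" by blast
      then have sub: "{(x, w). e = {x, w}} \<subseteq> {(p, q), (q, p)}" by (auto simp: doubleton_eq_iff)
      have "card {(p, q), (q, p)} \<le> 2" by (rule order_trans[OF card_insert_le_m1]) auto
      moreover have "card {(x, w). e = {x, w}} \<le> card {(p, q), (q, p)}" by (rule card_mono[OF _ sub]) simp
      moreover have "finite {(x, w). e = {x, w}}" by (rule finite_subset[OF sub]) simp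
      ultimately show ?thesis by linarith
    next
      case False
      then have "{(x, w). e = {x, w}} = {}" by auto
      then show ?thesis by simp
    qed
    then show "finite (Dec y') \<and> card (Dec y') \<le> 2" unfolding Dec_def
      by (auto intro: order_trans[OF card_image_le])
  qed
qed

text \<open>At least \<open>card B / 48\<close> values avoid the chords already prescribed, and at
  most two pairs lead to the same injection: \<open>96 = 2 * 48\<close>.\<close>

lemma card_injections_containing_le:
  fixes A B :: "'a set"
  assumes fin: "finite A" "finite B" "finite T" and B: "B \<noteq> {}"
  shows "real (card {y \<in> injections A B. T \<subseteq> chord_set A y})
     \<le> (96 / card B) ^ (card T - card T div 48) * real (card (injections A B))"
proof (rule card_containing_le_of_switching[OF _ fin(3), where M = "card B"])
  fix X :: "'a set set" and e assume X: "finite X" "e \<notin> X" "card B \<le> 48 * (card B - card X)"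
  let ?A = "{y \<in> injections A B. insert e X \<subseteq> chord_set A y}"
  let ?B = "{y \<in> injections A B. X \<subseteq> chord_set A y}"
  have b0: "card B > 0" using fin B by (simp add: card_gt_0_iff)
  have "real (card ?A) * real (card B - card X) \<le> real (card ?B) * 2"
    using of_nat_mono[OF card_injections_containing_insert_le[OF fin(1,2) X(1,2)], where ?'a = real]
    by (simp only: of_nat_mult of_nat_numeral)
  moreover have "real (card B) / 48 \<le> real (card B - card X)" using X by linarith
  then have "real (card ?A) * (real (card B) / 48) \<le> real (card ?A) * real (card B - card X)" by (intro mult_left_mono) auto
  ultimately have "real (card ?A) * (real (card B) / 48) \<le> real (card ?B) * 2" by linarith
  then show "real (card ?A) \<le> 96 / card B * real (card ?B)" using b0 by (simp add: field_simps)
next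
  fix y assume "y \<in> injections A B"
  then have "card A \<le> card B" using card_inj_on_le[of y A B] fin by (auto simp: injections_def)
  then show "finite (chord_set A y) \<and> card (chord_set A y) \<le> card B"
    unfolding chord_set_def using fin by (auto intro: order_trans[OF card_image_le])
qed (use fin finite_injections in auto)

text \<open>What makes the chords simple: \<open>forb x\<close> will consist of \<open>x\<close> and
  its neighbours in the other two layers, and the last condition excludes that two sources choose
  each other, which would produce the same chord twice.\<close>

definition good_injections :: "('a \<Rightarrow> 'a set) \<Rightarrow> 'a set \<Rightarrow> 'a set \<Rightarrow> ('a \<Rightarrow> 'a) set" where
  "good_injections forb R V = {y \<in> injections R V. (\<forall>x\<in>R. y x \<notin> forb x) \<and> (\<forall>x\<in>R. \<forall>x'\<in>R. y x = x' \<longrightarrow> y x' \<noteq> x)}"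

text \<open>Sources are added one at a time. Of the \<open>n - card R \<ge> n / 2\<close> values
  still free for \<open>x\<close>, at most \<open>\<Delta> + 1\<close> are bad: those in
  \<open>forb x\<close> and the at most one \<open>x'\<close> that has already chosen
  \<open>x\<close>. So a fraction of at most \<open>2 * (\<Delta> + 1) / n\<close> is lost per
  source.\<close>

lemma card_good_injections_ge:
  assumes V: "finite V" "n = card V" and R: "finite R" "2 * card R \<le> n"
    and forb: "\<And>x. x \<in> R \<Longrightarrow> x \<in> forb x \<and> finite (forb x) \<and> card (forb x) \<le> \<Delta>" and n: "n \<ge> 2 * (\<Delta> + 1)"
  shows "(1 - real (2 * (\<Delta> + 1)) / real n) ^ card R * real (card (injections R V)) \<le> real (card (good_injections forb R V))"
  using R forb
proof (induction R rule: finite_induct)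
  case empty
  have "good_injections forb {} V = injections {} V" by (auto simp: good_injections_def)
  then show ?case by simp
next
  case (insert x R)
  let ?\<theta> = "1 - real (2 * (\<Delta> + 1)) / real n :: real"
  have \<theta>: "?\<theta> \<ge> 0" using n by (simp add: field_simps)
  let ?G = "good_injections forb R V"
  define S where "S = (\<lambda>y. V - y ` R - forb x - {x' \<in> R. y x' = x})"
  have n0: "n > 0" using n by simp
  have finG: "finite ?G" "finite (good_injections forb (insert x R) V)"
    using finite_injections[of R V] finite_injections[of "insert x R" V] V insert
    by (auto simp: good_injections_def)
  have upper: "card (injections (insert x R) V) \<le> card (injections R V) * (n - card R)"
  proof -
    let ?f = "\<lambda>y. (restrict y R, y x)"
    have "card (injections (insert x R) V) \<le> card (SIGMA y : injections R V. V - y ` R)"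
    proof (rule card_inj_on_le[of ?f])
      show "inj_on ?f (injections (insert x R) V)"
      proof (rule inj_onI)
        fix y y' assume y: "y \<in> injections (insert x R) V" "y' \<in> injections (insert x R) V" and eq: "?f y = ?f y'"
        have "y a = y' a" if "a \<in> insert x R" for a
          using fun_cong[OF conjunct1[OF eq[unfolded prod.inject]], of a] conjunct2[OF eq[unfolded prod.inject]] that
          by (auto split: if_splits)
        then show "y = y'" using y by (intro PiE_ext[of y "insert x R" "\<lambda>_. V"]) (auto simp: injections_def)
      qed
      show "?f ` injections (insert x R) V \<subseteq> (SIGMA y : injections R V. V - y ` R)"
        using insert by (auto simp: injections_def inj_on_def)
      show "finite (SIGMA y : injections R V. V - y ` R)"
        using V insert by (auto intro!: finite_injections)
    qed
    also have "\<dots> = (\<Sum>y\<in>injections R V. card (V - y ` R))"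
      using V insert by (subst card_SigmaI) (auto intro!: finite_injections)
    also have "\<dots> = (\<Sum>y\<in>injections R V. n - card R)"
    proof (rule sum.cong[OF refl])
      fix y assume "y \<in> injections R V"
      then have "y ` R \<subseteq> V" "card (y ` R) = card R" by (auto simp: injections_def card_image)
      then show "card (V - y ` R) = n - card R" using insert V by (simp add: card_Diff_subset)
    qed
    finally show ?thesis by simp
  qed
  have lower: "card ?G * (n - card R - \<Delta> - 1) \<le> card (good_injections forb (insert x R) V)"
  proof -
    have "card ?G * (n - card R - \<Delta> - 1) = (\<Sum>y\<in>?G. n - card R - \<Delta> - 1)" by simp
    also have "\<dots> \<le> (\<Sum>y\<in>?G. card (S y))"
    proof (rule sum_mono)
      fix y assume y: "y \<in> ?G"
      then have yI: "y ` R \<subseteq> V" "inj_on y R" by (auto simp: good_injections_def injections_def)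
      then have c: "card (y ` R) = card R" by (simp add: card_image)
      have "card {x' \<in> R. y x' = x} \<le> 1"
        using yI(2) insert by (auto simp: card_le_Suc0_iff_eq inj_on_def)
      moreover have "n \<le> card (S y) + card (y ` R) + card (forb x) + card {x' \<in> R. y x' = x}"
      proof -
        have "n \<le> card (S y \<union> y ` R \<union> forb x \<union> {x' \<in> R. y x' = x})"
          unfolding V(2) using V insert by (intro card_mono) (auto simp: S_def)
        also have "\<dots> \<le> card (S y) + card (y ` R) + card (forb x) + card {x' \<in> R. y x' = x}"
          by (intro order_trans[OF card_Un_le] add_mono order_refl)
        finally show ?thesis .
      qed
      moreover have "card (forb x) \<le> \<Delta>" using insert.prems(2)[of x] by simp
      ultimately show "n - card R - \<Delta> - 1 \<le> card (S y)" using c by linarith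
    qed
    also have "\<dots> = card (SIGMA y : ?G. S y)" using V finG by (subst card_SigmaI) (auto simp: S_def)
    also have "\<dots> \<le> card (good_injections forb (insert x R) V)"
    proof (rule card_inj_on_le[of "\<lambda>(y, v). y(x := v)"])
      show "inj_on (\<lambda>(y, v). y(x := v)) (SIGMA y : ?G. S y)"
      proof (rule inj_onI, clarify)
        fix y v y' v' assume y: "y \<in> ?G" "y' \<in> ?G" and eq: "y(x := v) = y'(x := v')"
        have "y a = y' a" if "a \<in> R" for a using fun_cong[OF eq, of a] that insert by (auto split: if_splits)
        then have "y = y'" using y by (intro PiE_ext[of y R "\<lambda>_. V"]) (auto simp: injections_def good_injections_def)
        moreover have "v = v'" using fun_cong[OF eq, of x] by simp
        ultimately show "y = y' \<and> v = v'" by simp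
      qed
      show "(\<lambda>(y, v). y(x := v)) ` (SIGMA y : ?G. S y) \<subseteq> good_injections forb (insert x R) V"
      proof clarify
        fix y v assume y: "y \<in> ?G" and v: "v \<in> S y"
        have ne: "a \<noteq> x" if "a \<in> R" for a using that insert by auto
        have "v \<noteq> x" using v insert.prems(2)[of x] by (auto simp: S_def)
        then show "y(x := v) \<in> good_injections forb (insert x R) V"
          using y v insert.hyps unfolding good_injections_def injections_def S_def
          by (auto simp: inj_on_def ne PiE_iff extensional_def)
      qed
    qed (use finG in auto)
    finally show ?thesis .
  qed
  have rn: "2 * (card R + 1) \<le> n" using insert by simp
  have IH: "?\<theta> ^ card R * real (card (injections R V)) \<le> real (card ?G)"
  proof (rule insert.IH)
    show "2 * card R \<le> n" using rn by simp
  qed (use insert.prems in auto)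
  have frac: "?\<theta> * real (n - card R) \<le> real (n - card R - \<Delta> - 1)"
  proof -
    have "real n * real (\<Delta> + 1) \<le> 2 * real (n - card R) * real (\<Delta> + 1)"
      using rn by (intro mult_right_mono) auto
    then have "real (\<Delta> + 1) \<le> real (2 * (\<Delta> + 1)) / real n * real (n - card R)"
      using n0 by (simp add: field_simps)
    then have "?\<theta> * real (n - card R) \<le> real (n - card R) - real (\<Delta> + 1)" by (simp add: algebra_simps)
    then show ?thesis by linarith
  qed
  have "?\<theta> ^ card (insert x R) * real (card (injections (insert x R) V))
      \<le> ?\<theta> ^ card (insert x R) * real (card (injections R V) * (n - card R))"
    using upper \<theta> by (intro mult_left_mono of_nat_mono) auto
  also have "\<dots> = (?\<theta> ^ card R * real (card (injections R V))) * (?\<theta> * real (n - card R))"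
    using insert by (simp add: mult_ac)
  also have "\<dots> \<le> real (card ?G) * real (n - card R - \<Delta> - 1)"
    using IH frac \<theta> by (intro mult_mono) auto
  also have "\<dots> \<le> real (card (good_injections forb (insert x R) V))"
    using of_nat_mono[OF lower, where ?'a = real] by (simp only: of_nat_mult)
  finally show ?case .
qed

section \<open>Switchings in regular graphs\<close>

lemma finite_regular_graphs: "finite (regular_graphs n d)"
  by (rule finite_subset[of _ "Pow (Pow {1..n})"]) (auto simp: regular_graphs_def)

lemma regular_graph_finite: "F \<in> regular_graphs n d \<Longrightarrow> finite F"
  by (rule finite_subset[of _ "Pow {1..n}"]) (auto simp: regular_graphs_def)

lemma regular_graph_edge:
  assumes "F \<in> regular_graphs n d" "f \<in> F"
  obtains a b where "f = {a, b}" "a \<noteq> b" "a \<in> {1..n}" "b \<in> {1..n}"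
proof -
  have "f \<subseteq> {1..n}" "card f = 2" using assms by (auto simp: regular_graphs_def)
  then show ?thesis using that by (auto simp: card_2_iff)
qed

lemma regular_graph_degree: "F \<in> regular_graphs n d \<Longrightarrow> v \<in> {1..n} \<Longrightarrow> card {f \<in> F. v \<in> f} = d"
  by (simp add: regular_graphs_def)

lemma card_regular_graph:
  assumes "F \<in> regular_graphs n d"
  shows "2 * card F = n * d"
proof -
  have "n * d = (\<Sum>v\<in>{1..n}. card {f \<in> F. v \<in> f})"
    using regular_graph_degree[OF assms] by simp
  also have "\<dots> = (\<Sum>f\<in>F. card {v \<in> {1..n}. v \<in> f})"
    using regular_graph_finite[OF assms] by (intro sum_multicount_gen) auto
  also have "\<dots> = (\<Sum>f\<in>F. 2)"
  proof (rule sum.cong[OF refl])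
    fix f assume "f \<in> F"
    then have "f \<subseteq> {1..n}" "card f = 2" using assms by (auto simp: regular_graphs_def)
    moreover from this have "{v \<in> {1..n}. v \<in> f} = f" by auto
    ultimately show "card {v \<in> {1..n}. v \<in> f} = 2" by simp
  qed
  finally show ?thesis by simp
qed

lemma card_regular_neighbours:
  assumes "F \<in> regular_graphs n d" "v \<in> {1..n}"
  shows "finite {a. {v, a} \<in> F}" "card {a. {v, a} \<in> F} \<le> d"
proof -
  have sub: "{a. {v, a} \<in> F} \<subseteq> {1..n}" using assms by (auto simp: regular_graphs_def)
  then show "finite {a. {v, a} \<in> F}" by (rule finite_subset) simp
  have "card {a. {v, a} \<in> F} \<le> card {f \<in> F. v \<in> f}"
    by (rule card_inj_on_le[of "\<lambda>a. {v, a}"])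
      (use regular_graph_finite[OF assms(1)] in \<open>auto simp: inj_on_def doubleton_eq_iff\<close>)
  then show "card {a. {v, a} \<in> F} \<le> d" using regular_graph_degree[OF assms] by simp
qed

text \<open>Both pairs of edges cover \<open>u\<close>, \<open>v\<close>, \<open>a\<close>,
  \<open>b\<close> once each, so all degrees persist; the side conditions exclude loops and multiple
  edges.\<close>

lemma regular_graph_switch:
  assumes F: "F \<in> regular_graphs n d" and uv: "{u, v} \<in> F" "u \<noteq> v" and ab: "{a, b} \<in> F" "a \<noteq> b"
    and disj: "a \<notin> {u, v}" "b \<notin> {u, v}" and new: "{u, a} \<notin> F" "{v, b} \<notin> F"
  shows "F - {{u, v}, {a, b}} \<union> {{u, a}, {v, b}} \<in> regular_graphs n d" (is "?F \<in> _")
proof -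
  have finF: "finite F" using regular_graph_finite[OF F] .
  have V: "u \<in> {1..n}" "v \<in> {1..n}" "a \<in> {1..n}" "b \<in> {1..n}"
    using F uv ab by (auto simp: regular_graphs_def)
  have "card {f \<in> ?F. w \<in> f} = d" if w: "w \<in> {1..n}" for w
  proof -
    define s :: "nat set \<Rightarrow> int" where "s = (\<lambda>f. of_bool (w \<in> f))"
    have c: "int (card {f \<in> H. w \<in> f}) = (\<Sum>f\<in>H. s f)" if "finite H" for H
      using that by (simp add: s_def of_bool_def sum.If_cases Int_def)
    have ne: "{u, v} \<noteq> {a, b}" "{u, a} \<noteq> {v, b}" using disj uv by (auto simp: doubleton_eq_iff)
    have "(\<Sum>f\<in>?F. s f) = (\<Sum>f\<in>F - {{u, v}, {a, b}}. s f) + (\<Sum>f\<in>{{u, a}, {v, b}}. s f)"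
      using finF new by (intro sum.union_disjoint) auto
    also have "(\<Sum>f\<in>F - {{u, v}, {a, b}}. s f) = (\<Sum>f\<in>F. s f) - (\<Sum>f\<in>{{u, v}, {a, b}}. s f)"
      using finF uv ab by (intro sum_diff) auto
    also have "(\<Sum>f\<in>{{u, v}, {a, b}}. s f) = (\<Sum>f\<in>{{u, a}, {v, b}}. s f)"
    proof -
      have two: "(\<Sum>f\<in>{p, q}. s f) = s p + s q" if "p \<noteq> q" for p q using that by simp
      show ?thesis unfolding two[OF ne(1)] two[OF ne(2)] using disj uv(2) ab(2) by (auto simp: s_def)
    qed
    finally have "(\<Sum>f\<in>?F. s f) = (\<Sum>f\<in>F. s f)" by simp
    moreover have "finite ?F" using finF by simp
    ultimately have "int (card {f \<in> ?F. w \<in> f}) = int (card {f \<in> F. w \<in> f})"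
      using c[of F] c[of ?F] finF by presburger
    then show ?thesis using regular_graph_degree[OF F w] by simp
  qed
  moreover have "?F \<subseteq> {e. e \<subseteq> {1..n} \<and> card e = 2}"
    using F V disj by (auto simp: regular_graphs_def)
  ultimately show ?thesis by (simp add: regular_graphs_def)
qed

text \<open>The edge \<open>e = {u, v}\<close> is switched with an edge \<open>{a, b}\<close>
  outside \<open>X\<close> whose ends avoid \<open>u\<close>, \<open>v\<close> and their neighbours;
  these at most \<open>2 * d + 2\<close> vertices spoil at most \<open>(2 * d + 2) * d\<close>
  edges. Conversely \<open>a\<close> is a neighbour of \<open>u\<close> and \<open>b\<close> one of
  \<open>v\<close> in the new graph, which leaves \<open>d * d\<close> possibilities.\<close>

lemma card_regular_containing_insert:
  assumes X: "finite X" "e \<notin> X"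
  shows "card {F \<in> regular_graphs n d. insert e X \<subseteq> F} * (n * d div 2 - card X - 1 - (2 * d + 2) * d)
           \<le> card {F \<in> regular_graphs n d. X \<subseteq> F} * (d * d)"
proof (cases "{F \<in> regular_graphs n d. insert e X \<subseteq> F} = {}")
  case True
  then have "card {F \<in> regular_graphs n d. insert e X \<subseteq> F} = 0" by (simp only: card.empty)
  then show ?thesis by simp
next
  case False
  let ?A = "{F \<in> regular_graphs n d. insert e X \<subseteq> F}"
  let ?B = "{F \<in> regular_graphs n d. X \<subseteq> F}"
  obtain F0 where "F0 \<in> regular_graphs n d" "e \<in> F0" using False by auto
  then obtain u v where uv: "e = {u, v}" "u \<noteq> v" "u \<in> {1..n}" "v \<in> {1..n}"
    by (rule regular_graph_edge)
  define K where "K = (\<lambda>F. {(a, b). {a, b} \<in> F \<and> a \<noteq> b \<and> {a, b} \<notin> X \<and> a \<notin> {u, v} \<and> b \<notin> {u, v} \<and> {u, a} \<notin> F \<and> {v, b} \<notin> F})"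
  define sw where "sw = (\<lambda>F (a, b). F - {{u, v}, {a, b}} \<union> {{u, a}, {v, b}})"
  define Dec where "Dec = (\<lambda>F. (\<lambda>(a, b). (F - {{u, a}, {v, b}} \<union> {{u, v}, {a, b}}, (a, b))) `
      ({a. {u, a} \<in> F} \<times> {b. {v, b} \<in> F}))"
  show ?thesis
  proof (rule switching_card_le[of ?A ?B K _ sw Dec])
    show "finite ?A" "finite ?B" using finite_regular_graphs by auto
  next
    fix F assume F: "F \<in> ?A"
    have FR: "F \<in> regular_graphs n d" "finite F" using F regular_graph_finite by auto
    define Z where "Z = {u, v} \<union> {a. {u, a} \<in> F} \<union> {a. {v, a} \<in> F}"
    note Nu = card_regular_neighbours[OF FR(1) uv(3)] and Nv = card_regular_neighbours[OF FR(1) uv(4)]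
    have ZV: "Z \<subseteq> {1..n}" using FR uv by (auto simp: Z_def regular_graphs_def)
    have finZ: "finite Z" using Nu Nv by (simp add: Z_def)
    have cZ: "card Z \<le> 2 * d + 2"
    proof -
      have "card Z \<le> card {u, v} + card {a. {u, a} \<in> F} + card {a. {v, a} \<in> F}"
        unfolding Z_def by (intro order_trans[OF card_Un_le] add_mono order_refl)
      then show ?thesis using uv Nu Nv by simp
    qed
    let ?T = "\<Union>z\<in>Z. {f \<in> F. z \<in> f}"
    let ?G = "F - X - {e} - ?T"
    have "card ?T \<le> (\<Sum>z\<in>Z. card {f \<in> F. z \<in> f})" using finZ by (rule card_UN_le)
    also have "\<dots> = (\<Sum>z\<in>Z. d)"
      using regular_graph_degree[OF FR(1)] ZV by (intro sum.cong refl) blast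
    also have "\<dots> = card Z * d" by simp
    also have "\<dots> \<le> (2 * d + 2) * d" using cZ by (intro mult_right_mono) auto
    finally have cT: "card ?T \<le> (2 * d + 2) * d" .
    have "card F \<le> card ?G + card X + card {e} + card ?T"
    proof -
      have "finite (?G \<union> X \<union> {e} \<union> ?T)" using FR X finZ by simp
      then have "card F \<le> card (?G \<union> X \<union> {e} \<union> ?T)" by (rule card_mono) blast
      also have "\<dots> \<le> card ?G + card X + card {e} + card ?T"
        by (intro order_trans[OF card_Un_le] add_mono order_refl)
      finally show ?thesis .
    qed
    then have G: "n * d div 2 - card X - 1 - (2 * d + 2) * d \<le> card ?G"
      using cT card_regular_graph[OF FR(1)] by simp
    \<comment> \<open>One orientation is fixed for every edge, so that distinct available edges give
      distinct moves.\<close>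
    define pr where "pr = (\<lambda>f. SOME (a, b). f = {a, b} \<and> (a :: nat) \<noteq> b)"
    have pr: "f = {fst (pr f), snd (pr f)} \<and> fst (pr f) \<noteq> snd (pr f)" if f: "f \<in> F" for f
    proof -
      obtain a b where "f = {a, b}" "a \<noteq> b" using regular_graph_edge[OF FR(1) f] .
      then have "\<exists>p. case p of (a, b) \<Rightarrow> f = {a, b} \<and> a \<noteq> b" by auto
      then have "case pr f of (a, b) \<Rightarrow> f = {a, b} \<and> a \<noteq> b" unfolding pr_def by (rule someI_ex)
      then show ?thesis by (simp add: case_prod_beta)
    qed
    have finK: "finite (K F)"
    proof (rule finite_subset)
      show "K F \<subseteq> {1..n} \<times> {1..n}" using FR by (auto simp: K_def regular_graphs_def)
    qed simp
    have "card ?G \<le> card (K F)"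
    proof (rule card_inj_on_le[of pr])
      show "inj_on pr ?G" using pr by (metis (no_types, lifting) DiffD1 inj_onI)
      show "pr ` ?G \<subseteq> K F"
      proof (rule image_subsetI)
        fix f assume f: "f \<in> ?G"
        obtain a b where ab: "pr f = (a, b)" by (cases "pr f")
        then have fab: "f = {a, b}" "a \<noteq> b" using pr[of f] f by auto
        have "a \<notin> Z" "b \<notin> Z" using f fab by auto
        then show "pr f \<in> K F" unfolding ab using fab f by (auto simp: K_def Z_def)
      qed
    qed (rule finK)
    then show "finite (K F) \<and> n * d div 2 - card X - 1 - (2 * d + 2) * d \<le> card (K F)"
      using G finK by simp
  next
    fix F k assume F: "F \<in> ?A" and k: "k \<in> K F"
    obtain a b where ab: "k = (a, b)" by (cases k)
    have kab: "{a, b} \<in> F" "a \<noteq> b" "{a, b} \<notin> X" "a \<notin> {u, v}" "b \<notin> {u, v}" "{u, a} \<notin> F" "{v, b} \<notin> F"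
      using k by (auto simp: K_def ab)
    have FR: "F \<in> regular_graphs n d" "{u, v} \<in> F" "X \<subseteq> F" "{u, v} \<notin> X" using F uv X by auto
    have "sw F k \<in> regular_graphs n d"
      unfolding sw_def ab prod.case using regular_graph_switch[OF FR(1,2) uv(2) kab(1,2,4,5,6,7)] .
    moreover have "X \<subseteq> sw F k" using FR kab by (auto simp: sw_def ab)
    moreover have "(F, k) \<in> Dec (sw F k)"
    proof -
      have "sw F k - {{u, a}, {v, b}} \<union> {{u, v}, {a, b}} = F"
        using FR kab by (auto simp: sw_def ab)
      then show ?thesis unfolding Dec_def using ab by (intro image_eqI[of _ _ "(a, b)"]) (auto simp: sw_def)
    qed
    ultimately show "sw F k \<in> ?B \<and> (F, k) \<in> Dec (sw F k)" by simp
  next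
    fix F assume F: "F \<in> ?B"
    then have FR: "F \<in> regular_graphs n d" by simp
    note Nu = card_regular_neighbours[OF FR(1) uv(3)] and Nv = card_regular_neighbours[OF FR(1) uv(4)]
    have "card ({a. {u, a} \<in> F} \<times> {b. {v, b} \<in> F}) \<le> d * d"
      unfolding card_cartesian_product using Nu Nv by (intro mult_le_mono)
    then show "finite (Dec F) \<and> card (Dec F) \<le> d * d"
      unfolding Dec_def using Nu Nv by (auto intro: order_trans[OF card_image_le])
  qed
qed

text \<open>If an edge is present then \<open>d \<ge> 1\<close>, so at least
  \<open>n * d / 96 \<ge> n / 96\<close> edges lie outside \<open>X\<close>. The lower bound on
  \<open>n\<close> makes the further deduction at most \<open>n / 192\<close>, and
  \<open>n / 192\<close> moves remain.\<close>

lemma card_regular_containing_le: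
  assumes n: "n \<ge> 192 * (2 * d + 4) * (d + 1)" and T: "finite T"
  shows "real (card {F \<in> regular_graphs n d. T \<subseteq> F})
     \<le> (192 * real d * real d / real n) ^ (card T - card T div 48) * real (card (regular_graphs n d))"
proof (rule card_containing_le_of_switching[OF finite_regular_graphs T, where M = "n * d div 2" and E = "\<lambda>F. F"])
  fix X :: "nat set set" and e assume X: "finite X" "e \<notin> X" "n * d div 2 \<le> 48 * (n * d div 2 - card X)"
  let ?A = "{F \<in> regular_graphs n d. insert e X \<subseteq> F}"
  let ?B = "{F \<in> regular_graphs n d. X \<subseteq> F}"
  have n0: "n > 0" using n by (cases "n = 0") auto
  show "real (card ?A) \<le> 192 * real d * real d / real n * real (card ?B)"
  proof (cases "?A = {}")
    case True
    then have A0: "card ?A = 0" by (simp only: card.empty)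
    show ?thesis unfolding A0 by simp
  next
    case False
    then obtain F where F: "F \<in> regular_graphs n d" "e \<in> F" by auto
    then have "card F > 0" using regular_graph_finite card_gt_0_iff by blast
    then have d: "d \<ge> 1" using card_regular_graph[OF F(1)] by (cases d) auto
    let ?D = "n * d div 2 - card X - 1 - (2 * d + 2) * d"
    have M: "2 * (n * d div 2) = n * d" using card_regular_graph[OF F(1)] by (metis dvd_mult_div_cancel dvd_triv_left)
    have "real (n * d) \<le> 96 * real (n * d div 2 - card X)"
      using X(3) M by linarith
    moreover have "real n \<le> real (n * d)" using mult_left_mono[of 1 "real d" "real n"] d by simp
    ultimately have "real n \<le> 96 * real (n * d div 2 - card X)" by linarith
    moreover have "192 * (1 + (2 * d + 2) * d) \<le> n"
    proof -
      have "1 + (2 * d + 2) * d \<le> (2 * d + 4) * (d + 1)" by (simp add: algebra_simps)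
      then have "192 * (1 + (2 * d + 2) * d) \<le> 192 * ((2 * d + 4) * (d + 1))" by (rule mult_le_mono2)
      also have "\<dots> \<le> n" using n by (simp only: mult.assoc)
      finally show ?thesis .
    qed
    then have "192 * (1 + real ((2 * d + 2) * d)) \<le> real n" by (metis (mono_tags, lifting) of_nat_1 of_nat_add of_nat_le_iff of_nat_mult of_nat_numeral)
    moreover have "real n / 192 \<le> real (x - 1 - c)" if "real n \<le> 96 * real x" "192 * (1 + real c) \<le> real n" for x c
    proof -
      have "x \<le> x - 1 - c + 1 + c" by simp
      then have "real x \<le> real (x - 1 - c) + 1 + real c" by linarith
      moreover define y where "y = real (x - 1 - c)"
      ultimately have "real x \<le> y + 1 + real c" by simp
      then have "real n / 192 \<le> y" using that by (simp add: field_simps)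
      then show ?thesis by (simp only: y_def)
    qed
    ultimately have D: "real n / 192 \<le> real ?D" by blast
    have "real (card ?A) * real ?D \<le> real (card ?B) * real (d * d)"
      using of_nat_mono[OF card_regular_containing_insert[OF X(1,2), of n d], where ?'a = real]
      by (simp only: of_nat_mult)
    moreover have "real (card ?A) * (real n / 192) \<le> real (card ?A) * real ?D" using D by (intro mult_left_mono) auto
    ultimately have "real (card ?A) * (real n / 192) \<le> real (card ?B) * real (d * d)" by linarith
    then show ?thesis using n0 by (simp add: field_simps)
  qed
next
  fix F assume "F \<in> regular_graphs n d"
  then show "finite F \<and> card F \<le> n * d div 2" using card_regular_graph regular_graph_finite by fastforce
qed auto

section \<open>Existence of regular graphs\<close>

lemma card_residues_below:
  fixes h m a d :: nat
  assumes "d \<le> h" "h > 0"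
  shows "card {b \<in> {m + 1..m + h}. (a + b) mod h < d} = d"
proof -
  let ?f = "\<lambda>b. (a + b) mod h"
  have inj: "inj_on ?f {m + 1..m + h}"
  proof (rule inj_onI)
    fix b c assume bc: "b \<in> {m + 1..m + h}" "c \<in> {m + 1..m + h}" "?f b = ?f c"
    have *: "x = y" if "x \<le> y" "x \<in> {m + 1..m + h}" "y \<in> {m + 1..m + h}" "?f x = ?f y" for x y
    proof -
      have "h dvd (a + y) - (a + x)" using that mod_eq_dvd_iff_nat[where m = "a + y" and n = "a + x" and q = h] by simp
      then have "h dvd y - x" by simp
      moreover have "y - x < h" using that by auto
      ultimately have "y - x = 0" using dvd_imp_le[of h "y - x"] by linarith
      then show ?thesis using that by simp
    qed
    show "b = c"
    proof (cases "b \<le> c")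
      case True
      then show ?thesis using *[OF True bc] by blast
    next
      case False
      then have "c \<le> b" by simp
      then show ?thesis using *[OF _ bc(2,1)] bc(3) by simp
    qed
  qed
  have "?f ` {m + 1..m + h} = {..<h}"
  proof (rule card_subset_eq)
    show "card (?f ` {m + 1..m + h}) = card {..<h}" using card_image[OF inj] by simp
  qed (use assms(2) in auto)
  then have bij: "bij_betw ?f {m + 1..m + h} {..<h}" using inj by (simp add: bij_betw_def)
  have img: "?f ` {b \<in> {m + 1..m + h}. (a + b) mod h < d} = {..<d}"
  proof (intro equalityI subsetI)
    fix x assume "x \<in> {..<d}"
    then have "x \<in> ?f ` {m + 1..m + h}" using bij assms by (auto simp: bij_betw_def)
    then show "x \<in> ?f ` {b \<in> {m + 1..m + h}. (a + b) mod h < d}" using \<open>x \<in> {..<d}\<close> by auto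
  qed auto
  have "inj_on ?f {b \<in> {m + 1..m + h}. (a + b) mod h < d}" using inj by (rule inj_on_subset) auto
  from card_image[OF this] show ?thesis unfolding img by simp
qed

text \<open>A bipartite circulant graph between the two halves of the vertex set: \<open>a\<close>
  and \<open>b\<close> are joined if the residue of \<open>a + b\<close> modulo \<open>h\<close> is
  below \<open>d\<close>. Each vertex sees every residue exactly once on the other side.\<close>

lemma regular_graphs_nonempty:
  assumes "even n" "2 * d \<le> n" "n > 0"
  shows "regular_graphs n d \<noteq> {}"
proof -
  define h where "h = n div 2"
  have h: "n = 2 * h" "h > 0" "d \<le> h" using assms by (auto simp: h_def)
  define F where "F = {{a, b} | a b. a \<in> {1..h} \<and> b \<in> {h + 1..h + h} \<and> (a + b) mod h < d}"
  have "card {f \<in> F. v \<in> f} = d" if v: "v \<in> {1..n}" for v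
  proof (cases "v \<le> h")
    case True
    have "{f \<in> F. v \<in> f} = (\<lambda>b. {v, b}) ` {b \<in> {h + 1..h + h}. (v + b) mod h < d}"
      using True v by (auto simp: F_def)
    moreover have "inj_on (\<lambda>b. {v, b}) {b \<in> {h + 1..h + h}. (v + b) mod h < d}"
      by (auto simp: inj_on_def doubleton_eq_iff)
    ultimately show ?thesis using card_residues_below[OF h(3,2), of h v] by (simp add: card_image)
  next
    case False
    have "{f \<in> F. v \<in> f} = (\<lambda>a. {a, v}) ` {a \<in> {0 + 1..0 + h}. (v + a) mod h < d}"
    proof (intro equalityI subsetI)
      fix f assume "f \<in> (\<lambda>a. {a, v}) ` {a \<in> {0 + 1..0 + h}. (v + a) mod h < d}"
      then obtain a where a: "f = {a, v}" "a \<in> {1..h}" "(a + v) mod h < d" by (auto simp: add.commute)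
      moreover have "v \<in> {h + 1..h + h}" using False v h by auto
      ultimately show "f \<in> {f \<in> F. v \<in> f}" unfolding F_def by blast
    qed (use False v h in \<open>auto simp: F_def add.commute\<close>)
    moreover have "inj_on (\<lambda>a. {a, v}) {a \<in> {0 + 1..0 + h}. (v + a) mod h < d}"
      by (auto simp: inj_on_def doubleton_eq_iff)
    ultimately show ?thesis using card_residues_below[OF h(3,2), of 0 v] by (simp add: card_image)
  qed
  moreover have "F \<subseteq> {e. e \<subseteq> {1..n} \<and> card e = 2}" using h by (auto simp: F_def)
  ultimately have "F \<in> regular_graphs n d" by (simp add: regular_graphs_def)
  then show ?thesis by blast
qed

section \<open>The balanced multigraph\<close>

text \<open>List positions start at \<open>0\<close>, so position \<open>i\<close> carries the
  vertex with index \<open>i + 1\<close> of the cycle. The floors of real quotients become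
  \<open>div\<close>.\<close>

definition selected_positions :: "nat \<Rightarrow> nat \<Rightarrow> nat set" where
  "selected_positions n r = {i. i < n \<and> i * r div n < Suc i * r div n}"

lemma cycle_selection_eq: "cycle_selection vs r = (!) vs ` selected_positions (length vs) r"
proof -
  let ?n = "length vs"
  have fl: "\<lfloor>real a / real b\<rfloor> < \<lfloor>real c / real b\<rfloor> \<longleftrightarrow> a div b < c div b" for a b c :: nat
    by (simp add: floor_divide_of_nat_eq)
  show ?thesis
  proof (intro equalityI subsetI)
    fix x assume "x \<in> cycle_selection vs r"
    then obtain i where i: "x = vs ! (i - 1)" "i \<in> {1..?n}" "(i - 1) * r div ?n < i * r div ?n"
      unfolding cycle_selection_def fl by blast
    then obtain k where k: "i = Suc k" by (cases i) auto
    then have "k \<in> selected_positions ?n r" using i by (auto simp: selected_positions_def)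
    then show "x \<in> (!) vs ` selected_positions ?n r" using i k by auto
  next
    fix x assume "x \<in> (!) vs ` selected_positions ?n r"
    then obtain i where i: "x = vs ! i" "i \<in> selected_positions ?n r" by blast
    then have "x = vs ! (Suc i - 1)" "Suc i \<in> {1..?n}" "(Suc i - 1) * r div ?n < Suc i * r div ?n"
      by (auto simp: selected_positions_def)
    then show "x \<in> cycle_selection vs r" unfolding cycle_selection_def fl by blast
  qed
qed

lemma selected_step:
  fixes i r n :: nat
  assumes "r \<le> n" "n > 0"
  shows "Suc i * r div n \<le> i * r div n + 1" "i * r div n \<le> Suc i * r div n"
proof -
  have "Suc i * r div n \<le> (i * r + n) div n" using assms by (intro div_le_mono) auto
  then show "Suc i * r div n \<le> i * r div n + 1" using assms by simp
  show "i * r div n \<le> Suc i * r div n" by (intro div_le_mono) auto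
qed

text \<open>The quotient \<open>i * r div n\<close> rises from \<open>0\<close> to \<open>r\<close>
  in steps of \<open>0\<close> or \<open>1\<close>, and the selected positions are those where it
  rises.\<close>

lemma card_selected_positions:
  assumes "r \<le> n" "n > 0"
  shows "card (selected_positions n r) = r"
proof -
  have "card {i. i < k \<and> i * r div n < Suc i * r div n} = k * r div n" for k
  proof (induction k)
    case (Suc k)
    have "{i. i < Suc k \<and> i * r div n < Suc i * r div n} = {i. i < k \<and> i * r div n < Suc i * r div n} \<union>
        (if k * r div n < Suc k * r div n then {k} else {})" by (auto simp: less_Suc_eq)
    also have "card \<dots> = k * r div n + (if k * r div n < Suc k * r div n then 1 else 0)"
      using Suc by (subst card_Un_disjoint) auto
    also have "\<dots> = Suc k * r div n" using selected_step[OF assms, of k] by auto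
    finally show ?case .
  qed auto
  from this[of n] show ?thesis using assms by (simp add: selected_positions_def)
qed

lemma finite_selected_positions: "finite (selected_positions n r)"
  by (simp add: selected_positions_def)

text \<open>Two rises in a row would need \<open>2 * r \<ge> n\<close>, and across the wrap position
  \<open>0\<close> is not selected because \<open>r < n\<close>. For few chords this keeps the
  sources pairwise nonadjacent on the cycle.\<close>

lemma selected_not_adjacent:
  assumes r: "2 * r < n" and i: "i \<in> selected_positions n r"
  shows "Suc i mod n \<notin> selected_positions n r"
proof
  assume s: "Suc i mod n \<in> selected_positions n r"
  have n0: "n > 0" using r by simp
  show False
  proof (cases "Suc i < n")
    case True
    then have "Suc i * r div n < Suc (Suc i) * r div n" "i * r div n < Suc i * r div n"
      using s i by (auto simp: selected_positions_def)
    then have "i * r div n + 2 \<le> Suc (Suc i) * r div n" by linarith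
    moreover have "Suc (Suc i) * r div n \<le> (i * r + n) div n" using r by (intro div_le_mono) auto
    moreover have "(i * r + n) div n = i * r div n + 1" using n0 by simp
    ultimately show False by linarith
  next
    case False
    then have "Suc i = n" using i by (auto simp: selected_positions_def)
    then have "0 \<in> selected_positions n r" using s by simp
    then show False using r by (simp add: selected_positions_def)
  qed
qed

lemma card_cycle_selection:
  assumes "distinct vs" "r \<le> length vs" "length vs > 0"
  shows "card (cycle_selection vs r) = r" "cycle_selection vs r \<subseteq> set vs" "finite (cycle_selection vs r)"
proof -
  have "inj_on ((!) vs) (selected_positions (length vs) r)"
    using assms by (auto simp: inj_on_def selected_positions_def nth_eq_iff_index_eq)
  then show "card (cycle_selection vs r) = r"
    unfolding cycle_selection_eq using card_selected_positions[OF assms(2,3)] by (simp add: card_image)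
  show "cycle_selection vs r \<subseteq> set vs" unfolding cycle_selection_eq by (auto simp: selected_positions_def)
  show "finite (cycle_selection vs r)" unfolding cycle_selection_eq by (simp add: finite_selected_positions)
qed

lemma cycle_neighbour:
  assumes "distinct vs" "i < length vs" "{vs ! i, v} \<in> cycle_set vs"
  shows "v = vs ! (Suc i mod length vs) \<or> (\<exists>j<length vs. Suc j mod length vs = i \<and> v = vs ! j)"
proof -
  let ?n = "length vs"
  obtain k where k: "k < ?n" "{vs ! i, v} = {vs ! k, vs ! (Suc k mod ?n)}"
    using assms by (auto simp: cycle_set_def cycle_edge_def)
  have "Suc k mod ?n < ?n" using k by (intro mod_less_divisor) linarith
  then show ?thesis
    using k assms by (auto simp: doubleton_eq_iff nth_eq_iff_index_eq)
qed

lemma Suc_mod_inj: "a < n \<Longrightarrow> b < n \<Longrightarrow> Suc a mod n = Suc b mod n \<Longrightarrow> a = b"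
  by (auto simp: mod_Suc split: if_splits)

lemma card_cycle_neighbours:
  assumes "distinct vs" "v \<in> set vs"
  shows "finite {w. {v, w} \<in> cycle_set vs}" "card {w. {v, w} \<in> cycle_set vs} \<le> 2"
proof -
  let ?n = "length vs"
  obtain i where i: "i < ?n" "v = vs ! i" using assms by (auto simp: in_set_conv_nth)
  define j where "j = (THE j. j < ?n \<and> Suc j mod ?n = i)"
  have sub: "{w. {v, w} \<in> cycle_set vs} \<subseteq> {vs ! (Suc i mod ?n), vs ! j}"
  proof
    fix w assume "w \<in> {w. {v, w} \<in> cycle_set vs}"
    then have "w = vs ! (Suc i mod ?n) \<or> (\<exists>j<?n. Suc j mod ?n = i \<and> w = vs ! j)"
      using cycle_neighbour[of vs i w] assms i by simp
    moreover have "w = vs ! j" if k: "k < ?n" "Suc k mod ?n = i" "w = vs ! k" for k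
    proof -
      have "j = k" unfolding j_def
      proof (rule the_equality)
        show "k < ?n \<and> Suc k mod ?n = i" using k by simp
        show "l = k" if "l < ?n \<and> Suc l mod ?n = i" for l
          using Suc_mod_inj[of l ?n k] that k by simp
      qed
      then show ?thesis using k by simp
    qed
    ultimately show "w \<in> {vs ! (Suc i mod ?n), vs ! j}" by auto
  qed
  show "finite {w. {v, w} \<in> cycle_set vs}" by (rule finite_subset[OF sub]) simp
  have "card {w. {v, w} \<in> cycle_set vs} \<le> card {vs ! (Suc i mod ?n), vs ! j}" by (rule card_mono[OF _ sub]) simp
  also have "\<dots> \<le> 2" by (rule order_trans[OF card_insert_le_m1]) auto
  finally show "card {w. {v, w} \<in> cycle_set vs} \<le> 2" .
qed

lemma card_cycle_incident:
  assumes "distinct vs" "length vs \<ge> 3" "v \<in> set vs"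
  shows "2 \<le> card {e \<in> cycle_set vs. v \<in> e}"
proof -
  let ?n = "length vs"
  obtain i where i: "i < ?n" "v = vs ! i" using assms by (auto simp: in_set_conv_nth)
  define j where "j = (if i = 0 then ?n - 1 else i - 1)"
  have j: "j < ?n" "Suc j mod ?n = i" "j \<noteq> i" using i assms by (auto simp: j_def)
  have "cycle_edge vs i \<noteq> cycle_edge vs j" using cycle_edge_eq_iff[OF assms(1,2) i(1) j(1)] j by auto
  moreover have "{cycle_edge vs i, cycle_edge vs j} \<subseteq> {e \<in> cycle_set vs. v \<in> e}"
    using i j by (auto simp: cycle_set_def cycle_edge_def)
  ultimately show ?thesis
    using card_mono[of "{e \<in> cycle_set vs. v \<in> e}" "{cycle_edge vs i, cycle_edge vs j}"] finite_cycle_set[of vs]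
    by simp
qed

lemma cycle_set_subset:
  assumes "distinct vs" "length vs \<ge> 3" "e \<in> cycle_set vs"
  shows "e \<subseteq> set vs" "card e = 2"
proof -
  obtain i where i: "i < length vs" "e = cycle_edge vs i" using assms by (auto simp: cycle_set_def)
  then have "Suc i mod length vs < length vs" by (intro mod_less_divisor) linarith
  then show "e \<subseteq> set vs" using i by (auto simp: cycle_edge_def)
  show "card e = 2" using card_cycle_edge[OF assms(1,2) i(1)] i by simp
qed

definition sum_multigraph :: "nat set set \<Rightarrow> nat list \<Rightarrow> nat set \<Rightarrow> (nat \<Rightarrow> nat) \<Rightarrow> nat set multiset" where
  "sum_multigraph F vs R y = mset_set F + cycle_edges vs + image_mset (\<lambda>x. {x, y x}) (mset_set R)"

lemma set_sum_multigraph: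
  assumes "finite F" "finite R"
  shows "set_mset (sum_multigraph F vs R y) = F \<union> cycle_set vs \<union> chord_set R y"
  using assms by (auto simp: sum_multigraph_def set_mset_cycle_edges chord_set_def)

text \<open>The multiplicity of an edge is the sum of those in the three layers. The cycle is simple
  by itself because its length is at least \<open>3\<close>, and a chord can repeat only when two
  sources choose each other.\<close>

lemma simple_sum_multigraph_iff:
  assumes F: "finite F" "\<And>f. f \<in> F \<Longrightarrow> card f = 2" and R: "finite R" and vs: "distinct vs" "length vs \<ge> 3"
  shows "simple_multigraph (sum_multigraph F vs R y) \<longleftrightarrow>
     F \<inter> cycle_set vs = {} \<and> chord_set R y \<inter> (F \<union> cycle_set vs) = {} \<and>
     (\<forall>x\<in>R. y x \<noteq> x) \<and> (\<forall>x\<in>R. \<forall>x'\<in>R. y x = x' \<longrightarrow> y x' \<noteq> x)"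
proof -
  have cyc: "cycle_edges vs = mset_set (cycle_set vs)"
    unfolding cycle_edges_def cycle_set_def cycle_edge_def[abs_def, symmetric]
    using inj_on_cycle_edge[OF vs] by (simp add: cycle_edge_def[abs_def] image_mset_mset_set)
  have cnt: "count (image_mset (\<lambda>x. {x, y x}) (mset_set R)) e = card {x \<in> R. {x, y x} = e}" for e
  proof -
    have "count (image_mset (\<lambda>x. {x, y x}) (mset_set R)) e = (\<Sum>x | x \<in> R \<and> e = {x, y x}. 1)"
      using R by (simp add: count_image_mset')
    also have "\<dots> = card {x \<in> R. e = {x, y x}}" by simp
    also have "{x \<in> R. e = {x, y x}} = {x \<in> R. {x, y x} = e}" by auto
    finally show ?thesis .
  qed
  have count: "count (sum_multigraph F vs R y) e
     = of_bool (e \<in> F) + of_bool (e \<in> cycle_set vs) + card {x \<in> R. {x, y x} = e}" for e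
    using F finite_cycle_set[of vs] by (simp add: sum_multigraph_def cyc cnt count_mset_set')
  have mem: "card {x \<in> R. {x, y x} = e} > 0 \<longleftrightarrow> e \<in> chord_set R y" for e
    using R by (auto simp: card_gt_0_iff chord_set_def)
  let ?H = "sum_multigraph F vs R y"
  have set: "set_mset ?H = F \<union> cycle_set vs \<union> chord_set R y" by (rule set_sum_multigraph[OF F(1) R])
  show ?thesis
  proof
    assume s: "simple_multigraph ?H"
    have one: "count ?H e = 1" "card e = 2" if "e \<in> F \<union> cycle_set vs \<union> chord_set R y" for e
      using s that set by (auto simp: simple_multigraph_def)
    have "F \<inter> cycle_set vs = {}" using one(1) count by fastforce
    moreover have "chord_set R y \<inter> (F \<union> cycle_set vs) = {}"
    proof (rule ccontr)
      assume "chord_set R y \<inter> (F \<union> cycle_set vs) \<noteq> {}"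
      then obtain e where e: "e \<in> chord_set R y" "e \<in> F \<or> e \<in> cycle_set vs" by blast
      then have "count ?H e \<ge> 1 + card {x \<in> R. {x, y x} = e}" by (auto simp: count)
      then show False using one(1)[of e] e mem[of e] by simp
    qed
    moreover have "\<forall>x\<in>R. y x \<noteq> x"
    proof
      fix x assume "x \<in> R"
      then have "card {x, y x} = 2" using one(2)[of "{x, y x}"] by (auto simp: chord_set_def)
      then show "y x \<noteq> x" by auto
    qed
    moreover have "\<forall>x\<in>R. \<forall>x'\<in>R. y x = x' \<longrightarrow> y x' \<noteq> x"
    proof (intro ballI impI notI)
      fix x x' assume x: "x \<in> R" "x' \<in> R" "y x = x'" "y x' = x"
      then have "x \<noteq> x'" using \<open>\<forall>x\<in>R. y x \<noteq> x\<close> by auto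
      have "{x, x'} \<subseteq> {z \<in> R. {z, y z} = {x, y x}}" using x by auto
      then have "card {x, x'} \<le> card {z \<in> R. {z, y z} = {x, y x}}" using R by (intro card_mono) auto
      then have "count ?H {x, y x} \<ge> 2" using \<open>x \<noteq> x'\<close> by (simp add: count)
      moreover have "count ?H {x, y x} = 1" using one(1)[of "{x, y x}"] x by (auto simp: chord_set_def)
      ultimately show False by simp
    qed
    ultimately show "F \<inter> cycle_set vs = {} \<and> chord_set R y \<inter> (F \<union> cycle_set vs) = {} \<and>
     (\<forall>x\<in>R. y x \<noteq> x) \<and> (\<forall>x\<in>R. \<forall>x'\<in>R. y x = x' \<longrightarrow> y x' \<noteq> x)" by blast
  next
    assume a: "F \<inter> cycle_set vs = {} \<and> chord_set R y \<inter> (F \<union> cycle_set vs) = {} \<and>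
     (\<forall>x\<in>R. y x \<noteq> x) \<and> (\<forall>x\<in>R. \<forall>x'\<in>R. y x = x' \<longrightarrow> y x' \<noteq> x)"
    have le1: "card {x \<in> R. {x, y x} = e} \<le> 1" for e
    proof -
      have "x = x'" if "x \<in> {x \<in> R. {x, y x} = e}" "x' \<in> {x \<in> R. {x, y x} = e}" for x x'
        using that a by (auto simp: doubleton_eq_iff)
      then show ?thesis using R by (auto simp: card_le_Suc0_iff_eq)
    qed
    have "card e = 2 \<and> count ?H e = 1" if "e \<in># ?H" for e
    proof -
      have "e \<in> F \<or> e \<in> cycle_set vs \<or> e \<in> chord_set R y" using that set by auto
      then show ?thesis
      proof (elim disjE)
        assume e: "e \<in> F"
        then have "e \<notin> cycle_set vs" "\<not> card {x \<in> R. {x, y x} = e} > 0" using a mem by auto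
        then show ?thesis using e F by (simp add: count)
      next
        assume e: "e \<in> cycle_set vs"
        then have "e \<notin> F" "\<not> card {x \<in> R. {x, y x} = e} > 0" using a mem by auto
        then show ?thesis using e cycle_set_subset[OF vs] by (simp add: count)
      next
        assume e: "e \<in> chord_set R y"
        then have "e \<notin> F" "e \<notin> cycle_set vs" "card {x \<in> R. {x, y x} = e} > 0" using a mem by auto
        moreover have "card e = 2" using e a by (auto simp: chord_set_def)
        ultimately show ?thesis using le1[of e] by (simp add: count)
      qed
    qed
    then show "simple_multigraph ?H" by (simp add: simple_multigraph_def)
  qed
qed

section \<open>The conditioned multigraph as a uniform configuration\<close>

lemma card_injections_cong:
  assumes "finite A" "finite A'" "finite B" "card A = card A'"
  shows "card (injections A B) = card (injections A' B)"
  unfolding injections_def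
  using card_inj_on_subset_funcset[OF assms(1,3) order_refl] card_inj_on_subset_funcset[OF assms(2,3) order_refl] assms(4)
  by simp

lemma injections_nonempty:
  assumes "finite A" "finite B" "card A \<le> card B"
  shows "injections A B \<noteq> {}"
proof -
  obtain f where f: "f ` A \<subseteq> B" "inj_on f A" using card_le_inj[OF assms] by blast
  then have "restrict f A \<in> injections A B" by (auto simp: injections_def inj_on_def)
  then show ?thesis by blast
qed

text \<open>All second-stage sets have the same size \<open>k\<close>, so every pair gets the same
  probability. For injections this applies because the number of sources is always
  \<open>r\<close>.\<close>

lemma bind_pmf_of_set_Sigma:
  assumes A: "finite A" "A \<noteq> {}" and B: "\<And>a. a \<in> A \<Longrightarrow> finite (B a) \<and> card (B a) = k" and k: "k > 0"
  shows "bind_pmf (pmf_of_set A) (\<lambda>a. bind_pmf (pmf_of_set (B a)) (f a))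
       = bind_pmf (pmf_of_set (Sigma A B)) (\<lambda>(a, b). f a b)"
proof (rule pmf_eqI)
  fix x
  have Bne: "B a \<noteq> {}" if "a \<in> A" for a using B[OF that] k by auto
  have cA: "card A > 0" using A by (simp add: card_gt_0_iff)
  have S: "finite (Sigma A B)" "Sigma A B \<noteq> {}" using A B Bne by auto
  have cS: "card (Sigma A B) = card A * k" using A B by (subst card_SigmaI) auto
  have "pmf (bind_pmf (pmf_of_set A) (\<lambda>a. bind_pmf (pmf_of_set (B a)) (f a))) x
      = (\<Sum>a\<in>A. (\<Sum>b\<in>B a. pmf (f a b) x) / real k) / real (card A)"
    unfolding pmf_bind_pmf_of_set[OF A(2,1)]
    by (intro arg_cong[where f = "\<lambda>t. t / _"] sum.cong refl) (use B Bne in \<open>simp add: pmf_bind_pmf_of_set\<close>)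
  also have "\<dots> = (\<Sum>a\<in>A. \<Sum>b\<in>B a. pmf (f a b) x) / real (card (Sigma A B))"
    by (simp add: cS sum_divide_distrib[symmetric])
  also have "(\<Sum>a\<in>A. \<Sum>b\<in>B a. pmf (f a b) x) = (\<Sum>ab\<in>Sigma A B. pmf (case ab of (a, b) \<Rightarrow> f a b) x)"
    using A B by (subst sum.Sigma) (auto simp: case_prod_beta)
  also have "\<dots> / real (card (Sigma A B)) = pmf (bind_pmf (pmf_of_set (Sigma A B)) (\<lambda>(a, b). f a b)) x"
    using S by (simp add: pmf_bind_pmf_of_set)
  finally show "pmf (bind_pmf (pmf_of_set A) (\<lambda>a. bind_pmf (pmf_of_set (B a)) (f a))) x
     = pmf (bind_pmf (pmf_of_set (Sigma A B)) (\<lambda>(a, b). f a b)) x" .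
qed

lemma cond_pmf_of_set:
  assumes "finite A" "A \<inter> S \<noteq> {}"
  shows "cond_pmf (pmf_of_set A) S = pmf_of_set (A \<inter> S)"
proof (rule pmf_eqI)
  fix x
  have A: "A \<noteq> {}" using assms by blast
  have c: "card A > 0" "card (A \<inter> S) > 0" using assms A by (auto simp: card_gt_0_iff)
  have "set_pmf (pmf_of_set A) \<inter> S \<noteq> {}" using assms A by simp
  then show "pmf (cond_pmf (pmf_of_set A) S) x = pmf (pmf_of_set (A \<inter> S)) x"
    using assms A c by (simp add: pmf_cond measure_pmf_of_set indicator_def)
qed

text \<open>A dependent sum, because the domain of the injection is selected from the Hamilton
  cycle.\<close>

definition configurations :: "nat \<Rightarrow> nat \<Rightarrow> nat \<Rightarrow> (nat set set \<times> nat list \<times> (nat \<Rightarrow> nat)) set" where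
  "configurations n d r = (SIGMA F : regular_graphs n d. SIGMA vs : permutations_of_set {1..n}.
     injections (cycle_selection vs r) {1..n})"

definition simple_configurations :: "nat \<Rightarrow> nat \<Rightarrow> nat \<Rightarrow> (nat set set \<times> nat list \<times> (nat \<Rightarrow> nat)) set" where
  "simple_configurations n d r = {(F, vs, y) \<in> configurations n d r.
     simple_multigraph (sum_multigraph F vs (cycle_selection vs r) y)}"

definition configuration_graph :: "nat \<Rightarrow> nat set set \<times> nat list \<times> (nat \<Rightarrow> nat) \<Rightarrow> nat set set" where
  "configuration_graph r = (\<lambda>(F, vs, y). F \<union> cycle_set vs \<union> chord_set (cycle_selection vs r) y)"

lemma permutation_list:
  assumes "vs \<in> permutations_of_set {1..n :: nat}"
  shows "distinct vs" "length vs = n" "set vs = {1..n}"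
  using assms distinct_card[of vs] by (auto simp: permutations_of_set_def)

lemma balanced_multigraph_eq:
  assumes n: "n > 0" "r = m mod (n div 2)" "d = m div (n div 2) - 2" and R: "regular_graphs n d \<noteq> {}" and r: "r \<le> n"
  shows "balanced_multigraph n m = map_pmf (\<lambda>(F, vs, y). sum_multigraph F vs (cycle_selection vs r) y)
     (pmf_of_set (configurations n d r))"
proof -
  define J where "J = card (injections {1..r} {1..n})"
  have J: "card (injections (cycle_selection vs r) {1..n}) = J \<and> finite (injections (cycle_selection vs r) {1..n})"
    if "vs \<in> permutations_of_set {1..n}" for vs
  proof -
    note p = permutation_list[OF that]
    have "card (cycle_selection vs r) = r" "finite (cycle_selection vs r)"
      using card_cycle_selection[OF p(1), of r] p r n by auto
    then show ?thesis unfolding J_def by (auto intro!: card_injections_cong finite_injections)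
  qed
  have J0: "J > 0" unfolding J_def using injections_nonempty[of "{1..r}" "{1..n}"] r
    by (simp add: card_gt_0_iff finite_injections)
  let ?P = "permutations_of_set {1..n}"
  let ?I = "\<lambda>vs. injections (cycle_selection vs r) {1..n}"
  have P: "finite ?P" "?P \<noteq> {}" by simp_all
  have cP: "card ?P > 0" using P by (simp add: card_gt_0_iff)
  let ?g = "\<lambda>F (vs, y). return_pmf (sum_multigraph F vs (cycle_selection vs r) y)"
  have "balanced_multigraph n m = bind_pmf (pmf_of_set (regular_graphs n d)) (\<lambda>F.
      bind_pmf (pmf_of_set ?P) (\<lambda>vs. bind_pmf (pmf_of_set (?I vs)) (\<lambda>y. ?g F (vs, y))))"
    unfolding balanced_multigraph_def Let_def n(2,3) sum_multigraph_def by simp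
  also have "\<dots> = bind_pmf (pmf_of_set (regular_graphs n d)) (\<lambda>F.
      bind_pmf (pmf_of_set (SIGMA vs : ?P. ?I vs)) (?g F))"
  proof -
    have "bind_pmf (pmf_of_set ?P) (\<lambda>vs. bind_pmf (pmf_of_set (?I vs)) (\<lambda>y. ?g F (vs, y)))
        = bind_pmf (pmf_of_set (SIGMA vs : ?P. ?I vs)) (?g F)" for F
      using bind_pmf_of_set_Sigma[OF P, of ?I J "\<lambda>vs y. ?g F (vs, y)"] J J0 by (simp add: case_prod_beta')
    then show ?thesis by (simp only:)
  qed
  also have "\<dots> = bind_pmf (pmf_of_set (configurations n d r)) (\<lambda>(F, w). ?g F w)"
    unfolding configurations_def
  proof (rule bind_pmf_of_set_Sigma[OF finite_regular_graphs R])
    show "finite (SIGMA vs : ?P. ?I vs) \<and> card (SIGMA vs : ?P. ?I vs) = card ?P * J"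
      using J P by (subst card_SigmaI) auto
    show "0 < card ?P * J" using cP J0 by simp
  qed
  finally show ?thesis by (simp add: map_pmf_def case_prod_beta')
qed

text \<open>Conditioning a uniform law gives the uniform law on the smaller set, so everything below
  can be stated as a comparison of cardinalities.\<close>

lemma balanced_graph_prob:
  assumes n: "n \<ge> 3" "r = m mod (n div 2)" "d = m div (n div 2) - 2" and r: "r \<le> n"
    and S: "simple_configurations n d r \<noteq> {}"
  shows "measure_pmf.prob (balanced_graph n m) A
    = real (card {\<omega> \<in> simple_configurations n d r. configuration_graph r \<omega> \<in> A}) / real (card (simple_configurations n d r))"
proof -
  let ?\<Omega> = "configurations n d r"
  let ?H = "\<lambda>(F, vs, y). sum_multigraph F vs (cycle_selection vs r) y"
  let ?S = "?H -` {H. simple_multigraph H}"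
  have n0: "n > 0" using n by simp
  have finI: "finite (injections (cycle_selection vs r) {1..n})" if "vs \<in> permutations_of_set {1..n}" for vs
    using card_cycle_selection(3)[of vs r] permutation_list[OF that] r n0 by (auto intro!: finite_injections)
  have fin: "finite ?\<Omega>" unfolding configurations_def
    using finI by (intro finite_SigmaI finite_regular_graphs) auto
  have eq: "?\<Omega> \<inter> ?S = simple_configurations n d r" by (auto simp: simple_configurations_def)
  have R: "regular_graphs n d \<noteq> {}" using S by (auto simp: simple_configurations_def configurations_def)
  have ne: "?\<Omega> \<inter> ?S \<noteq> {}" unfolding eq by (rule S)
  have \<Omega>0: "?\<Omega> \<noteq> {}" using ne by blast
  have "cond_pmf (balanced_multigraph n m) {H. simple_multigraph H} = map_pmf ?H (cond_pmf (pmf_of_set ?\<Omega>) ?S)"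
    unfolding balanced_multigraph_eq[OF n0 n(2,3) R r]
    by (rule cond_map_pmf) (use ne fin \<Omega>0 in simp)
  also have "cond_pmf (pmf_of_set ?\<Omega>) ?S = pmf_of_set (simple_configurations n d r)"
    using cond_pmf_of_set[OF fin ne] eq by simp
  finally have bg: "balanced_graph n m = map_pmf (\<lambda>\<omega>. set_mset (?H \<omega>)) (pmf_of_set (simple_configurations n d r))"
    unfolding balanced_graph_def by (simp add: map_pmf_comp)
  have finS: "finite (simple_configurations n d r)" unfolding eq[symmetric] using fin by (rule finite_Int[OF disjI1])
  have gr: "set_mset (?H \<omega>) = configuration_graph r \<omega>" if "\<omega> \<in> simple_configurations n d r" for \<omega>
  proof -
    obtain F vs y where \<omega>: "\<omega> = (F, vs, y)" by (cases \<omega>)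
    then have "F \<in> regular_graphs n d" "vs \<in> permutations_of_set {1..n}"
      using that by (auto simp: simple_configurations_def configurations_def)
    then have "finite F" "finite (cycle_selection vs r)"
      using regular_graph_finite card_cycle_selection(3)[of vs r] permutation_list[of vs n] r n0 by auto
    then show ?thesis by (simp add: \<omega> set_sum_multigraph configuration_graph_def)
  qed
  have "measure_pmf.prob (balanced_graph n m) A
     = real (card (simple_configurations n d r \<inter> (\<lambda>\<omega>. set_mset (?H \<omega>)) -` A)) / real (card (simple_configurations n d r))"
    unfolding bg measure_map_pmf by (rule measure_pmf_of_set[OF S finS])
  also have "simple_configurations n d r \<inter> (\<lambda>\<omega>. set_mset (?H \<omega>)) -` A
     = {\<omega> \<in> simple_configurations n d r. configuration_graph r \<omega> \<in> A}" using gr by auto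
  finally show ?thesis .
qed

section \<open>Graphs with a regular layer\<close>

lemma one_minus_power_ge_exp:
  fixes t :: real
  assumes "0 \<le> t" "t \<le> 1 / 2"
  shows "exp (- 2 * t * k) \<le> (1 - t) ^ k"
proof -
  have "- t - 2 * t\<^sup>2 \<le> ln (1 - t)" using ln_one_minus_pos_lower_bound[OF assms] .
  moreover have "2 * t\<^sup>2 \<le> t" using mult_left_mono[of t "1/2" t] assms by (simp add: power2_eq_square)
  ultimately have "- 2 * t \<le> ln (1 - t)" by linarith
  then have "exp (- 2 * t) \<le> exp (ln (1 - t))" by simp
  then have "exp (- 2 * t) \<le> 1 - t" using assms by simp
  then have "exp (- 2 * t) ^ k \<le> (1 - t) ^ k" by (intro power_mono) auto
  then show ?thesis by (simp add: exp_of_nat_mult[symmetric] mult.commute)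
qed

text \<open>A source must avoid itself, at most \<open>d\<close> neighbours in \<open>F\<close> and
  at most two on the cycle, so \<open>\<Delta> = d + 3\<close>. With
  \<open>t = 2 * (d + 4) / n\<close> and \<open>r \<le> n / 2\<close>, the fraction
  \<open>(1 - t) ^ r\<close> of good injections is at least
  \<open>exp (- 2 * (d + 4))\<close>.\<close>

lemma card_simple_injections_ge:
  assumes n: "n \<ge> 3" "n \<ge> 4 * (d + 4)" "2 * r \<le> n" and F: "F \<in> regular_graphs n d"
    and vs: "vs \<in> permutations_of_set {1..n}" and disj: "cycle_set vs \<inter> F = {}"
  defines "R \<equiv> cycle_selection vs r"
  shows "real (card (injections R {1..n})) \<le> exp (2 * real (d + 4)) *
      real (card {y \<in> injections R {1..n}. simple_multigraph (sum_multigraph F vs R y)})"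
proof -
  note p = permutation_list[OF vs]
  have n0: "n > 0" and rn: "r \<le> n" using n by auto
  have R: "card R = r" "R \<subseteq> {1..n}" "finite R"
    unfolding R_def using card_cycle_selection[OF p(1), of r] p rn n0 by auto
  have finF: "finite F" using regular_graph_finite[OF F] .
  have F2: "card f = 2" if "f \<in> F" for f using F that by (auto simp: regular_graphs_def)
  define forb where "forb = (\<lambda>x. {x} \<union> {v. {x, v} \<in> F} \<union> {v. {x, v} \<in> cycle_set vs})"
  have forb: "x \<in> forb x \<and> finite (forb x) \<and> card (forb x) \<le> d + 3" if "x \<in> R" for x
  proof -
    have xV: "x \<in> {1..n}" using that R by blast
    note a = card_regular_neighbours[OF F xV]
    have "x \<in> set vs" using xV p by blast
    note b = card_cycle_neighbours[OF p(1) this]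
    have "card (forb x) \<le> card {x} + card {v. {x, v} \<in> F} + card {v. {x, v} \<in> cycle_set vs}"
      unfolding forb_def by (intro order_trans[OF card_Un_le] add_mono order_refl)
    then show ?thesis using a b by (auto simp: forb_def)
  qed
  let ?G = "good_injections forb R {1..n}"
  have sub: "?G \<subseteq> {y \<in> injections R {1..n}. simple_multigraph (sum_multigraph F vs R y)}"
  proof
    fix y assume y: "y \<in> ?G"
    have len: "length vs \<ge> 3" using p n by simp
    have "chord_set R y \<inter> (F \<union> cycle_set vs) = {}"
      using y by (auto simp: good_injections_def forb_def chord_set_def)
    moreover have "\<forall>x\<in>R. y x \<noteq> x" using y by (auto simp: good_injections_def forb_def)
    moreover have "\<forall>x\<in>R. \<forall>x'\<in>R. y x = x' \<longrightarrow> y x' \<noteq> x" using y by (simp add: good_injections_def)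
    moreover have "F \<inter> cycle_set vs = {}" using disj by blast
    ultimately have "simple_multigraph (sum_multigraph F vs R y)"
      using simple_sum_multigraph_iff[OF finF F2 R(3) p(1) len, of y] by blast
    then show "y \<in> {y \<in> injections R {1..n}. simple_multigraph (sum_multigraph F vs R y)}"
      using y by (simp add: good_injections_def)
  qed
  let ?t = "real (2 * (d + 3 + 1)) / real n"
  have t: "0 \<le> ?t" "?t \<le> 1 / 2" using n n0 by (auto simp: field_simps)
  have finI: "finite (injections R {1..n})" using R by (intro finite_injections) auto
  have lower: "(1 - ?t) ^ card R * real (card (injections R {1..n})) \<le> real (card ?G)"
    by (rule card_good_injections_ge) (use R n forb in auto)
  have "exp (- (2 * real (d + 4))) \<le> exp (- 2 * ?t * r)"
  proof -
    have "real (2 * (d + 4)) * real (2 * r) \<le> real (2 * (d + 4)) * real n"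
      using n by (intro mult_left_mono of_nat_mono) auto
    then have "2 * ?t * r \<le> real (2 * (d + 4))" using n0 by (simp add: field_simps)
    then have "- (2 * real (d + 4)) \<le> - (2 * ?t * r)" by simp
    also have "- (2 * ?t * r) = - 2 * ?t * r" by (simp only: mult_minus_left)
    finally show ?thesis by (simp only: exp_le_cancel_iff)
  qed
  also have "\<dots> \<le> (1 - ?t) ^ card R" using one_minus_power_ge_exp[OF t] R by simp
  finally have "exp (- (2 * real (d + 4))) * real (card (injections R {1..n})) \<le> (1 - ?t) ^ card R * real (card (injections R {1..n}))"
    by (intro mult_right_mono) auto
  also have "\<dots> \<le> real (card ?G)" by (rule lower)
  also have "\<dots> \<le> real (card {y \<in> injections R {1..n}. simple_multigraph (sum_multigraph F vs R y)})"
    using sub finI by (intro of_nat_mono card_mono) auto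
  finally have le: "exp (- (2 * real (d + 4))) * real (card (injections R {1..n}))
      \<le> real (card {y \<in> injections R {1..n}. simple_multigraph (sum_multigraph F vs R y)})" .
  have inverse: "a \<le> exp E * b" if "exp (- E) * a \<le> b" for E a b :: real
    using mult_left_mono[OF that, of "exp E"] by (simp add: mult.assoc[symmetric] exp_add[symmetric])
  show ?thesis by (rule inverse[OF le])
qed

text \<open>The first factor is the price for a cycle disjoint from the regular layer, the second
  the price for simple chords. Neither depends on \<open>n\<close> or \<open>r\<close>.\<close>

definition simple_constant :: "nat \<Rightarrow> real" where
  "simple_constant d = real (2 * (1 + 32 * d) ^ (3072 * d)) * exp (2 * real (d + 4))"

lemma card_simple_configurations_ge:
  assumes n: "n \<ge> 96" "n \<ge> 4 * (d + 4)" "2 * r \<le> n"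
  shows "real (card (configurations n d r)) \<le> simple_constant d * real (card (simple_configurations n d r))"
proof -
  let ?P = "permutations_of_set {1..n}"
  let ?I = "\<lambda>vs. injections (cycle_selection vs r) {1..n}"
  let ?S = "\<lambda>F vs. {y \<in> ?I vs. simple_multigraph (sum_multigraph F vs (cycle_selection vs r) y)}"
  define J where "J = card (injections {1..r} {1..n})"
  have rn: "r \<le> n" and n0: "n > 0" using n by auto
  have J: "card (?I vs) = J \<and> finite (?I vs)" if "vs \<in> ?P" for vs
  proof -
    note p = permutation_list[OF that]
    have "card (cycle_selection vs r) = r" "finite (cycle_selection vs r)"
      using card_cycle_selection[OF p(1), of r] p rn n0 by auto
    then show ?thesis unfolding J_def by (auto intro!: card_injections_cong finite_injections)
  qed
  let ?e = "exp (2 * real (d + 4))"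
  let ?c = "2 * (1 + 32 * d) ^ (3072 * d)"
  have perF: "real (card ?P) * real J \<le> simple_constant d * (\<Sum>vs\<in>?P. real (card (?S F vs)))" if F: "F \<in> regular_graphs n d" for F
  proof -
    let ?A = "{vs \<in> ?P. cycle_set vs \<inter> F = {}}"
    have "card ?P \<le> ?c * card ?A"
    proof (rule card_cycles_avoiding_ge[where n = n])
      show "card {e \<in> F. v \<in> e} \<le> d" if "v \<in> {1..n}" for v
        using regular_graph_degree[OF F that] by simp
      show "card F \<le> d * n" using card_regular_graph[OF F] by (simp add: mult.commute)
    qed (use n regular_graph_finite[OF F] in auto)
    then have "real (card ?P) * real J \<le> real (?c * card ?A) * real J" by (intro mult_right_mono of_nat_mono) auto
    also have "\<dots> = real ?c * (\<Sum>vs\<in>?A. real J)" by simp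
    also have "\<dots> \<le> real ?c * (\<Sum>vs\<in>?A. ?e * real (card (?S F vs)))"
    proof (intro mult_left_mono sum_mono)
      fix vs assume vs: "vs \<in> ?A"
      then have "real (card (?I vs)) \<le> ?e * real (card (?S F vs))"
        using card_simple_injections_ge[OF _ n(2,3) F, of vs] n by simp
      then show "real J \<le> ?e * real (card (?S F vs))" using J vs by simp
    qed auto
    also have "\<dots> \<le> real ?c * (\<Sum>vs\<in>?P. ?e * real (card (?S F vs)))"
      by (intro mult_left_mono sum_mono2) auto
    finally show ?thesis by (simp add: simple_constant_def sum_distrib_left mult.assoc)
  qed
  have conf: "card (configurations n d r) = card (regular_graphs n d) * (card ?P * J)"
  proof -
    have "card (SIGMA vs : ?P. ?I vs) = card ?P * J \<and> finite (SIGMA vs : ?P. ?I vs)"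
      using J by (subst card_SigmaI) auto
    then show ?thesis unfolding configurations_def using finite_regular_graphs by (subst card_SigmaI) auto
  qed
  have simp_eq: "simple_configurations n d r = (SIGMA F : regular_graphs n d. SIGMA vs : ?P. ?S F vs)"
    by (auto simp: simple_configurations_def configurations_def)
  have cS: "card (simple_configurations n d r) = (\<Sum>F\<in>regular_graphs n d. \<Sum>vs\<in>?P. card (?S F vs))"
  proof -
    have "finite (SIGMA vs : ?P. ?S F vs) \<and> card (SIGMA vs : ?P. ?S F vs) = (\<Sum>vs\<in>?P. card (?S F vs))" for F
      using J by (subst card_SigmaI) auto
    then show ?thesis unfolding simp_eq using finite_regular_graphs by (subst card_SigmaI) auto
  qed
  have "real (card (configurations n d r)) = (\<Sum>F\<in>regular_graphs n d. real (card ?P) * real J)"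
    by (simp add: conf)
  also have "\<dots> \<le> (\<Sum>F\<in>regular_graphs n d. simple_constant d * (\<Sum>vs\<in>?P. real (card (?S F vs))))"
    using perF by (intro sum_mono) auto
  also have "\<dots> = simple_constant d * real (card (simple_configurations n d r))"
    by (simp add: cS sum_distrib_left)
  finally show ?thesis .
qed

lemma finite_configurations: "n > 0 \<Longrightarrow> r \<le> n \<Longrightarrow> finite (configurations n d r)"
proof -
  assume n: "n > 0" "r \<le> n"
  have "finite (injections (cycle_selection vs r) {1..n})" if "vs \<in> permutations_of_set {1..n}" for vs
    using card_cycle_selection(3)[of vs r] permutation_list[OF that] n by (auto intro!: finite_injections)
  then show ?thesis unfolding configurations_def by (intro finite_SigmaI finite_regular_graphs) auto
qed

lemma power_sub_div_le_powr:
  fixes x :: real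
  assumes "0 < x" "x \<le> 1"
  shows "x ^ (k - k div 48) \<le> (x powr (47/48)) ^ k"
proof -
  have "47 / 48 * real k \<le> real (k - k div 48)"
  proof -
    have "48 * (k div 48) \<le> k" by simp
    then show ?thesis by linarith
  qed
  then have "x powr real (k - k div 48) \<le> x powr (47 / 48 * real k)"
    using assms by (intro powr_mono') auto
  moreover have "x powr real (k - k div 48) = x ^ (k - k div 48)" using assms by (intro powr_realpow) simp
  moreover have "(x powr (47/48)) ^ k = x powr (47 / 48 * real k)"
    using powr_realpow[of "x powr (47/48)" k] assms by (simp add: powr_powr)
  ultimately show ?thesis by simp
qed

text \<open>Origin of the exponent \<open>23/24\<close>: of the \<open>47/48\<close> left by the
  switchings, another \<open>1/48\<close> is spent to absorb the constant \<open>4 * K\<close>,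
  which is at most \<open>n powr (1/48)\<close>.\<close>

lemma four_powr_le:
  fixes K n :: real
  assumes "K \<ge> 1" "n \<ge> (4 * K) ^ 48"
  shows "4 * (K / n) powr (47/48) \<le> n powr (-23/24)" "K \<le> n" "n > 0"
proof -
  have "(4 * K) ^ 1 \<le> (4 * K) ^ 48" using assms by (intro power_increasing) auto
  then have n: "4 * K \<le> n" using assms by simp
  then show "K \<le> n" "n > 0" using assms by linarith+
  have root: "a = (a ^ 48) powr (1/48)" if "a > 0" for a :: real
  proof -
    have "a ^ 48 = a powr 48" using that by (simp add: powr_numeral)
    then have "(a ^ 48) powr (1/48) = a powr (48 * (1/48))" by (simp only: powr_powr)
    then show ?thesis using that by simp
  qed
  have "4 * K = ((4 * K) ^ 48) powr (1/48)" using assms by (intro root) simp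
  also have "\<dots> \<le> n powr (1/48)" using assms by (intro powr_mono2) auto
  finally have a: "4 * K \<le> n powr (1/48)" .
  have "4 * (K / n) powr (47/48) = 4 * K powr (47/48) * n powr (-47/48)"
    using assms \<open>n > 0\<close> by (simp add: powr_divide powr_minus field_simps)
  also have "\<dots> \<le> 4 * K * n powr (-47/48)"
  proof -
    have "K powr (47/48) \<le> K powr 1" using assms by (intro powr_mono) auto
    then show ?thesis using assms by (intro mult_right_mono) auto
  qed
  also have "\<dots> \<le> n powr (1/48) * n powr (-47/48)" using a by (intro mult_right_mono) auto
  also have "\<dots> = n powr (-23/24)" by (simp add: powr_add[symmetric])
  finally show "4 * (K / n) powr (47/48) \<le> n powr (-23/24)" .
qed

text \<open>Every edge of \<open>T\<close> lies in one of the three layers. For a prescribed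
  distribution the three bounds multiply, since the number of suitable injections is bounded
  uniformly over the cycles; the number of distributions is at most
  \<open>4 ^ card T\<close>.\<close>

lemma card_configurations_containing_le:
  fixes K :: real
  assumes n: "n \<ge> 192 * (2 * d + 4) * (d + 1)" "n \<ge> 96" "r \<le> n" and K: "K \<ge> 1536" "K \<ge> 192 * real d * real d" "K \<le> n"
    and T: "finite T"
  shows "real (card {\<omega> \<in> configurations n d r. T \<subseteq> configuration_graph r \<omega>})
     \<le> (4 * (K / n) powr (47/48)) ^ card T * real (card (configurations n d r))"
proof -
  define x where "x = (K / n) powr (47/48)"
  have n0: "n > 0" using n by simp
  have Kn: "0 < K / n" "K / n \<le> 1" using K n0 by auto
  have x: "0 < x" "x \<le> 1" using Kn K n0 by (auto simp: x_def powr_le1)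
  have pw: "a ^ (k - k div 48) \<le> x ^ k" if "0 \<le> a" "a \<le> K / n" for a k
  proof -
    have "a ^ (k - k div 48) \<le> (K / n) ^ (k - k div 48)" using that by (intro power_mono) auto
    also have "\<dots> \<le> x ^ k" unfolding x_def using power_sub_div_le_powr[OF Kn] .
    finally show ?thesis .
  qed
  let ?P = "permutations_of_set {1..n}"
  let ?I = "\<lambda>vs. injections (cycle_selection vs r) {1..n}"
  define J where "J = card (injections {1..r} {1..n})"
  have J: "card (?I vs) = J \<and> finite (?I vs) \<and> finite (cycle_selection vs r)" if "vs \<in> ?P" for vs
  proof -
    note p = permutation_list[OF that]
    have "card (cycle_selection vs r) = r" "finite (cycle_selection vs r)"
      using card_cycle_selection[OF p(1), of r] p n n0 by auto
    then show ?thesis unfolding J_def by (auto intro!: card_injections_cong finite_injections)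
  qed
  have conf: "card (configurations n d r) = card (regular_graphs n d) * (card ?P * J)"
  proof -
    have "card (SIGMA vs : ?P. ?I vs) = card ?P * J \<and> finite (SIGMA vs : ?P. ?I vs)"
      using J by (subst card_SigmaI) auto
    then show ?thesis unfolding configurations_def using finite_regular_graphs by (subst card_SigmaI) auto
  qed
  let ?C = "\<lambda>T1 T2 T3. {(F, vs, y) \<in> configurations n d r. T1 \<subseteq> F \<and> T2 \<subseteq> cycle_set vs \<and> T3 \<subseteq> chord_set (cycle_selection vs r) y}"
  have part: "real (card (?C T1 T2 T3)) \<le> x ^ (card T1 + card T2 + card T3) * real (card (configurations n d r))"
    if fin: "finite T1" "finite T2" "finite T3" for T1 T2 T3
  proof -
    let ?F = "{F \<in> regular_graphs n d. T1 \<subseteq> F}"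
    let ?V = "{vs \<in> ?P. T2 \<subseteq> cycle_set vs}"
    let ?Y = "\<lambda>vs. {y \<in> ?I vs. T3 \<subseteq> chord_set (cycle_selection vs r) y}"
    have "?C T1 T2 T3 = (SIGMA F : ?F. SIGMA vs : ?V. ?Y vs)" by (auto simp: configurations_def)
    moreover have "finite (SIGMA vs : ?V. ?Y vs) \<and> card (SIGMA vs : ?V. ?Y vs) = (\<Sum>vs\<in>?V. card (?Y vs))"
      using J by (subst card_SigmaI) auto
    ultimately have "card (?C T1 T2 T3) = (\<Sum>F\<in>?F. \<Sum>vs\<in>?V. card (?Y vs))"
      using finite_regular_graphs by (simp add: card_SigmaI)
    then have "real (card (?C T1 T2 T3)) = real (card ?F) * (\<Sum>vs\<in>?V. real (card (?Y vs)))" by simp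
    also have "\<dots> \<le> real (card ?F) * (\<Sum>vs\<in>?V. x ^ card T3 * real J)"
    proof (intro mult_left_mono sum_mono)
      fix vs assume vs: "vs \<in> ?V"
      have "real (card (?Y vs)) \<le> (96 / card {1..n}) ^ (card T3 - card T3 div 48) * real (card (?I vs))"
        using J vs fin n0 by (intro card_injections_containing_le) auto
      also have "\<dots> \<le> x ^ card T3 * real (card (?I vs))"
        using K by (intro mult_right_mono pw) (auto simp: divide_right_mono)
      finally show "real (card (?Y vs)) \<le> x ^ card T3 * real J" using J vs by simp
    qed auto
    also have "\<dots> = real (card ?F) * real (card ?V) * (x ^ card T3 * real J)" by simp
    also have "\<dots> \<le> (x ^ card T1 * real (card (regular_graphs n d))) * (x ^ card T2 * real (card ?P)) * (x ^ card T3 * real J)"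
    proof (intro mult_mono)
      have "real (card ?F) \<le> (192 * real d * real d / real n) ^ (card T1 - card T1 div 48) * real (card (regular_graphs n d))"
        by (rule card_regular_containing_le[OF n(1) fin(1)])
      also have "\<dots> \<le> x ^ card T1 * real (card (regular_graphs n d))"
        using K by (intro mult_right_mono pw) (auto simp: divide_right_mono)
      finally show "real (card ?F) \<le> x ^ card T1 * real (card (regular_graphs n d))" .
      have "real (card ?V) \<le> (1536 / real n) ^ (card T2 - card T2 div 48) * real (card ?P)"
        using n by (intro card_cycles_containing_le fin) auto
      also have "\<dots> \<le> x ^ card T2 * real (card ?P)"
        using K by (intro mult_right_mono pw) (auto simp: divide_right_mono)
      finally show "real (card ?V) \<le> x ^ card T2 * real (card ?P)" .
    qed (use x in auto)
    finally show ?thesis by (simp add: conf power_add mult_ac)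
  qed
  have finC: "finite (configurations n d r)" using finite_configurations[OF n0 n(3)] .
  let ?D = "Pow T \<times> Pow T"
  have "{\<omega> \<in> configurations n d r. T \<subseteq> configuration_graph r \<omega>} \<subseteq> (\<Union>(T1, T2)\<in>?D. ?C T1 T2 (T - T1 - T2))"
  proof
    fix \<omega> assume \<omega>: "\<omega> \<in> {\<omega> \<in> configurations n d r. T \<subseteq> configuration_graph r \<omega>}"
    obtain F vs y where e: "\<omega> = (F, vs, y)" by (cases \<omega>)
    have "\<omega> \<in> ?C (T \<inter> F) (T \<inter> cycle_set vs) (T - (T \<inter> F) - (T \<inter> cycle_set vs))"
      using \<omega> by (auto simp: e configuration_graph_def)
    moreover have "(T \<inter> F, T \<inter> cycle_set vs) \<in> ?D" by auto
    ultimately show "\<omega> \<in> (\<Union>(T1, T2)\<in>?D. ?C T1 T2 (T - T1 - T2))" by blast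
  qed
  then have "card {\<omega> \<in> configurations n d r. T \<subseteq> configuration_graph r \<omega>} \<le> card (\<Union>(T1, T2)\<in>?D. ?C T1 T2 (T - T1 - T2))"
  proof (rule card_mono[rotated])
    show "finite (\<Union>(T1, T2)\<in>?D. ?C T1 T2 (T - T1 - T2))"
      by (rule finite_subset[OF _ finC]) auto
  qed
  also have "\<dots> \<le> (\<Sum>T12\<in>?D. card (case T12 of (T1, T2) \<Rightarrow> ?C T1 T2 (T - T1 - T2)))"
    using T by (intro card_UN_le) auto
  finally have "real (card {\<omega> \<in> configurations n d r. T \<subseteq> configuration_graph r \<omega>})
      \<le> real (\<Sum>T12\<in>?D. card (case T12 of (T1, T2) \<Rightarrow> ?C T1 T2 (T - T1 - T2)))" by (rule of_nat_mono)
  also have "\<dots> = (\<Sum>T12\<in>?D. real (card (case T12 of (T1, T2) \<Rightarrow> ?C T1 T2 (T - T1 - T2))))" by simp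
  also have "\<dots> \<le> (\<Sum>T12\<in>?D. x ^ card T * real (card (configurations n d r)))"
  proof (rule sum_mono)
    fix T12 assume "T12 \<in> ?D"
    then obtain T1 T2 where T12: "T12 = (T1, T2)" "T1 \<subseteq> T" "T2 \<subseteq> T" by auto
    then have fin: "finite T1" "finite T2" "finite (T - T1 - T2)" using T finite_subset by auto
    \<comment> \<open>The two subsets may overlap. This only raises the exponent of
      \<open>x \<le> 1\<close>.\<close>
    have "card T \<le> card (T1 \<union> T2 \<union> (T - T1 - T2))" using fin by (intro card_mono) auto
    also have "\<dots> \<le> card T1 + card T2 + card (T - T1 - T2)"
      by (intro order_trans[OF card_Un_le] add_mono order_refl)
    finally have "x ^ (card T1 + card T2 + card (T - T1 - T2)) \<le> x ^ card T"
      using x by (intro power_decreasing) auto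
    then have "x ^ (card T1 + card T2 + card (T - T1 - T2)) * real (card (configurations n d r)) \<le> x ^ card T * real (card (configurations n d r))"
      by (intro mult_right_mono) auto
    then show "real (card (case T12 of (T1, T2) \<Rightarrow> ?C T1 T2 (T - T1 - T2))) \<le> x ^ card T * real (card (configurations n d r))"
      unfolding T12(1) prod.case using part[OF fin] by (rule order_trans[rotated])
  qed
  also have "\<dots> = real (card ?D) * (x ^ card T * real (card (configurations n d r)))" by simp
  also have "real (card ?D) = (2 * 2) ^ card T"
    using T by (simp only: card_cartesian_product card_Pow of_nat_mult of_nat_power of_nat_numeral power_mult_distrib)
  also have "(2 * 2) ^ card T * (x ^ card T * real (card (configurations n d r))) = (4 * x) ^ card T * real (card (configurations n d r))"
  proof -
    have "(2 * 2 :: real) ^ card T = 4 ^ card T" by simp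
    then show ?thesis by (simp only: power_mult_distrib[of 4 x] mult.assoc)
  qed
  finally show ?thesis by (simp add: x_def)
qed

lemma automorphism_image:
  assumes "\<pi> \<in> automorphisms V E" "e \<in> E" "e \<subseteq> V" "card e = 2"
  shows "\<pi> ` e \<in> E"
proof -
  obtain u v where "e = {u, v}" using assms(4) by (auto simp: card_2_iff)
  then show ?thesis using assms by (auto simp: automorphisms_def)
qed

lemma not_asymmetric_automorphism:
  assumes "\<not> asymmetric V E"
  obtains \<pi> where "\<pi> \<in> automorphisms V E" "\<pi> \<noteq> id"
proof -
  have "id \<in> automorphisms V E" by (auto simp: automorphisms_def permutes_id)
  then show ?thesis using assms that unfolding asymmetric_def by blast
qed

text \<open>In a simple configuration the cycle and a regular layer with \<open>d \<ge> 1\<close>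
  are disjoint and already give every vertex degree at least \<open>3\<close>. The chords enter only
  through the probability bound.\<close>

lemma card_symmetric_configurations_le:
  fixes K :: real
  assumes n: "n \<ge> 192 * (2 * d + 4) * (d + 1)" "2 * r \<le> n" "d \<ge> 1"
    and K: "K = 1536 + 192 * real d * real d" "real n \<ge> (4 * K) ^ 48"
  shows "real (card {\<omega> \<in> simple_configurations n d r. \<not> asymmetric {1..n} (configuration_graph r \<omega>)})
     \<le> 16 * exp 10 * real n powr (-1/4) * real (card (configurations n d r))"
proof -
  let ?\<Omega> = "configurations n d r"
  have K1: "K \<ge> 1536" "K \<ge> 192 * real d * real d" "K \<ge> 1" using K by auto
  note f = four_powr_le[OF K1(3) K(2)]
  have n96: "n \<ge> 96" "n \<ge> 3" "n > 0" "r \<le> n" using f(2) K1 n by linarith+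
  \<comment> \<open>The first moment ranges over all configurations, so possible loops are filtered
    out here. On simple configurations the filter changes nothing.\<close>
  define E where "E = (\<lambda>\<omega>. Pair True ` {e \<in> configuration_graph r \<omega>. e \<subseteq> {1..n} \<and> card e = 2})"
  let ?Bad = "{\<omega> \<in> ?\<Omega>. (\<forall>v\<in>{1..n}. 3 \<le> card {ce \<in> E \<omega>. v \<in> snd ce}) \<and> (\<exists>\<pi>. coloured_auto {1..n} (E \<omega>) \<pi> \<and> \<pi> \<noteq> id)}"
  have fin\<Omega>: "finite ?\<Omega>" using finite_configurations n96 by blast
  have "real (card ?Bad) \<le> 16 * exp 10 * real (card {1..n}) powr (-1/4) * real (card ?\<Omega>)"
  proof (rule first_moment_automorphisms[OF _ fin\<Omega>])
    show "E \<omega> \<subseteq> coloured_pairs {1..n}" for \<omega> by (auto simp: E_def coloured_pairs_def)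
    show "real (card {\<omega> \<in> ?\<Omega>. T \<subseteq> E \<omega>}) \<le> (real (card {1..n}) powr (-23/24)) ^ card T * real (card ?\<Omega>)"
      if T: "T \<subseteq> coloured_pairs {1..n}" for T
    proof (cases "\<exists>\<omega>\<in>?\<Omega>. T \<subseteq> E \<omega>")
      case False
      then have "{\<omega> \<in> ?\<Omega>. T \<subseteq> E \<omega>} = {}" by blast
      then have c0: "card {\<omega> \<in> ?\<Omega>. T \<subseteq> E \<omega>} = 0" by (simp only: card.empty)
      show ?thesis unfolding c0 by simp
    next
      case True
      have finT: "finite T" using finite_subset[OF T finite_coloured_pairs] by simp
      have col: "fst ce = True" if "ce \<in> T" for ce using that True by (auto simp: E_def)
      have "inj_on snd T" using col by (auto simp: inj_on_def prod_eq_iff)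
      then have cT: "card (snd ` T) = card T" by (rule card_image)
      have "{\<omega> \<in> ?\<Omega>. T \<subseteq> E \<omega>} \<subseteq> {\<omega> \<in> ?\<Omega>. snd ` T \<subseteq> configuration_graph r \<omega>}"
        by (auto simp: E_def)
      then have "real (card {\<omega> \<in> ?\<Omega>. T \<subseteq> E \<omega>}) \<le> real (card {\<omega> \<in> ?\<Omega>. snd ` T \<subseteq> configuration_graph r \<omega>})"
        using fin\<Omega> by (intro of_nat_mono card_mono) auto
      also have "\<dots> \<le> (4 * (K / n) powr (47/48)) ^ card (snd ` T) * real (card ?\<Omega>)"
        using n(1) n96(1,4) K1(1,2) f(2) finT by (intro card_configurations_containing_le) auto
      also have "\<dots> \<le> (real n powr (-23/24)) ^ card (snd ` T) * real (card ?\<Omega>)"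
        using f(1) by (intro mult_right_mono power_mono) auto
      finally show ?thesis by (simp add: cT)
    qed
  qed (use n96 in auto)
  moreover have "{\<omega> \<in> simple_configurations n d r. \<not> asymmetric {1..n} (configuration_graph r \<omega>)} \<subseteq> ?Bad"
  proof
    fix \<omega> assume \<omega>: "\<omega> \<in> {\<omega> \<in> simple_configurations n d r. \<not> asymmetric {1..n} (configuration_graph r \<omega>)}"
    obtain F vs y where e: "\<omega> = (F, vs, y)" by (cases \<omega>)
    define R where "R = cycle_selection vs r"
    have F: "F \<in> regular_graphs n d" and vs: "vs \<in> permutations_of_set {1..n}" and y: "y \<in> injections R {1..n}"
      and s: "simple_multigraph (sum_multigraph F vs R y)"
      using \<omega> by (auto simp: e simple_configurations_def configurations_def R_def)
    note p = permutation_list[OF vs]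
    have len: "length vs \<ge> 3" using p n96 by simp
    have R: "R \<subseteq> {1..n}" "finite R"
      unfolding R_def using card_cycle_selection[OF p(1), of r] p n96 by auto
    have finF: "finite F" using regular_graph_finite[OF F] .
    have F2: "card f = 2 \<and> f \<subseteq> {1..n}" if "f \<in> F" for f using F that by (auto simp: regular_graphs_def)
    let ?G = "configuration_graph r \<omega>"
    have G: "?G = F \<union> cycle_set vs \<union> chord_set R y" by (simp add: e configuration_graph_def R_def)
    have simp': "F \<inter> cycle_set vs = {}" "\<forall>x\<in>R. y x \<noteq> x"
      using s simple_sum_multigraph_iff[OF finF _ R(2) p(1) len, of y] F2 by blast+
    have pairs: "f \<subseteq> {1..n} \<and> card f = 2" if "f \<in> ?G" for f
    proof -
      have "f \<subseteq> {1..n} \<and> card f = 2" if "f \<in> chord_set R y"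
        using that simp' R y by (auto simp: chord_set_def injections_def)
      then show ?thesis using that F2 cycle_set_subset[OF p(1) len] p(3) unfolding G by blast
    qed
    then have E: "E \<omega> = Pair True ` ?G" unfolding E_def by auto
    have finG: "finite ?G" unfolding G using finF finite_cycle_set R by (simp add: chord_set_def)
    have deg: "3 \<le> card {ce \<in> E \<omega>. v \<in> snd ce}" if v: "v \<in> {1..n}" for v
    proof -
      have "3 \<le> card {f \<in> F. v \<in> f} + card {f \<in> cycle_set vs. v \<in> f}"
        using regular_graph_degree[OF F v] card_cycle_incident[OF p(1) len, of v] p v n by simp
      also have "\<dots> = card ({f \<in> F. v \<in> f} \<union> {f \<in> cycle_set vs. v \<in> f})"
        using simp' finF finite_cycle_set[of vs] by (intro card_Un_disjoint[symmetric]) auto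
      also have "\<dots> \<le> card {f \<in> ?G. v \<in> f}" using finG by (intro card_mono) (auto simp: G)
      also have "\<dots> = card (Pair True ` {f \<in> ?G. v \<in> f})" by (simp add: card_image inj_on_def)
      also have "Pair True ` {f \<in> ?G. v \<in> f} = {ce \<in> E \<omega>. v \<in> snd ce}" by (auto simp: E)
      finally show ?thesis .
    qed
    obtain \<pi> where \<pi>: "\<pi> \<in> automorphisms {1..n} ?G" "\<pi> \<noteq> id"
      using not_asymmetric_automorphism \<omega> by blast
    have "coloured_auto {1..n} (E \<omega>) \<pi>"
      using \<pi>(1) automorphism_image[OF \<pi>(1)] pairs unfolding coloured_auto_def E
      by (auto simp: automorphisms_def)
    then show "\<omega> \<in> ?Bad" using \<omega> deg \<pi>(2) by (auto simp: simple_configurations_def)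
  qed
  then have "real (card {\<omega> \<in> simple_configurations n d r. \<not> asymmetric {1..n} (configuration_graph r \<omega>)}) \<le> real (card ?Bad)"
    using fin\<Omega> by (intro of_nat_mono card_mono) auto
  ultimately show ?thesis by simp
qed

section \<open>Marked positions on a cycle\<close>

definition rank_in :: "nat set \<Rightarrow> nat \<Rightarrow> nat" where
  "rank_in K j = card {k \<in> K. k < j}"

text \<open>For an unmarked position this is the index of the marked position that opens its arc,
  that is, the last one before it in cyclic order. Adding \<open>card K\<close> before subtracting
  \<open>1\<close> gives the last marked position when none comes earlier.\<close>

definition arc_index :: "nat set \<Rightarrow> nat \<Rightarrow> nat" where
  "arc_index K j = (rank_in K j + card K - 1) mod card K"

lemma nth_rank_in:
  assumes "finite K" "k \<in> K"
  shows "sorted_list_of_set K ! rank_in K k = k" "rank_in K k < card K"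
proof -
  let ?ps = "sorted_list_of_set K"
  obtain t where t: "t < length ?ps" "?ps ! t = k" using assms by (metis in_set_conv_nth set_sorted_list_of_set)
  have len: "length ?ps = card K" by simp
  have mono: "?ps ! a < ?ps ! b \<longleftrightarrow> a < b" if "a < card K" "b < card K" for a b
    using that strict_sorted_list_of_set[of K] sorted_wrt_nth_less[of "(<)" ?ps]
    by (metis len less_asym' linorder_neqE_nat less_irrefl)
  have "{k' \<in> K. k' < k} = (!) ?ps ` {..<t}"
  proof (intro equalityI subsetI)
    fix k' assume k': "k' \<in> {k' \<in> K. k' < k}"
    then obtain s where s: "s < length ?ps" "?ps ! s = k'" using assms(1) by (metis (lifting) in_set_conv_nth mem_Collect_eq set_sorted_list_of_set)
    then have "s < t" using mono[of s t] t k' len by auto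
    then show "k' \<in> (!) ?ps ` {..<t}" using s by auto
  next
    fix k' assume "k' \<in> (!) ?ps ` {..<t}"
    then obtain s where s: "s < t" "k' = ?ps ! s" by auto
    then have "s < length ?ps" using t by simp
    then have "k' \<in> K" using s assms(1) nth_mem[of s ?ps] by simp
    then show "k' \<in> {k' \<in> K. k' < k}" using s mono[of s t] t \<open>s < length ?ps\<close> len by auto
  qed
  moreover have "inj_on ((!) ?ps) {..<t}"
    using t distinct_sorted_list_of_set[of K] by (auto simp: inj_on_def nth_eq_iff_index_eq)
  ultimately have "rank_in K k = t" by (simp add: rank_in_def card_image)
  then show "?ps ! rank_in K k = k" "rank_in K k < card K" using t by auto
qed

lemma rank_in_Suc:
  assumes "finite K"
  shows "rank_in K (Suc j) = rank_in K j + (if j \<in> K then 1 else 0)"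
proof -
  have "{k \<in> K. k < Suc j} = {k \<in> K. k < j} \<union> (if j \<in> K then {j} else {})" by (auto simp: less_Suc_eq)
  then show ?thesis unfolding rank_in_def using assms by (auto simp: card_insert_if)
qed

lemma rank_in_nth:
  assumes "finite K" "i < card K"
  shows "rank_in K (sorted_list_of_set K ! i) = i"
proof -
  let ?ps = "sorted_list_of_set K"
  have "?ps ! i \<in> K" using assms nth_mem[of i ?ps] by simp
  note r = nth_rank_in[OF assms(1) this]
  then show ?thesis using assms nth_eq_iff_index_eq[OF distinct_sorted_list_of_set[of K], of "rank_in K (?ps ! i)" i] by simp
qed

lemma rank_in_le: "finite K \<Longrightarrow> rank_in K j \<le> card K"
  unfolding rank_in_def by (intro card_mono) auto

lemma rank_in_0 [simp]: "rank_in K 0 = 0"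
  by (simp add: rank_in_def)

lemma rank_in_all: "K \<subseteq> {..<j} \<Longrightarrow> rank_in K j = card K"
  unfolding rank_in_def by (intro arg_cong[where f = card]) auto

context
  fixes n :: nat and K :: "nat set"
  assumes K: "K \<subseteq> {..<n}" and K3: "3 \<le> card K"
begin

lemma finite_marked: "finite K"
  using K finite_subset by blast

lemma last_rank: "Suc j = n \<Longrightarrow> j \<notin> K \<Longrightarrow> rank_in K j = card K"
  using K by (intro rank_in_all) (auto simp: less_Suc_eq)

lemma Suc_arc_index: "Suc (arc_index K j) mod card K = rank_in K j mod card K"
proof -
  have "Suc (arc_index K j) mod card K = Suc (rank_in K j + card K - 1) mod card K"
    unfolding arc_index_def by (simp add: mod_Suc_eq)
  also have "Suc (rank_in K j + card K - 1) = rank_in K j + card K" using K3 by simp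
  finally show ?thesis by simp
qed

lemma arc_index_pos:
  assumes "0 < rank_in K j"
  shows "arc_index K j = rank_in K j - 1"
proof -
  have "rank_in K j + card K - 1 = (rank_in K j - 1) + card K" using assms by simp
  moreover have "rank_in K j - 1 < card K" using rank_in_le[OF finite_marked, of j] assms by linarith
  ultimately show ?thesis unfolding arc_index_def by (metis mod_add_self2 mod_less)
qed

lemma arc_index_less: "arc_index K j < card K"
  unfolding arc_index_def using K3 by (intro mod_less_divisor) linarith

lemma arc_index_Suc:
  assumes "j < n" "j \<notin> K" "Suc j mod n \<notin> K"
  shows "arc_index K (Suc j mod n) = arc_index K j"
proof (cases "Suc j < n")
  case True
  then show ?thesis using assms rank_in_Suc[OF finite_marked, of j] by (simp add: arc_index_def)
next
  case False
  then have "Suc j = n" using assms by simp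
  then have "rank_in K j = card K" using last_rank assms by simp
  then have "arc_index K j = card K - 1" using arc_index_pos[of j] K3 by simp
  then show ?thesis using \<open>Suc j = n\<close> K3 by (simp add: arc_index_def)
qed

lemma arc_index_enter:
  assumes "j < n" "j \<notin> K" "Suc j mod n \<in> K"
  shows "Suc j mod n = sorted_list_of_set K ! (Suc (arc_index K j) mod card K)"
proof (cases "Suc j < n")
  case True
  then have "rank_in K (Suc j) = rank_in K j" using assms rank_in_Suc[OF finite_marked, of j] by simp
  then show ?thesis using nth_rank_in[OF finite_marked assms(3)] True by (simp add: Suc_arc_index)
next
  case False
  then have "Suc j = n" using assms by simp
  then show ?thesis using last_rank[of j] nth_rank_in(1)[OF finite_marked assms(3)] assms by (simp add: Suc_arc_index)
qed

lemma arc_index_leave: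
  assumes "k < n" "k \<in> K" "Suc k mod n \<notin> K"
  shows "k = sorted_list_of_set K ! arc_index K (Suc k mod n)"
proof (cases "Suc k < n")
  case True
  have "rank_in K (Suc k) = rank_in K k + 1" using assms rank_in_Suc[OF finite_marked, of k] by simp
  then show ?thesis using nth_rank_in[OF finite_marked assms(2)] True by (simp add: arc_index_def)
next
  case False
  then have e: "Suc k = n" using assms by simp
  have "K \<subseteq> {..<Suc k}" using K e by simp
  then have "rank_in K (Suc k) = card K" by (rule rank_in_all)
  then have "rank_in K k = card K - 1" using rank_in_Suc[OF finite_marked, of k] assms by simp
  then show ?thesis using nth_rank_in[OF finite_marked assms(2)] e by (simp add: arc_index_def)
qed

text \<open>A second marked position directly after the one opening the arc of \<open>j\<close>
  would come before \<open>j\<close> in cyclic order and would itself open that arc. So an arc that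
  contains \<open>j\<close> is a long one.\<close>

lemma arc_index_after:
  assumes "j < n" "j \<notin> K"
  shows "Suc (sorted_list_of_set K ! arc_index K j) mod n \<notin> K"
proof
  let ?ps = "sorted_list_of_set K"
  define a where "a = ?ps ! arc_index K j"
  assume s: "Suc (sorted_list_of_set K ! arc_index K j) mod n \<in> K"
  have aK: "a \<in> K" unfolding a_def using nth_mem[of "arc_index K j" ?ps] arc_index_less[of j] finite_marked by simp
  have ra: "rank_in K a = arc_index K j" unfolding a_def by (rule rank_in_nth[OF finite_marked arc_index_less])
  have an: "a < n" using aK K by auto
  show False
  \<comment> \<open>Rank \<open>0\<close> means that the arc wraps around: it is opened by the last
    marked position, and all positions before \<open>j\<close> are unmarked.\<close>
  proof (cases "rank_in K j = 0")
    case True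
    then have none: "\<not> k < j" if "k \<in> K" for k using that finite_marked by (auto simp: rank_in_def)
    have ra': "rank_in K a = card K - 1" using ra True K3 by (simp add: arc_index_def)
    show False
    proof (cases "Suc a < n")
      case True
      then have "rank_in K (Suc a) < card K" using s nth_rank_in(2)[OF finite_marked] by (simp add: a_def)
      then show False using ra' rank_in_Suc[OF finite_marked, of a] aK K3 by simp
    next
      case False
      then have "Suc a = n" using an by simp
      then have "0 \<in> K" using s by (simp add: a_def)
      then show False using none[of 0] assms by (cases j) auto
    qed
  next
    case False
    then have ra': "rank_in K a = rank_in K j - 1"
      using ra arc_index_pos[of j] by simp
    have "a < j"
    proof (rule ccontr)
      assume "\<not> a < j"
      then have "{k \<in> K. k < j} \<subseteq> {k \<in> K. k < a}" by auto
      then have "rank_in K j \<le> rank_in K a" unfolding rank_in_def using finite_marked by (intro card_mono) auto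
      then show False using ra' False by simp
    qed
    then have "Suc a < n" using assms by simp
    then have sK: "Suc a \<in> K" using s by (simp add: a_def)
    then have "Suc a < j" using \<open>a < j\<close> assms by (cases "Suc a = j") auto
    then have "{k \<in> K. k < Suc a} \<subset> {k \<in> K. k < j}" using sK by auto
    then have "rank_in K (Suc a) < rank_in K j" unfolding rank_in_def using finite_marked by (intro psubset_card_mono) auto
    then show False using ra' rank_in_Suc[OF finite_marked, of a] aK False by simp
  qed
qed

lemma consecutive_marked:
  assumes "i < card K" "Suc (sorted_list_of_set K ! i) mod n \<in> K"
  shows "Suc (sorted_list_of_set K ! i) mod n = sorted_list_of_set K ! (Suc i mod card K)"
proof -
  let ?ps = "sorted_list_of_set K"
  define a where "a = ?ps ! i"
  have aK: "a \<in> K" unfolding a_def using nth_mem[of i ?ps] assms finite_marked by simp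
  have ra: "rank_in K a = i" unfolding a_def by (rule rank_in_nth[OF finite_marked assms(1)])
  have an: "a < n" using aK K by auto
  have rs: "rank_in K (Suc a) = Suc i" using rank_in_Suc[OF finite_marked, of a] aK ra by simp
  show ?thesis
  proof (cases "Suc a < n")
    case True
    then have "Suc a \<in> K" using assms by (simp add: a_def)
    from nth_rank_in[OF finite_marked this] show ?thesis using rs True by (simp add: a_def)
  next
    case False
    then have e: "Suc a = n" using an by simp
    have "rank_in K (Suc a) = card K" using K e by (intro rank_in_all) auto
    then have "Suc i = card K" using rs by simp
    moreover have "0 \<in> K" using assms e by (simp add: a_def)
    from nth_rank_in(1)[OF finite_marked this] have "?ps ! 0 = 0" by simp
    ultimately show ?thesis using e by (simp add: a_def)
  qed
qed

end

section \<open>The kernel of a chorded cycle\<close>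

definition marked_positions :: "'a list \<Rightarrow> 'a set \<Rightarrow> nat set" where
  "marked_positions vs K = {i. i < length vs \<and> vs ! i \<in> K}"

definition marked_cycle :: "'a list \<Rightarrow> 'a set \<Rightarrow> 'a list" where
  "marked_cycle vs K = map ((!) vs) (sorted_list_of_set (marked_positions vs K))"

definition long_arc :: "'a list \<Rightarrow> 'a set \<Rightarrow> nat \<Rightarrow> bool" where
  "long_arc vs K i \<longleftrightarrow>
     Suc (sorted_list_of_set (marked_positions vs K) ! i) mod length vs \<notin> marked_positions vs K"

text \<open>
  The colour is \<open>True\<close> exactly for the arcs with inner vertices; a chord may be parallel to such an arc.
\<close>

definition kernel_graph :: "'a list \<Rightarrow> 'a set \<Rightarrow> 'a set set \<Rightarrow> (bool \<times> 'a set) set" where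
  "kernel_graph vs K B = (\<lambda>i. (long_arc vs K i, cycle_edge (marked_cycle vs K) i)) ` {..<card K} \<union> Pair False ` B"

text \<open>Three marked vertices guarantee that the cycle through them has pairwise distinct edges,
  so that the kernel is again a cycle with chords.\<close>

locale chorded_cycle =
  fixes vs :: "'a list" and R :: "'a set" and y :: "'a \<Rightarrow> 'a"
  assumes dist: "distinct vs" and len: "3 \<le> length vs"
    and R: "R \<subseteq> set vs" and yR: "y ` R \<subseteq> set vs"
    and no_loop: "\<forall>x\<in>R. y x \<noteq> x" and no_parallel: "chord_set R y \<inter> cycle_set vs = {}"
    and marked3: "3 \<le> card (R \<union> y ` R)"
begin

definition "n = length vs"
definition "V = set vs"
definition "K = R \<union> y ` R"
definition "KP = marked_positions vs K"
definition "ps = sorted_list_of_set KP"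
definition "ks = marked_cycle vs K"
definition "G = cycle_set vs \<union> chord_set R y"

lemma n3: "3 \<le> n" and n0: "0 < n" using len by (auto simp: n_def)

lemma KV: "K \<subseteq> V" using R yR by (auto simp: K_def V_def)

lemma KP_sub: "KP \<subseteq> {..<n}" by (auto simp: KP_def marked_positions_def n_def)

lemma finKP: "finite KP" using KP_sub finite_subset by blast

lemma KP_iff: "i < n \<Longrightarrow> i \<in> KP \<longleftrightarrow> vs ! i \<in> K" by (auto simp: KP_def marked_positions_def n_def)

lemma nth_inj: "i < n \<Longrightarrow> j < n \<Longrightarrow> vs ! i = vs ! j \<longleftrightarrow> i = j"
  using dist by (simp add: n_def nth_eq_iff_index_eq)

lemma pos: "v \<in> V \<Longrightarrow> \<exists>i<n. v = vs ! i" by (auto simp: V_def n_def in_set_conv_nth)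

lemma nth_V: "i < n \<Longrightarrow> vs ! i \<in> V" by (simp add: V_def n_def)

lemma K_image: "K = (!) vs ` KP"
proof (intro equalityI subsetI)
  fix v assume v: "v \<in> K"
  then obtain i where "i < n" "v = vs ! i" using pos KV by blast
  then show "v \<in> (!) vs ` KP" using v KP_iff by blast
qed (auto simp: KP_def marked_positions_def)

lemma card_KP: "card KP = card K"
proof -
  have "inj_on ((!) vs) KP" using KP_sub nth_inj by (intro inj_onI) auto
  then show ?thesis using K_image card_image by metis
qed

lemma KP3: "3 \<le> card KP" using marked3 card_KP by (simp add: K_def)

lemma card_K0: "0 < card K" using KP3 card_KP by simp

lemma finK: "finite K" using K_image finKP by simp

lemma length_ps: "length ps = card K" by (simp add: ps_def card_KP)

lemma length_ks: "length ks = card K" by (simp add: ks_def marked_cycle_def KP_def[symmetric] card_KP)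

lemma ps_in: "i < card K \<Longrightarrow> ps ! i \<in> KP"
  using nth_mem[of i ps] length_ps finKP by (simp add: ps_def)

lemma ks_nth: "i < card K \<Longrightarrow> ks ! i = vs ! (ps ! i)"
  using length_ps by (simp add: ks_def marked_cycle_def KP_def[symmetric] ps_def)

lemma ps_less: "i < card K \<Longrightarrow> ps ! i < n" using ps_in KP_sub by blast

lemma ps_eq_iff: "i < card K \<Longrightarrow> j < card K \<Longrightarrow> ps ! i = ps ! j \<longleftrightarrow> i = j"
  using length_ps by (simp add: ps_def nth_eq_iff_index_eq)

lemma ks_eq_iff: "i < card K \<Longrightarrow> j < card K \<Longrightarrow> ks ! i = ks ! j \<longleftrightarrow> i = j"
  using ks_nth ps_less ps_eq_iff nth_inj by simp

lemma distinct_ks: "distinct ks" unfolding distinct_conv_nth using ks_eq_iff length_ks by simp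

lemma set_ks: "set ks = K"
  unfolding ks_def marked_cycle_def KP_def[symmetric] using finKP K_image by simp

lemma ks_in: "i < card K \<Longrightarrow> ks ! i \<in> K" using set_ks length_ks nth_mem by metis

lemma long_arc_iff: "long_arc vs K i \<longleftrightarrow> Suc (ps ! i) mod n \<notin> KP"
  by (simp add: long_arc_def KP_def ps_def n_def)

lemmas arc = arc_index_less[OF KP_sub KP3, unfolded card_KP]
lemmas arc_Suc = arc_index_Suc[OF KP_sub KP3]
lemmas arc_enter = arc_index_enter[OF KP_sub KP3, folded ps_def, unfolded card_KP]
lemmas arc_leave = arc_index_leave[OF KP_sub KP3, folded ps_def]
lemmas arc_after = arc_index_after[OF KP_sub KP3, folded ps_def]
lemmas consecutive = consecutive_marked[OF KP_sub KP3, folded ps_def, unfolded card_KP]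

lemma Suc_mod_less: "Suc i mod n < n" using n0 by simp

lemma Suc_mod_lessK: "Suc i mod card K < card K" using card_K0 by simp

lemma cycle_adjacent:
  assumes "{vs ! a, vs ! b} \<in> cycle_set vs" "a < n" "b < n"
  shows "b = Suc a mod n \<or> a = Suc b mod n"
  using cycle_neighbour[OF dist, of a "vs ! b"] assms nth_inj Suc_mod_less by (auto simp: n_def)

lemma cycle_step: "a < n \<Longrightarrow> {vs ! a, vs ! (Suc a mod n)} \<in> cycle_set vs"
  by (auto simp: cycle_set_def cycle_edge_def n_def)

lemma chord_in_K: "e \<in> chord_set R y \<Longrightarrow> e \<subseteq> K"
  by (auto simp: chord_set_def K_def)

lemma unmarked_edge: "e \<in> G \<Longrightarrow> \<not> e \<subseteq> K \<Longrightarrow> e \<in> cycle_set vs"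
  using chord_in_K by (auto simp: G_def)

lemma G_pair: "e \<in> G \<Longrightarrow> e \<subseteq> V \<and> card e = 2"
proof -
  assume "e \<in> G"
  then show ?thesis
  proof (cases "e \<in> cycle_set vs")
    case True
    then show ?thesis using cycle_set_subset[OF dist len] by (simp add: V_def)
  next
    case False
    then have e: "e \<in> chord_set R y" using \<open>e \<in> G\<close> by (simp add: G_def)
    then have "e \<subseteq> V" using chord_in_K KV by blast
    moreover have "card e = 2" using e no_loop by (auto simp: chord_set_def)
    ultimately show ?thesis by blast
  qed
qed

lemma finG: "finite G"
proof -
  have "finite R" using R finite_subset by blast
  then show ?thesis by (simp add: G_def finite_cycle_set chord_set_def)
qed

text \<open>Adjacency among unmarked vertices; its connected components are the interiors of the
  arcs. It refers to \<open>G\<close> and \<open>K\<close> only, not to positions, and is therefore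
  carried along by automorphisms.\<close>

definition "\<rho> = {(w, w'). w \<in> V - K \<and> w' \<in> V - K \<and> {w, w'} \<in> G}"

lemma rho_arc:
  assumes "(w, w') \<in> \<rho>\<^sup>*" "w = vs ! j" "j < n" "j \<notin> KP"
  shows "\<exists>j'<n. j' \<notin> KP \<and> w' = vs ! j' \<and> arc_index KP j' = arc_index KP j"
  using assms(1)
proof (induction rule: rtrancl_induct)
  case base
  then show ?case using assms by blast
next
  case (step w' w'')
  then obtain j' where j': "j' < n" "j' \<notin> KP" "w' = vs ! j'" "arc_index KP j' = arc_index KP j" by blast
  have w'': "w'' \<in> V - K" "{w', w''} \<in> G" using step by (auto simp: \<rho>_def)
  then obtain k where k: "k < n" "w'' = vs ! k" using pos by blast
  then have kK: "k \<notin> KP" using w'' KP_iff by blast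
  have "{vs ! j', vs ! k} \<in> cycle_set vs" using unmarked_edge w'' j' k by auto
  then have "k = Suc j' mod n \<or> j' = Suc k mod n" using cycle_adjacent j' k by blast
  then have "arc_index KP k = arc_index KP j'"
    using arc_Suc[of j'] arc_Suc[of k] j' k kK by auto
  then show ?case using j' k kK by auto
qed

lemma marked_neighbour:
  assumes "u \<in> K" "{u, vs ! j} \<in> G" "j < n" "j \<notin> KP"
  shows "u = ks ! arc_index KP j \<or> u = ks ! (Suc (arc_index KP j) mod card K)"
proof -
  have "vs ! j \<notin> K" using assms KP_iff by blast
  then have c: "{u, vs ! j} \<in> cycle_set vs" using unmarked_edge[OF assms(2)] by blast
  obtain k where k: "k < n" "u = vs ! k" using pos KV assms by blast
  then have kK: "k \<in> KP" using assms KP_iff by blast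
  have "j = Suc k mod n \<or> k = Suc j mod n" using cycle_adjacent[of k j] c k assms by simp
  then show ?thesis
  proof
    assume j: "j = Suc k mod n"
    then have "k = ps ! arc_index KP j" using arc_leave[of k] kK k assms by simp
    then show ?thesis using k ks_nth arc by simp
  next
    assume j: "k = Suc j mod n"
    then have "k = ps ! (Suc (arc_index KP j) mod card K)" using arc_enter[of j] kK assms by simp
    then show ?thesis using k ks_nth Suc_mod_lessK by simp
  qed
qed

text \<open>Walk forward from \<open>j\<close>. If the walk never arrived in front of a marked
  position, it would stay on unmarked ones forever, yet it runs through all positions of the
  cycle.\<close>

lemma arc_exit:
  assumes "j < n" "j \<notin> KP"
  shows "\<exists>j'<n. j' \<notin> KP \<and> (vs ! j, vs ! j') \<in> \<rho>\<^sup>* \<and> Suc j' mod n \<in> KP \<and> arc_index KP j' = arc_index KP j"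
proof (rule ccontr)
  assume none: "\<not> ?thesis"
  have "(j + t) mod n \<notin> KP \<and> (vs ! j, vs ! ((j + t) mod n)) \<in> \<rho>\<^sup>*" for t
  proof (induction t)
    case 0
    then show ?case using assms by simp
  next
    case (Suc t)
    define k where "k = (j + t) mod n"
    have k: "k < n" "k \<notin> KP" "(vs ! j, vs ! k) \<in> \<rho>\<^sup>*" using Suc n0 by (auto simp: k_def)
    have s: "(j + Suc t) mod n = Suc k mod n" by (simp add: k_def mod_Suc_eq)
    have "arc_index KP k = arc_index KP j"
      using rho_arc[OF k(3) refl assms] nth_inj k by auto
    then have "Suc k mod n \<notin> KP" using none k by blast
    moreover have "(vs ! k, vs ! (Suc k mod n)) \<in> \<rho>"
      unfolding \<rho>_def using k calculation KP_iff nth_V Suc_mod_less cycle_step[OF k(1)]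
      by (auto simp: G_def)
    ultimately show ?case unfolding s using k by (meson rtrancl.rtrancl_into_rtrancl)
  qed
  moreover obtain a where a: "a \<in> KP" using KP3 by fastforce
  moreover have "(j + (n - j + a)) mod n = a" using a KP_sub assms by auto
  ultimately show False by metis
qed

text \<open>The long arcs once more, described without positions: pairs of marked vertices joined by
  a path through unmarked ones. In this form invariance under automorphisms is immediate, while
  \<open>links_eq\<close> recovers the cyclic form on which the counting works.\<close>

definition "links = {{u, v} | u v. u \<in> K \<and> v \<in> K \<and> u \<noteq> v \<and>
   (\<exists>w w'. w \<in> V - K \<and> {u, w} \<in> G \<and> {v, w'} \<in> G \<and> (w, w') \<in> \<rho>\<^sup>*)}"

lemma links_eq: "links = cycle_edge ks ` {i. i < card K \<and> long_arc vs K i}"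
proof (intro equalityI subsetI)
  fix e assume "e \<in> links"
  then obtain u v w w' where e: "e = {u, v}" "u \<in> K" "v \<in> K" "u \<noteq> v" "w \<in> V - K" "{u, w} \<in> G" "{v, w'} \<in> G" "(w, w') \<in> \<rho>\<^sup>*"
    unfolding links_def by blast
  obtain j where j: "j < n" "w = vs ! j" using pos e by blast
  then have jK: "j \<notin> KP" using KP_iff e by blast
  obtain j' where j': "j' < n" "j' \<notin> KP" "w' = vs ! j'" "arc_index KP j' = arc_index KP j"
    using rho_arc[OF e(8) j(2,1) jK] by blast
  let ?i = "arc_index KP j"
  have "u = ks ! ?i \<or> u = ks ! (Suc ?i mod card K)" using marked_neighbour[of u j] e j jK by simp
  moreover have "v = ks ! ?i \<or> v = ks ! (Suc ?i mod card K)" using marked_neighbour[of v j'] e j' by simp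
  ultimately have "e = cycle_edge ks ?i" using e by (auto simp: cycle_edge_def length_ks)
  moreover have "long_arc vs K ?i" unfolding long_arc_iff using arc_after[OF j(1) jK] .
  ultimately show "e \<in> cycle_edge ks ` {i. i < card K \<and> long_arc vs K i}" using arc by blast
next
  fix e assume "e \<in> cycle_edge ks ` {i. i < card K \<and> long_arc vs K i}"
  then obtain i where i: "e = cycle_edge ks i" "i < card K" "long_arc vs K i" by blast
  define j where "j = Suc (ps ! i) mod n"
  have j: "j < n" "j \<notin> KP" using i Suc_mod_less by (auto simp: j_def long_arc_iff)
  have "ps ! i = ps ! arc_index KP j" using arc_leave[of "ps ! i"] ps_less ps_in i j by (simp add: j_def)
  then have ai: "arc_index KP j = i" using ps_eq_iff i arc by auto
  obtain j' where j': "j' < n" "j' \<notin> KP" "(vs ! j, vs ! j') \<in> \<rho>\<^sup>*" "Suc j' mod n \<in> KP" "arc_index KP j' = i"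
    using arc_exit[OF j] ai by blast
  have nx: "Suc j' mod n = ps ! (Suc i mod card K)" using arc_enter[of j'] j' by simp
  have e: "e = {ks ! i, ks ! (Suc i mod card K)}" using i by (simp add: cycle_edge_def length_ks)
  have "i \<noteq> Suc i mod card K" using i KP3 card_KP by (cases "Suc i < card K") (auto simp: mod_Suc)
  then have ne: "ks ! i \<noteq> ks ! (Suc i mod card K)" using ks_eq_iff i Suc_mod_lessK by simp
  have "{ks ! i, vs ! j} \<in> G"
    using cycle_step[of "ps ! i"] ps_less ks_nth i by (simp add: G_def j_def)
  moreover have "{ks ! (Suc i mod card K), vs ! j'} \<in> G"
    using cycle_step[OF j'(1)] ks_nth Suc_mod_lessK nx by (simp add: G_def insert_commute)
  moreover have "vs ! j \<in> V - K" using j KP_iff nth_V by blast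
  ultimately show "e \<in> links" unfolding links_def e using j'(3) ne ks_in i Suc_mod_lessK by blast
qed

lemma inner_eq: "{e \<in> G. e \<subseteq> K} = cycle_edge ks ` {i. i < card K \<and> \<not> long_arc vs K i} \<union> chord_set R y"
proof (intro equalityI subsetI)
  fix e assume e: "e \<in> {e \<in> G. e \<subseteq> K}"
  show "e \<in> cycle_edge ks ` {i. i < card K \<and> \<not> long_arc vs K i} \<union> chord_set R y"
  proof (cases "e \<in> chord_set R y")
    case False
    then obtain j where j: "j < n" "e = {vs ! j, vs ! (Suc j mod n)}"
      using e by (auto simp: G_def cycle_set_def cycle_edge_def n_def)
    then have jK: "j \<in> KP" "Suc j mod n \<in> KP" using e KP_iff Suc_mod_less by auto
    define i where "i = rank_in KP j"
    have i: "ps ! i = j" "i < card K"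
      using nth_rank_in[OF finKP jK(1)] card_KP by (auto simp: i_def ps_def)
    have "\<not> long_arc vs K i" using i jK by (simp add: long_arc_iff)
    moreover have "e = cycle_edge ks i"
      using consecutive[of i] i jK j ks_nth Suc_mod_lessK by (simp add: cycle_edge_def length_ks)
    ultimately show ?thesis using i by blast
  qed auto
next
  fix e assume "e \<in> cycle_edge ks ` {i. i < card K \<and> \<not> long_arc vs K i} \<union> chord_set R y"
  then show "e \<in> {e \<in> G. e \<subseteq> K}"
  proof
    assume "e \<in> cycle_edge ks ` {i. i < card K \<and> \<not> long_arc vs K i}"
    then obtain i where i: "e = cycle_edge ks i" "i < card K" "\<not> long_arc vs K i" by blast
    then have "Suc (ps ! i) mod n = ps ! (Suc i mod card K)" using consecutive by (simp add: long_arc_iff)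
    then have "e = {vs ! (ps ! i), vs ! (Suc (ps ! i) mod n)}"
      using i ks_nth Suc_mod_lessK by (simp add: cycle_edge_def length_ks)
    then have "e \<in> cycle_set vs" using cycle_step ps_less i by simp
    moreover have "e \<subseteq> K" using i ks_in Suc_mod_lessK by (auto simp: cycle_edge_def length_ks)
    ultimately show ?thesis by (simp add: G_def)
  qed (use chord_in_K in \<open>auto simp: G_def\<close>)
qed

lemma kernel_eq: "kernel_graph vs K (chord_set R y) = {(c, e). if c then e \<in> links else e \<in> G \<and> e \<subseteq> K}"
proof -
  have "kernel_graph vs K (chord_set R y) = Pair True ` links \<union> Pair False ` {e \<in> G. e \<subseteq> K}"
  proof -
    have split: "(\<lambda>i. (P i, f i)) ` {..<N} = Pair True ` f ` {i. i < N \<and> P i} \<union> Pair False ` f ` {i. i < N \<and> \<not> P i}"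
      for P :: "nat \<Rightarrow> bool" and f :: "nat \<Rightarrow> 'a set" and N
      by auto
    show ?thesis unfolding kernel_graph_def links_eq inner_eq ks_def[symmetric] split by (simp only: image_Un Un_assoc)
  qed
  then show ?thesis by (auto split: if_splits)
qed

text \<open>A marked vertex has two cycle edges and a chord that is not a cycle edge; an unmarked
  one has only cycle edges. Hence \<open>K\<close> is determined by degrees and every automorphism
  preserves it.\<close>

lemma card_incident: "v \<in> V \<Longrightarrow> 3 \<le> card {e \<in> G. v \<in> e} \<longleftrightarrow> v \<in> K"
proof -
  assume v: "v \<in> V"
  have cyc2: "2 \<le> card {e \<in> cycle_set vs. v \<in> e}" using card_cycle_incident[OF dist len] v by (simp add: V_def)
  show ?thesis
  proof (cases "v \<in> K")
    case True
    then obtain e where e: "e \<in> chord_set R y" "v \<in> e" by (auto simp: K_def chord_set_def)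
    have "{e \<in> cycle_set vs. v \<in> e} \<union> {e} \<subseteq> {e \<in> G. v \<in> e}" using e by (auto simp: G_def)
    then have "card ({e \<in> cycle_set vs. v \<in> e} \<union> {e}) \<le> card {e \<in> G. v \<in> e}" using finG by (intro card_mono) auto
    moreover have "e \<notin> cycle_set vs" using e no_parallel by auto
    then have "card ({e \<in> cycle_set vs. v \<in> e} \<union> {e}) = card {e \<in> cycle_set vs. v \<in> e} + 1"
      using finite_cycle_set[of vs] by (subst card_Un_disjoint) auto
    ultimately show ?thesis using True cyc2 by simp
  next
    case False
    have "{e \<in> G. v \<in> e} \<subseteq> (\<lambda>w. {v, w}) ` {w. {v, w} \<in> cycle_set vs}"
    proof
      fix e assume e: "e \<in> {e \<in> G. v \<in> e}"
      then have "e \<in> cycle_set vs" using unmarked_edge False by blast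
      moreover obtain w where "e = {v, w}" using G_pair[of e] e by (auto simp: card_2_iff)
      ultimately show "e \<in> (\<lambda>w. {v, w}) ` {w. {v, w} \<in> cycle_set vs}" by blast
    qed
    moreover note nb = card_cycle_neighbours[OF dist, of v]
    ultimately have "card {e \<in> G. v \<in> e} \<le> card {w. {v, w} \<in> cycle_set vs}"
      using v by (intro surj_card_le) (auto simp: V_def)
    then show ?thesis using False nb v by (simp add: V_def)
  qed
qed

section \<open>Automorphisms acting on the kernel\<close>

context
  fixes \<pi> assumes \<pi>: "\<pi> \<in> automorphisms V G"
begin

lemma perm: "\<pi> permutes V" using \<pi> by (simp add: automorphisms_def)

lemma inj_pi: "inj \<pi>" using perm permutes_inj by blast

lemma pi_V: "\<pi> v \<in> V \<longleftrightarrow> v \<in> V" using perm by (rule permutes_in_image)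

lemma pi_edge: "u \<in> V \<Longrightarrow> v \<in> V \<Longrightarrow> {u, v} \<in> G \<Longrightarrow> {\<pi> u, \<pi> v} \<in> G"
  using \<pi> by (simp add: automorphisms_def)

lemma pi_image: "e \<in> G \<Longrightarrow> \<pi> ` e \<in> G"
  using automorphism_image[OF \<pi>] G_pair by blast

lemma pi_K: "v \<in> V \<Longrightarrow> \<pi> v \<in> K \<longleftrightarrow> v \<in> K"
proof -
  assume v: "v \<in> V"
  have injI: "inj_on ((`) \<pi>) G" using inj_pi by (meson inj_image_eq_iff inj_onI)
  have surj: "(`) \<pi> ` G = G" using pi_image injI finG by (intro endo_inj_surj) auto
  have "{e \<in> G. \<pi> v \<in> e} = (`) \<pi> ` {e \<in> G. v \<in> e}"
  proof (intro equalityI subsetI)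
    fix e assume e: "e \<in> {e \<in> G. \<pi> v \<in> e}"
    then obtain e' where e': "e' \<in> G" "e = \<pi> ` e'" using surj by blast
    then have "v \<in> e'" using e inj_pi by (auto dest: injD)
    then show "e \<in> (`) \<pi> ` {e \<in> G. v \<in> e}" using e' by blast
  qed (use pi_image in auto)
  moreover have "inj_on ((`) \<pi>) {e \<in> G. v \<in> e}" using injI by (rule inj_on_subset) auto
  ultimately have "card {e \<in> G. \<pi> v \<in> e} = card {e \<in> G. v \<in> e}" by (simp add: card_image)
  then show ?thesis using card_incident[OF v] card_incident[of "\<pi> v"] pi_V v by simp
qed

lemma pi_rho: "(w, w') \<in> \<rho>\<^sup>* \<Longrightarrow> (\<pi> w, \<pi> w') \<in> \<rho>\<^sup>*"
proof (induction rule: rtrancl_induct)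
  case (step a b)
  then have "(\<pi> a, \<pi> b) \<in> \<rho>" using pi_edge pi_K pi_V by (auto simp: \<rho>_def)
  then show ?case using step by (meson rtrancl.rtrancl_into_rtrancl)
qed auto

lemma rho_V: "(w, w') \<in> \<rho>\<^sup>* \<Longrightarrow> w \<in> V - K \<Longrightarrow> w' \<in> V - K"
  by (induction rule: rtrancl_induct) (auto simp: \<rho>_def)

text \<open>The identity outside \<open>K\<close>, as required of a permutation of
  \<open>K\<close>.\<close>

definition "pi_kernel v = (if v \<in> K then \<pi> v else v)"

lemma coloured_auto_kernel: "coloured_auto K (kernel_graph vs K (chord_set R y)) pi_kernel"
proof -
  have "\<pi> ` K \<subseteq> K" using pi_K KV by blast
  then have "\<pi> ` K = K" using finK inj_pi by (intro endo_inj_surj) (auto intro: inj_on_subset)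
  then have "bij_betw pi_kernel K K"
    using inj_pi by (auto simp: bij_betw_def pi_kernel_def inj_on_def inj_def)
  then have p: "pi_kernel permutes K" by (intro bij_imp_permutes) (auto simp: pi_kernel_def)
  have im: "pi_kernel ` e = \<pi> ` e" if "e \<subseteq> K" for e using that by (auto simp: pi_kernel_def)
  have 1: "\<pi> ` e \<in> links \<and> e \<subseteq> K" if el: "e \<in> links" for e
  proof -
    obtain u v w w' where e: "e = {u, v}" "u \<in> K" "v \<in> K" "u \<noteq> v" "w \<in> V - K" "{u, w} \<in> G" "{v, w'} \<in> G" "(w, w') \<in> \<rho>\<^sup>*"
      using el unfolding links_def by blast
    have "w' \<in> V" using rho_V e by blast
    then have "\<pi> u \<in> K" "\<pi> v \<in> K" "\<pi> u \<noteq> \<pi> v" "\<pi> w \<in> V - K" "{\<pi> u, \<pi> w} \<in> G" "{\<pi> v, \<pi> w'} \<in> G" "(\<pi> w, \<pi> w') \<in> \<rho>\<^sup>*"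
      using e pi_K pi_V KV pi_edge pi_rho inj_pi by (auto dest: injD)
    then have "{\<pi> u, \<pi> v} \<in> links" unfolding links_def by blast
    then show ?thesis using e by simp
  qed
  have 2: "\<pi> ` e \<in> G \<and> \<pi> ` e \<subseteq> K" if "e \<in> G" "e \<subseteq> K" for e
    using that pi_image pi_K KV by blast
  have "(c, pi_kernel ` e) \<in> kernel_graph vs K (chord_set R y)" if "(c, e) \<in> kernel_graph vs K (chord_set R y)" for c e
  proof (cases c)
    case True
    then have "e \<in> links" using that by (simp add: kernel_eq)
    then show ?thesis using 1[of e] im[of e] True by (simp add: kernel_eq)
  next
    case False
    then have "e \<in> G" "e \<subseteq> K" using that by (simp_all add: kernel_eq)
    then show ?thesis using 2[of e] im[of e] False by (simp add: kernel_eq)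
  qed
  then show ?thesis unfolding coloured_auto_def using p by auto
qed

text \<open>With its ends fixed, an arc could only be exchanged with another arc having the same two
  ends or be reversed. The first needs at most two marked vertices, the second does not fix the
  ends.\<close>

lemma kernel_fixed_imp_id:
  assumes fixK: "\<And>v. v \<in> K \<Longrightarrow> \<pi> v = v"
  shows "\<pi> = id"
proof -
  have first: "\<pi> (vs ! (Suc a mod n)) = vs ! (Suc a mod n)" if a: "a \<in> KP" for a
  proof (cases "Suc a mod n \<in> KP")
    case True
    then show ?thesis using fixK K_image by blast
  next
    case False
    have an: "a < n" using a KP_sub by blast
    define j where "j = Suc a mod n"
    have j: "j < n" "j \<notin> KP" using False Suc_mod_less by (auto simp: j_def)
    have jV: "vs ! j \<in> V - K" using j KP_iff nth_V by blast
    have aK: "vs ! a \<in> K" using a K_image by blast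
    define i where "i = arc_index KP j"
    have i: "i < card K" "ps ! i = a" using arc arc_leave[of a] an a j by (auto simp: i_def j_def)
    have "{vs ! a, vs ! j} \<in> G" using cycle_step[OF an] by (simp add: G_def j_def)
    then have "{vs ! a, \<pi> (vs ! j)} \<in> G" using pi_edge[of "vs ! a" "vs ! j"] aK KV jV fixK by auto
    moreover have pj: "\<pi> (vs ! j) \<in> V - K" using jV pi_K pi_V by blast
    ultimately have c: "{vs ! a, \<pi> (vs ! j)} \<in> cycle_set vs" using unmarked_edge by blast
    obtain k where k: "k < n" "\<pi> (vs ! j) = vs ! k" using pos pj by blast
    then have kK: "k \<notin> KP" using pj KP_iff by auto
    have "k = j \<or> a = Suc k mod n" using cycle_adjacent[of a k] c k an by (simp add: j_def)
    \<comment> \<open>Here the first inner vertex of arc \<open>i\<close> is sent into the preceding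
      arc \<open>l\<close>. Following the arc to its far end \<open>b\<close>, which is fixed, makes
      \<open>b\<close> an end of arc \<open>l\<close> too. Among at least three marked vertices the
      end after \<open>i\<close> is neither \<open>l\<close> nor \<open>i\<close>.\<close>
    moreover have False if ak: "a = Suc k mod n"
    proof -
      obtain j' where j': "j' < n" "j' \<notin> KP" "(vs ! j, vs ! j') \<in> \<rho>\<^sup>*" "Suc j' mod n \<in> KP" "arc_index KP j' = i"
        using arc_exit[OF j] by (auto simp: i_def)
      define b where "b = Suc j' mod n"
      have b: "b = ps ! (Suc i mod card K)" using arc_enter[of j'] j' by (simp add: b_def)
      have bK: "vs ! b \<in> K" using j' K_image by (auto simp: b_def)
      have "{vs ! b, vs ! j'} \<in> G" using cycle_step[OF j'(1)] by (simp add: G_def b_def insert_commute)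
      then have "{vs ! b, \<pi> (vs ! j')} \<in> G" using pi_edge[of "vs ! b" "vs ! j'"] bK KV nth_V j' fixK by auto
      moreover have "(vs ! k, \<pi> (vs ! j')) \<in> \<rho>\<^sup>*" using pi_rho[OF j'(3)] k by simp
      then obtain k' where k': "k' < n" "k' \<notin> KP" "\<pi> (vs ! j') = vs ! k'" "arc_index KP k' = arc_index KP k"
        using rho_arc[OF _ refl k(1) kK] by blast
      ultimately have or: "vs ! b = ks ! arc_index KP k \<or> vs ! b = ks ! (Suc (arc_index KP k) mod card K)"
        using marked_neighbour[of "vs ! b" k'] bK by simp
      define l where "l = arc_index KP k"
      have l: "l < card K" using arc by (simp add: l_def)
      have "a = ps ! (Suc l mod card K)" using arc_enter[of k] k kK ak a by (simp add: l_def)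
      then have il: "i = Suc l mod card K" using i ps_eq_iff Suc_mod_lessK by simp
      have "vs ! b = ks ! (Suc i mod card K)" using b ks_nth Suc_mod_lessK by simp
      then have "Suc i mod card K = l \<or> Suc i mod card K = i"
        using or ks_eq_iff l Suc_mod_lessK i il by (auto simp: l_def[symmetric])
      moreover have c3: "3 \<le> card K" using KP3 card_KP by simp
      ultimately show False
      proof (cases "Suc l < card K")
        case True
        then have "i = Suc l" using il by simp
        show False
        proof (cases "Suc i < card K")
          case True
          then show False using \<open>Suc i mod card K = l \<or> _\<close> \<open>i = Suc l\<close> by simp
        next
          case False
          then have "Suc i = card K" using i(1) by simp
          then show False using \<open>Suc i mod card K = l \<or> _\<close> \<open>i = Suc l\<close> c3 by simp
        qed
      next
        case False
        then have "Suc l = card K" using l by simp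
        then have "i = 0" using il by simp
        then show False using \<open>Suc i mod card K = l \<or> _\<close> c3 \<open>Suc l = card K\<close> by auto
      qed
    qed
    ultimately have "k = j" by blast
    then show ?thesis using k by (simp add: j_def)
  qed
  obtain a where a: "a \<in> KP" using KP3 by fastforce
  let ?x = "\<lambda>t. (a + t) mod n"
  have xn: "?x t < n" for t using n0 by simp
  have xS: "?x (Suc t) = Suc (?x t) mod n" for t by (simp add: mod_Suc_eq)
  \<comment> \<open>Two consecutive fixed vertices fix the next one: an unmarked vertex has only its
    two neighbours on the cycle, and one of them is already taken.\<close>
  have "\<pi> (vs ! ?x t) = vs ! ?x t \<and> \<pi> (vs ! ?x (Suc t)) = vs ! ?x (Suc t)" for t
  proof (induction t)
    case 0
    have "?x 0 = a" using a KP_sub by auto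
    then show ?case using first[OF a] fixK a K_image xS[of 0] by auto
  next
    case (Suc t)
    define b where "b = ?x (Suc t)"
    define c where "c = ?x (Suc (Suc t))"
    have bn: "b < n" unfolding b_def by (rule xn)
    have cn: "c < n" unfolding c_def by (rule xn)
    have cb: "c = Suc b mod n" unfolding b_def c_def by (rule xS)
    have fb: "\<pi> (vs ! b) = vs ! b" using Suc by (simp only: b_def)
    have "\<pi> (vs ! c) = vs ! c"
    proof (cases "b \<in> KP \<or> c \<in> KP")
      case True
      then show ?thesis using first cb fixK K_image by auto
    next
      case False
      have "{vs ! b, vs ! c} \<in> G" using cycle_step[OF bn] cb by (simp add: G_def)
      then have "{vs ! b, \<pi> (vs ! c)} \<in> G" using pi_edge[of "vs ! b" "vs ! c"] nth_V bn cn fb by auto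
      then have cy: "{vs ! b, \<pi> (vs ! c)} \<in> cycle_set vs" using unmarked_edge False KP_iff bn by blast
      obtain k where k: "k < n" "\<pi> (vs ! c) = vs ! k" using pos pi_V nth_V cn by blast
      have "k = c \<or> b = Suc k mod n" using cycle_adjacent[of b k] cy k bn cb by simp
      moreover have False if bk: "b = Suc k mod n"
      proof -
        have "b = Suc (?x t) mod n" unfolding b_def by (rule xS)
        then have "k = ?x t" using bk Suc_mod_inj[of k n "?x t"] k xn by simp
        then have "\<pi> (vs ! c) = \<pi> (vs ! ?x t)" using Suc k by simp
        then have "vs ! c = vs ! ?x t" using inj_pi by (auto dest: injD)
        then have "c = ?x t" using nth_inj cn xn by simp
        then have "Suc (Suc (?x t) mod n) mod n = ?x t" using cb \<open>b = Suc (?x t) mod n\<close> by simp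
        moreover define z where "z = ?x t"
        ultimately have z: "Suc (Suc z mod n) mod n = z" by (simp only:)
        have zn: "z < n" unfolding z_def by (rule xn)
        show False
        proof (cases "Suc z < n")
          case True
          then have "Suc (Suc z) mod n = z" using z by simp
          show False
          proof (cases "Suc (Suc z) < n")
            case True
            then show False using \<open>Suc (Suc z) mod n = z\<close> by simp
          next
            case False
            then have "Suc (Suc z) = n" using True by simp
            then show False using \<open>Suc (Suc z) mod n = z\<close> n3 by simp
          qed
        next
          case False
          then have "Suc z = n" using zn by simp
          then show False using z n3 by auto
        qed
      qed
      ultimately show ?thesis using k by auto
    qed
    then show ?case using fb by (simp only: b_def c_def)
  qed
  then have fixall: "\<pi> (vs ! ?x t) = vs ! ?x t" for t by blast
  show ?thesis
  proof
    fix v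
    show "\<pi> v = id v"
    proof (cases "v \<in> V")
      case True
      then obtain j where j: "j < n" "v = vs ! j" using pos by blast
      have "?x (n - a + j) = j" using a KP_sub j by auto
      then show ?thesis using fixall[of "n - a + j"] j by simp
    qed (use perm in \<open>auto simp: permutes_def\<close>)
  qed
qed

lemma pi_kernel_nontrivial: "\<pi> \<noteq> id \<Longrightarrow> pi_kernel \<noteq> id"
proof
  assume "\<pi> \<noteq> id" "pi_kernel = id"
  have "\<pi> v = v" if "v \<in> K" for v
    using fun_cong[OF \<open>pi_kernel = id\<close>, of v] that by (simp add: pi_kernel_def)
  then show False using kernel_fixed_imp_id \<open>\<pi> \<noteq> id\<close> by blast
qed

end

text \<open>Two arcs and one chord end at every marked vertex. The chord differs from a long arc by
  its colour, and from an arc without inner vertices because it is not parallel to a cycle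
  edge.\<close>

lemma kernel_degree:
  assumes v: "v \<in> K"
  shows "3 \<le> card {ce \<in> kernel_graph vs K (chord_set R y). v \<in> snd ce}"
proof -
  let ?f = "\<lambda>i. (long_arc vs K i, cycle_edge ks i)"
  have c3: "3 \<le> length ks" using KP3 card_KP length_ks by simp
  let ?I = "{i. i < card K \<and> v \<in> cycle_edge ks i}"
  have "{e \<in> cycle_set ks. v \<in> e} = cycle_edge ks ` ?I" by (auto simp: cycle_set_def length_ks)
  then have "2 \<le> card (cycle_edge ks ` ?I)"
    using card_cycle_incident[OF distinct_ks c3, of v] set_ks v by simp
  also have "\<dots> \<le> card (?f ` ?I)"
  proof -
    have "cycle_edge ks ` ?I = snd ` ?f ` ?I" by force
    then show ?thesis using card_image_le[of "?f ` ?I" snd] by simp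
  qed
  finally have c2: "2 \<le> card (?f ` ?I)" .
  obtain e where e: "e \<in> chord_set R y" "v \<in> e" using v by (auto simp: K_def chord_set_def)
  have "(False, e) \<notin> ?f ` ?I"
  proof
    assume "(False, e) \<in> ?f ` ?I"
    then obtain i where i: "i < card K" "\<not> long_arc vs K i" "e = cycle_edge ks i" by auto
    then have "Suc (ps ! i) mod n = ps ! (Suc i mod card K)" using consecutive by (simp add: long_arc_iff)
    then have "e = {vs ! (ps ! i), vs ! (Suc (ps ! i) mod n)}"
      using i ks_nth Suc_mod_lessK by (simp add: cycle_edge_def length_ks)
    then have "e \<in> cycle_set vs" using cycle_step ps_less i by simp
    then show False using e no_parallel by auto
  qed
  then have c: "card (insert (False, e) (?f ` ?I)) = Suc (card (?f ` ?I))" by simp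
  have sub: "insert (False, e) (?f ` ?I) \<subseteq> {ce \<in> kernel_graph vs K (chord_set R y). v \<in> snd ce}"
    using e by (auto simp: kernel_graph_def ks_def)
  have fin: "finite {ce \<in> kernel_graph vs K (chord_set R y). v \<in> snd ce}"
    using finG by (simp add: kernel_graph_def G_def)
  have "Suc (card (?f ` ?I)) \<le> card {ce \<in> kernel_graph vs K (chord_set R y). v \<in> snd ce}"
    using card_mono[OF fin sub] unfolding c .
  then show ?thesis using c2 by linarith
qed

end

section \<open>Random relabelling of the kernel\<close>

lemma relabelling_permutation:
  assumes "distinct xs" "distinct ys" "set xs = K" "set ys = K"
  obtains g where "g permutes K" "\<And>i. i < length xs \<Longrightarrow> g (xs ! i) = ys ! i"
proof -
  have len: "length xs = length ys" using assms distinct_card by metis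
  have bx: "bij_betw ((!) xs) {..<length xs} K" using assms by (intro bij_betw_nth) auto
  have b2: "bij_betw ((!) ys) {..<length xs} K" using assms len by (intro bij_betw_nth) auto
  define h where "h = the_inv_into {..<length xs} ((!) xs)"
  have bh: "bij_betw h K {..<length xs}" unfolding h_def by (rule bij_betw_the_inv_into[OF bx])
  define g where "g = (\<lambda>v. if v \<in> K then ys ! h v else v)"
  have "bij_betw ((!) ys \<circ> h) K K" by (rule bij_betw_trans[OF bh b2])
  then have "bij_betw g K K" by (subst bij_betw_cong[of K g "(!) ys \<circ> h"]) (auto simp: g_def)
  then have "g permutes K" by (rule bij_imp_permutes) (auto simp: g_def)
  moreover have "g (xs ! i) = ys ! i" if "i < length xs" for i
  proof -
    have "h (xs ! i) = i" unfolding h_def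
      by (rule the_inv_into_f_f[OF bij_betw_imp_inj_on[OF bx]]) (use that in simp)
    moreover have "xs ! i \<in> K" using nth_mem[OF that] assms(3) by simp
    ultimately show ?thesis by (simp add: g_def)
  qed
  ultimately show ?thesis using that by blast
qed

text \<open>An isomorphic copy has the same degrees, and conjugation with \<open>g\<close> carries
  over a nontrivial automorphism.\<close>

lemma relabel_coloured_graph:
  assumes g: "g permutes K" and E: "E \<subseteq> coloured_pairs K" and K: "finite K"
  defines "E' \<equiv> (\<lambda>(c, e). (c, g ` e)) ` E"
  shows "E' \<subseteq> coloured_pairs K"
    and "(\<forall>v\<in>K. 3 \<le> card {ce \<in> E. v \<in> snd ce}) \<Longrightarrow> v \<in> K \<Longrightarrow> 3 \<le> card {ce \<in> E'. v \<in> snd ce}"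
    and "coloured_auto K E \<pi> \<Longrightarrow> \<pi> \<noteq> id \<Longrightarrow> \<exists>\<pi>'. coloured_auto K E' \<pi>' \<and> \<pi>' \<noteq> id"
proof -
  have inj: "inj g" using g permutes_inj by blast
  have ci: "card (g ` e) = card e" for e using inj by (meson card_image inj_on_subset subset_UNIV)
  show sub: "E' \<subseteq> coloured_pairs K"
  proof
    fix ce assume "ce \<in> E'"
    then obtain c e where e: "ce = (c, g ` e)" "(c, e) \<in> E" by (auto simp: E'_def)
    then have "(c, e) \<in> coloured_pairs K" using E by blast
    then have "e \<subseteq> K" "card e = 2" by (simp_all add: coloured_pairs_def)
    then show "ce \<in> coloured_pairs K"
      using e permutes_image[OF g] by (auto simp: coloured_pairs_def ci)
  qed
  have finE: "finite E" using E finite_coloured_pairs[OF K] finite_subset by blast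
  show "3 \<le> card {ce \<in> E'. v \<in> snd ce}" if d: "\<forall>v\<in>K. 3 \<le> card {ce \<in> E. v \<in> snd ce}" and v: "v \<in> K"
  proof -
    obtain u where u: "u \<in> K" "v = g u" using g v by (metis permutes_image imageE)
    let ?f = "\<lambda>(c :: bool, e). (c, g ` e)"
    have "inj_on ?f {ce \<in> E. u \<in> snd ce}" using inj by (auto simp: inj_on_def inj_image_eq_iff)
    then have "card {ce \<in> E. u \<in> snd ce} = card (?f ` {ce \<in> E. u \<in> snd ce})" by (simp add: card_image)
    also have "\<dots> \<le> card {ce \<in> E'. v \<in> snd ce}"
      using finE u by (intro card_mono) (auto simp: E'_def)
    finally show ?thesis using d u by force
  qed
  show "\<exists>\<pi>'. coloured_auto K E' \<pi>' \<and> \<pi>' \<noteq> id" if \<pi>: "coloured_auto K E \<pi>" "\<pi> \<noteq> id"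
  proof (intro exI conjI)
    let ?p = "g \<circ> \<pi> \<circ> inv g"
    have pp: "\<pi> permutes K" using \<pi> by (simp add: coloured_auto_def)
    have ig: "inv g (g x) = x" for x using inj by simp
    have "?p permutes K" using g pp by (intro permutes_compose permutes_inv)
    moreover have "(c, ?p ` g ` e) \<in> E'" if "(c, e) \<in> E" for c e
    proof -
      have "(c, \<pi> ` e) \<in> E" using \<pi> that by (auto simp: coloured_auto_def)
      moreover have "?p ` g ` e = g ` \<pi> ` e" by (simp add: image_comp comp_def ig)
      ultimately show ?thesis by (auto simp: E'_def intro!: image_eqI[of _ _ "(c, \<pi> ` e)"])
    qed
    ultimately show "coloured_auto K E' ?p" by (auto simp: coloured_auto_def E'_def)
    show "?p \<noteq> id"
    proof
      assume "?p = id"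
      have "g (\<pi> x) = g x" for x
        using fun_cong[OF \<open>?p = id\<close>, of "g x"] unfolding comp_apply ig id_apply .
      then show False using \<pi>(2) inj by (auto simp: fun_eq_iff dest: injD)
    qed
  qed
qed

text \<open>
  Given the set \<open>Q\<close> of chord ends, the cyclic order of the kernel is fixed. A random relabelling of its
  vertices turns it into a uniform Hamilton cycle without affecting asymmetry.
\<close>

lemma card_injections_symmetric_fixed_range:
  fixes vs :: "'a list"
  assumes dist: "distinct vs" and len: "3 \<le> length vs" and R: "R \<subseteq> set vs" and Q: "Q \<subseteq> set vs" "card Q = card R"
    and big: "real (card R) \<ge> (4 * 1536) ^ 48"
  shows "real (card {y \<in> injections R Q. (\<forall>x\<in>R. y x \<noteq> x) \<and> chord_set R y \<inter> cycle_set vs = {} \<and>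
             \<not> asymmetric (set vs) (cycle_set vs \<union> chord_set R y)})
     \<le> 16 * exp 10 * real (card R) powr (-1/4) * real (card (injections R Q))"
    (is "real (card ?Y) \<le> _")
proof -
  define K where "K = R \<union> Q"
  note K_union = K_def
  define k where "k = card K"
  let ?r = "card R"
  have fin: "finite R" "finite Q" using R Q finite_subset by blast+
  then have finK: "finite K" by (simp add: K_def)
  note finite_union = finK
  have kr: "?r \<le> k" "k \<le> 2 * ?r"
  proof -
    show "?r \<le> k" unfolding k_def using finK by (intro card_mono) (auto simp: K_def)
    show "k \<le> 2 * ?r" unfolding k_def K_def using card_Un_le[of R Q] Q by simp
  qed
  have bigk: "real k \<ge> (4 * 1536) ^ 48" using big kr by linarith
  note fp = four_powr_le[of 1536 "real k", OF _ bigk]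
  have k96: "k \<ge> 96" "k \<ge> 3" "k > 0" using fp(2) by simp_all
  have r0: "?r > 0" using k96 kr by simp
  define x where "x = (1536 / real k) powr (47/48)"
  have xk: "0 < 1536 / real k" "1536 / real k \<le> 1" using fp(2) k96 by auto
  have x: "0 < x" "x \<le> 1" using xk k96 by (auto simp: x_def powr_le1)
  have pw: "a ^ (m - m div 48) \<le> x ^ m" if "0 \<le> a" "a \<le> 1536 / real k" for a m
  proof -
    have "a ^ (m - m div 48) \<le> (1536 / real k) ^ (m - m div 48)" using that by (intro power_mono) auto
    also have "\<dots> \<le> x ^ m" unfolding x_def using power_sub_div_le_powr[OF xk] .
    finally show ?thesis .
  qed
  define ks where "ks = marked_cycle vs K"
  let ?P = "permutations_of_set K"
  let ?J = "injections R Q"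
  let ?\<Omega> = "?P \<times> ?J"
  have finJ: "finite ?J" using fin finite_injections by blast
  have fin\<Omega>: "finite ?\<Omega>" using finJ by simp
  have MP: "marked_positions vs K \<subseteq> {..<length vs}" "(!) vs ` marked_positions vs K = K"
    using R Q by (auto simp: marked_positions_def K_def in_set_conv_nth image_iff) (metis in_set_conv_nth subsetD)+
  have injMP: "inj_on ((!) vs) (marked_positions vs K)"
    using dist MP(1) by (auto simp: inj_on_def nth_eq_iff_index_eq marked_positions_def)
  have finMP: "finite (marked_positions vs K)" using MP(1) finite_subset by blast
  have cMP: "card (marked_positions vs K) = k" using card_image[OF injMP] MP(2) by (simp add: k_def)
  have ks: "length ks = k" "set ks = K" "distinct ks"
    unfolding ks_def marked_cycle_def using cMP finMP MP(2) injMP by (auto simp: distinct_map)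
  \<comment> \<open>The relabelling that turns the cyclic order of the marked vertices into the list
    \<open>us\<close>. Under it the kernel cycle becomes the cycle of \<open>us\<close>, and a chord
    prescribed in the copy corresponds to a chord prescribed for \<open>y\<close>.\<close>
  define g where "g = (\<lambda>us. SOME g. g permutes K \<and> (\<forall>i<k. g (ks ! i) = us ! i))"
  have g: "g us permutes K \<and> (\<forall>i<k. g us (ks ! i) = us ! i)" if us: "us \<in> ?P" for us
  proof -
    have "distinct us" "set us = K" using us by (auto simp: permutations_of_set_def)
    then obtain h where "h permutes K" "\<And>i. i < length ks \<Longrightarrow> h (ks ! i) = us ! i"
      using relabelling_permutation[OF ks(3) _ ks(2)] by metis
    then have "\<exists>h. h permutes K \<and> (\<forall>i<k. h (ks ! i) = us ! i)" using ks by auto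
    then show ?thesis unfolding g_def by (rule someI_ex)
  qed
  define E where "E = (\<lambda>(us, y). (\<lambda>(c, e). (c, g us ` e)) ` (kernel_graph vs K (chord_set R y) \<inter> coloured_pairs K))"
  have Esub: "E \<omega> \<subseteq> coloured_pairs K" if \<omega>: "\<omega> \<in> ?\<Omega>" for \<omega>
  proof -
    obtain us y where e: "\<omega> = (us, y)" "us \<in> ?P" using \<omega> by auto
    show ?thesis unfolding E_def e(1) prod.case
      by (rule relabel_coloured_graph(1)[OF conjunct1[OF g[OF e(2)]] _ finK]) auto
  qed
  let ?Bad = "{\<omega> \<in> ?\<Omega>. (\<forall>v\<in>K. 3 \<le> card {ce \<in> E \<omega>. v \<in> snd ce}) \<and> (\<exists>\<pi>. coloured_auto K (E \<omega>) \<pi> \<and> \<pi> \<noteq> id)}"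
  have "real (card ?Bad) \<le> 16 * exp 10 * real (card K) powr (-1/4) * real (card ?\<Omega>)"
  proof (rule first_moment_automorphisms[OF finK fin\<Omega> Esub])
    show "K \<noteq> {}" using k96 by (auto simp: k_def)
    fix T assume T: "T \<subseteq> coloured_pairs K"
    have finT: "finite T" using finite_subset[OF T finite_coloured_pairs[OF finK]] .
    \<comment> \<open>The set \<open>S\<close> collects the edges of \<open>T\<close> that come from
      arcs; the rest are chords. \<open>T\<close> may contain a pair in both colours, but within
      each of the two parts a pair occurs only once, so that dropping the colours loses no
      edge.\<close>
    let ?D = "{S. S \<subseteq> T \<and> inj_on snd S \<and> inj_on snd (T - S)}"
    let ?C = "\<lambda>S. SIGMA us : {us \<in> ?P. snd ` S \<subseteq> cycle_set us}.
        {y \<in> ?J. (\<lambda>e. inv (g us) ` e) ` snd ` (T - S) \<subseteq> chord_set R y}"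
    have sub: "{\<omega> \<in> ?\<Omega>. T \<subseteq> E \<omega>} \<subseteq> (\<Union>S\<in>?D. ?C S)"
    proof
      fix \<omega> assume \<omega>: "\<omega> \<in> {\<omega> \<in> ?\<Omega>. T \<subseteq> E \<omega>}"
      then obtain us y where e: "\<omega> = (us, y)" "us \<in> ?P" "y \<in> ?J" "T \<subseteq> E (us, y)" by auto
      have usl: "length us = k" "distinct us"
        using e by (auto simp: permutations_of_set_def distinct_card k_def)
      have inj: "inj (g us)" using g[OF e(2)] permutes_inj by blast
      let ?A = "(\<lambda>i. (long_arc vs K i, cycle_edge us i)) ` {..<k}"
      define S where "S = T \<inter> ?A"
      have cyc: "g us ` cycle_edge ks i = cycle_edge us i" if "i < k" for i
      proof -
        have "Suc i mod k < k" using k96 by simp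
        then show ?thesis using g[OF e(2)] that ks usl by (simp add: cycle_edge_def)
      qed
      have chord: "ce \<in> (\<lambda>e. (False, g us ` e)) ` chord_set R y" if ce: "ce \<in> T - S" for ce
      proof -
        have "ce \<in> E (us, y)" "ce \<notin> ?A" using ce e(4) by (auto simp: S_def)
        then obtain c b where b: "ce = (c, g us ` b)" "(c, b) \<in> kernel_graph vs K (chord_set R y)" by (auto simp: E_def)
        then consider i where "i < k" "c = long_arc vs K i" "b = cycle_edge ks i" | "c = False" "b \<in> chord_set R y"
          by (auto simp: kernel_graph_def ks_def k_def)
        then show ?thesis
        proof cases
          case 1
          then have "ce \<in> ?A" using b cyc by auto
          then show ?thesis using \<open>ce \<notin> ?A\<close> by blast
        next
          case 2
          then show ?thesis using b by auto
        qed
      qed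
      have "inj_on snd ?A"
        using cycle_edge_eq_iff[OF usl(2)] usl k96 by (auto simp: inj_on_def)
      then have "inj_on snd S" by (rule inj_on_subset) (auto simp: S_def)
      moreover have "inj_on snd (T - S)"
      proof (rule inj_onI)
        fix a b assume ab: "a \<in> T - S" "b \<in> T - S" "snd a = snd b"
        then have "fst a = False" "fst b = False" using chord by fastforce+
        then show "a = b" using ab by (simp add: prod_eq_iff)
      qed
      ultimately have "S \<in> ?D" by (auto simp: S_def)
      moreover have "snd ` S \<subseteq> cycle_set us" by (auto simp: S_def cycle_set_def usl)
      moreover have "inv (g us) ` snd ce \<in> chord_set R y" if ce: "ce \<in> T - S" for ce
      proof -
        obtain b where b: "ce = (False, g us ` b)" "b \<in> chord_set R y" using chord[OF ce] by blast
        then show ?thesis using inj by (simp add: image_comp comp_def)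
      qed
      ultimately show "\<omega> \<in> (\<Union>S\<in>?D. ?C S)" using e by blast
    qed
    have part: "real (card (?C S)) \<le> x ^ card T * real (card ?\<Omega>)" if S: "S \<in> ?D" for S
    proof -
      have finS: "finite S" "finite (T - S)" using S finT finite_subset by auto
      have cs: "card (snd ` S) = card S" "card (snd ` (T - S)) = card (T - S)" using S by (auto simp: card_image)
      let ?U = "{us \<in> ?P. snd ` S \<subseteq> cycle_set us}"
      have finU: "finite ?U" by simp
      have "card (?C S) = (\<Sum>us\<in>?U. card {y \<in> ?J. (\<lambda>e. inv (g us) ` e) ` snd ` (T - S) \<subseteq> chord_set R y})"
        using finJ by (intro card_SigmaI[OF finU]) auto
      then have "real (card (?C S)) = (\<Sum>us\<in>?U. real (card {y \<in> ?J. (\<lambda>e. inv (g us) ` e) ` snd ` (T - S) \<subseteq> chord_set R y}))"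
        by simp
      also have "\<dots> \<le> (\<Sum>us\<in>?U. x ^ card (T - S) * real (card ?J))"
      proof (rule sum_mono)
        fix us assume us: "us \<in> ?U"
        let ?T = "(\<lambda>e. inv (g us) ` e) ` snd ` (T - S)"
        have "bij (g us)" using g us permutes_bij by blast
        then have "inj (inv (g us))" by (simp add: bij_imp_bij_inv bij_is_inj)
        then have "inj_on (\<lambda>e. inv (g us) ` e) (snd ` (T - S))" by (auto simp: inj_on_def inj_image_eq_iff)
        then have cT: "card ?T = card (T - S)" using cs by (simp add: card_image)
        have "real (card {y \<in> ?J. ?T \<subseteq> chord_set R y}) \<le> (96 / card Q) ^ (card ?T - card ?T div 48) * real (card ?J)"
        proof (rule card_injections_containing_le[OF fin])
          show "finite ?T" using finS by simp
          show "Q \<noteq> {}" using r0 Q by auto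
        qed
        also have "\<dots> \<le> x ^ card ?T * real (card ?J)"
        proof (intro mult_right_mono pw)
          \<comment> \<open>The range has only \<open>r \<ge> k / 2\<close> elements, so a chord
            costs at most \<open>192 / k\<close>, which is below the cost \<open>1536 / k\<close> of
            a cycle edge.\<close>
          have "real k \<le> 2 * real ?r" using kr by linarith
          then have "96 * real k \<le> 1536 * real ?r" by simp
          then show "96 / real (card Q) \<le> 1536 / real k" using Q r0 k96 by (simp add: field_simps)
        qed auto
        finally show "real (card {y \<in> ?J. ?T \<subseteq> chord_set R y}) \<le> x ^ card (T - S) * real (card ?J)" by (simp only: cT)
      qed
      also have "\<dots> = real (card ?U) * (x ^ card (T - S) * real (card ?J))" by simp
      also have "\<dots> \<le> (x ^ card S * real (card ?P)) * (x ^ card (T - S) * real (card ?J))"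
      proof (intro mult_right_mono)
        have "real (card ?U) \<le> (1536 / real k) ^ (card (snd ` S) - card (snd ` S) div 48) * real (card ?P)"
          using k96 finS by (intro card_cycles_containing_le) (auto simp: k_def)
        also have "\<dots> \<le> x ^ card (snd ` S) * real (card ?P)" by (intro mult_right_mono pw) auto
        finally show "real (card ?U) \<le> x ^ card S * real (card ?P)" by (simp only: cs)
      qed (use x in auto)
      also have "\<dots> = x ^ (card S + card (T - S)) * real (card ?\<Omega>)" by (simp add: card_cartesian_product power_add)
      also have "card S + card (T - S) = card T" using S finT finS by (simp add: card_Diff_subset card_mono)
      finally show ?thesis .
    qed
    have finD: "finite ?D" using finT by simp
    have "card {\<omega> \<in> ?\<Omega>. T \<subseteq> E \<omega>} \<le> (\<Sum>S\<in>?D. card (?C S))"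
    proof (rule order_trans[OF card_mono card_UN_le[OF finD]])
      show "{\<omega> \<in> ?\<Omega>. T \<subseteq> E \<omega>} \<subseteq> (\<Union>S\<in>?D. ?C S)" by (rule sub)
      show "finite (\<Union>S\<in>?D. ?C S)" by (rule finite_subset[OF _ fin\<Omega>]) auto
    qed
    then have "real (card {\<omega> \<in> ?\<Omega>. T \<subseteq> E \<omega>}) \<le> real (\<Sum>S\<in>?D. card (?C S))" by (rule of_nat_mono)
    also have "\<dots> = (\<Sum>S\<in>?D. real (card (?C S)))" by simp
    also have "\<dots> \<le> (\<Sum>S\<in>?D. x ^ card T * real (card ?\<Omega>))" using part by (intro sum_mono) blast
    also have "\<dots> = real (card ?D) * (x ^ card T * real (card ?\<Omega>))" by simp
    also have "\<dots> \<le> 4 ^ card T * (x ^ card T * real (card ?\<Omega>))"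
    proof (intro mult_right_mono)
      have "card ?D \<le> card (Pow T)" using finT by (intro card_mono) auto
      also have "\<dots> = 2 ^ card T" using finT by (simp add: card_Pow)
      also have "\<dots> \<le> (4 :: nat) ^ card T" by (intro power_mono) auto
      finally show "real (card ?D) \<le> 4 ^ card T"
        using of_nat_mono[of "card ?D" "4 ^ card T", where ?'a = real] by (simp only: of_nat_power of_nat_numeral)
    qed (use x in auto)
    also have "\<dots> = (4 * x) ^ card T * real (card ?\<Omega>)" by (simp only: power_mult_distrib[of 4 x] mult.assoc)
    also have "\<dots> \<le> (real (card K) powr (-23/24)) ^ card T * real (card ?\<Omega>)"
      using fp(1) x by (intro mult_right_mono power_mono) (auto simp: x_def k_def)
    finally show "real (card {\<omega> \<in> ?\<Omega>. T \<subseteq> E \<omega>}) \<le> (real (card K) powr (-23/24)) ^ card T * real (card ?\<Omega>)" .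
  qed
  \<comment> \<open>Symmetry does not depend on the relabelling: a bad injection is bad together
    with every \<open>us\<close>. Therefore the factor \<open>card ?P\<close> cancels in the
    end.\<close>
  moreover have "?P \<times> ?Y \<subseteq> ?Bad"
  proof
    fix \<omega> assume "\<omega> \<in> ?P \<times> ?Y"
    then obtain us y where e: "\<omega> = (us, y)" "us \<in> ?P" "y \<in> ?Y" by auto
    have yQ: "y ` R = Q"
    proof (rule card_subset_eq[OF fin(2)])
      show "y ` R \<subseteq> Q" "card (y ` R) = card Q" using e Q by (auto simp: injections_def card_image)
    qed
    interpret chorded_cycle vs R y
      using dist len R Q e(3) yQ k96 by unfold_locales (auto simp: K_def k_def)
    have K_eq: "chorded_cycle.K R y = K" using yQ by (simp add: K_def K_union)
    have pairs: "kernel_graph vs K (chord_set R y) \<subseteq> coloured_pairs K"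
    proof
      fix ce assume ce: "ce \<in> kernel_graph vs K (chord_set R y)"
      obtain c f where cf: "ce = (c, f)" by (cases ce)
      have "f \<in> links \<or> f \<in> G \<and> f \<subseteq> K"
        using ce kernel_eq unfolding K_eq cf by (auto split: if_splits)
      then have "f \<subseteq> K \<and> card f = 2"
        unfolding links_def K_eq using G_pair by auto
      then show "ce \<in> coloured_pairs K" by (simp add: coloured_pairs_def cf)
    qed
    have Ew: "E \<omega> = (\<lambda>(c, f). (c, g us ` f)) ` kernel_graph vs K (chord_set R y)"
      using pairs by (simp add: E_def e(1) Int_absorb2)
    have "\<not> asymmetric V G" using e(3) by (simp add: V_def G_def)
    then obtain \<pi> where \<pi>: "\<pi> \<in> automorphisms V G" "\<pi> \<noteq> id" by (rule not_asymmetric_automorphism)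
    note ca = coloured_auto_kernel[OF \<pi>(1), unfolded K_eq] and nt = pi_kernel_nontrivial[OF \<pi>]
    note rel = relabel_coloured_graph[OF conjunct1[OF g[OF e(2)]] pairs finite_union]
    have "\<forall>v\<in>K. 3 \<le> card {ce \<in> kernel_graph vs K (chord_set R y). v \<in> snd ce}"
      using kernel_degree unfolding K_eq by blast
    then have "\<forall>v\<in>K. 3 \<le> card {ce \<in> E \<omega>. v \<in> snd ce}" unfolding Ew using rel(2) by blast
    moreover have "\<exists>\<pi>'. coloured_auto K (E \<omega>) \<pi>' \<and> \<pi>' \<noteq> id" unfolding Ew using rel(3)[OF ca nt] .
    ultimately show "\<omega> \<in> ?Bad" using e by auto
  qed
  then have "card (?P \<times> ?Y) \<le> card ?Bad" using fin\<Omega> by (intro card_mono) auto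
  ultimately have "real (card ?P) * real (card ?Y) \<le> 16 * exp 10 * real k powr (-1/4) * (real (card ?P) * real (card ?J))"
    by (simp add: card_cartesian_product k_def of_nat_mult[symmetric] del: of_nat_mult)
  also have "\<dots> = real (card ?P) * (16 * exp 10 * real k powr (-1/4) * real (card ?J))" by simp
  finally have "real (card ?Y) \<le> 16 * exp 10 * real k powr (-1/4) * real (card ?J)"
    using finK by (simp add: card_permutations_of_set)
  also have "\<dots> \<le> 16 * exp 10 * real ?r powr (-1/4) * real (card ?J)"
  proof (intro mult_right_mono mult_left_mono)
    show "real k powr (-1/4) \<le> real ?r powr (-1/4)" using kr r0 by (intro powr_mono2') auto
  qed auto
  finally show ?thesis .
qed

text \<open>The injections split into disjoint classes by their range \<open>Q\<close>, and the
  bound for each fixed range has the same constant.\<close>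

lemma card_injections_symmetric_le:
  fixes vs :: "'a list"
  assumes dist: "distinct vs" and len: "3 \<le> length vs" and R: "R \<subseteq> set vs"
    and big: "real (card R) \<ge> (4 * 1536) ^ 48"
  shows "real (card {y \<in> injections R (set vs). (\<forall>x\<in>R. y x \<noteq> x) \<and> chord_set R y \<inter> cycle_set vs = {} \<and>
             \<not> asymmetric (set vs) (cycle_set vs \<union> chord_set R y)})
     \<le> 16 * exp 10 * real (card R) powr (-1/4) * real (card (injections R (set vs)))"
proof -
  let ?c = "16 * exp 10 * real (card R) powr (-1/4)"
  let ?V = "set vs"
  let ?P = "\<lambda>y. (\<forall>x\<in>R. y x \<noteq> x) \<and> chord_set R y \<inter> cycle_set vs = {} \<and> \<not> asymmetric ?V (cycle_set vs \<union> chord_set R y)"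
  let ?Q = "{Q. Q \<subseteq> ?V \<and> card Q = card R}"
  have finR: "finite R" using R finite_subset by blast
  have finQ: "finite ?Q" by simp
  have finV: "finite Q" if "Q \<in> ?Q" for Q using that finite_subset by auto
  have inj: "injections R ?V = (\<Union>Q\<in>?Q. injections R Q)"
  proof (intro equalityI subsetI)
    fix y assume y: "y \<in> injections R ?V"
    then have "y \<in> injections R (y ` R)" by (auto simp: injections_def PiE_iff)
    moreover have "y ` R \<in> ?Q" using y by (auto simp: injections_def card_image)
    ultimately show "y \<in> (\<Union>Q\<in>?Q. injections R Q)" by blast
  qed (auto simp: injections_def)
  have disj: "injections R Q \<inter> injections R Q' = {}" if "Q \<in> ?Q" "Q' \<in> ?Q" "Q \<noteq> Q'" for Q Q'
  proof -
    have range: "y ` R = Q" if "Q \<in> ?Q" "y \<in> injections R Q" for Q y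
    proof (rule card_subset_eq[OF finV[OF that(1)]])
      show "y ` R \<subseteq> Q" using that(2) by (auto simp: injections_def)
      show "card (y ` R) = card Q" using that by (simp add: injections_def card_image)
    qed
    show ?thesis
    proof (rule ccontr)
      assume "injections R Q \<inter> injections R Q' \<noteq> {}"
      then obtain y where "y \<in> injections R Q" "y \<in> injections R Q'" by blast
      then show False using range[OF \<open>Q \<in> ?Q\<close>, of y] range[OF \<open>Q' \<in> ?Q\<close>, of y] \<open>Q \<noteq> Q'\<close> by simp
    qed
  qed
  have eq: "{y \<in> injections R ?V. ?P y} = (\<Union>Q\<in>?Q. {y \<in> injections R Q. ?P y})"
  proof -
    have "{y \<in> (\<Union>Q\<in>A. f Q). S y} = (\<Union>Q\<in>A. {y \<in> f Q. S y})" for A and f :: "'a set \<Rightarrow> ('a \<Rightarrow> 'a) set" and S by blast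
    then show ?thesis unfolding inj .
  qed
  have "card {y \<in> injections R ?V. ?P y} \<le> (\<Sum>Q\<in>?Q. card {y \<in> injections R Q. ?P y})"
    unfolding eq by (rule card_UN_le[OF finQ])
  then have "real (card {y \<in> injections R ?V. ?P y}) \<le> real (\<Sum>Q\<in>?Q. card {y \<in> injections R Q. ?P y})"
    by (rule of_nat_mono)
  also have "\<dots> = (\<Sum>Q\<in>?Q. real (card {y \<in> injections R Q. ?P y}))" by simp
  also have "\<dots> \<le> (\<Sum>Q\<in>?Q. ?c * real (card (injections R Q)))"
    using card_injections_symmetric_fixed_range[OF dist len R _ _ big] by (intro sum_mono) blast
  also have "\<dots> = ?c * real (\<Sum>Q\<in>?Q. card (injections R Q))" by (simp add: sum_distrib_left)
  also have "(\<Sum>Q\<in>?Q. card (injections R Q)) = card (injections R ?V)"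
    unfolding inj using finQ finR finV disj finite_injections by (intro card_UN_disjoint[symmetric]) blast+
  finally show ?thesis .
qed

section \<open>Chorded cycles with few chords\<close>

text \<open>An integer, so that rotations and reflections of the cycle become congruences modulo its
  length.\<close>

definition list_pos :: "'a list \<Rightarrow> 'a \<Rightarrow> int" where
  "list_pos vs v = int (THE i. i < length vs \<and> vs ! i = v)"

lemma list_pos_nth: "distinct vs \<Longrightarrow> i < length vs \<Longrightarrow> list_pos vs (vs ! i) = int i"
  unfolding list_pos_def by (subst the_equality[of _ i]) (auto simp: nth_eq_iff_index_eq)

lemma list_pos_range:
  assumes "distinct vs" "v \<in> set vs"
  shows "0 \<le> list_pos vs v" "list_pos vs v < int (length vs)"
proof -
  obtain i where i: "i < length vs" "v = vs ! i" using assms by (auto simp: in_set_conv_nth)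
  then show "0 \<le> list_pos vs v" "list_pos vs v < int (length vs)"
    using list_pos_nth[OF assms(1) i(1)] by simp_all
qed

lemma list_pos_inj:
  assumes "distinct vs" "u \<in> set vs" "v \<in> set vs" "list_pos vs u = list_pos vs v"
  shows "u = v"
proof -
  obtain i where i: "i < length vs" "u = vs ! i" using assms by (auto simp: in_set_conv_nth)
  obtain j where j: "j < length vs" "v = vs ! j" using assms by (auto simp: in_set_conv_nth)
  show ?thesis using assms(4) i j list_pos_nth[OF assms(1) i(1)] list_pos_nth[OF assms(1) j(1)] by simp
qed

lemma dvd_range_eq:
  fixes a b N :: int
  assumes "N dvd a - b" "0 \<le> a" "a < N" "0 \<le> b" "b < N"
  shows "a = b"
proof -
  have "a - b = 0" using assms dvd_imp_le_int[of "a - b" N] by (cases "a - b = 0") auto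
  then show ?thesis by simp
qed

lemma Suc_mod_dvd: "int n dvd int (Suc a mod n) - (int a + 1)"
proof -
  have "int (Suc a mod n) = (int a + 1) mod int n" by (simp add: of_nat_mod add.commute)
  then show ?thesis by (simp add: mod_eq_dvd_iff[symmetric])
qed

context chorded_cycle
begin

abbreviation "X \<equiv> list_pos vs"
abbreviation "N \<equiv> int n"

lemma X_nth: "i < n \<Longrightarrow> X (vs ! i) = int i" using list_pos_nth dist by (simp add: n_def)

lemma X_range: "v \<in> V \<Longrightarrow> 0 \<le> X v \<and> X v < N" using list_pos_range[OF dist] by (simp add: V_def n_def)

lemma X_eq: "u \<in> V \<Longrightarrow> v \<in> V \<Longrightarrow> N dvd X u - X v \<Longrightarrow> u = v"
  using dvd_range_eq[of N "X u" "X v"] X_range list_pos_inj[OF dist] by (simp add: V_def)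

text \<open>Along the cycle the position of the image changes by \<open>1\<close> or
  \<open>-1\<close> at each step. The sign never switches, because then \<open>\<pi>\<close> would
  take equal values two steps apart; so the image position is an affine function with slope
  \<open>\<epsilon>\<close>.\<close>

lemma cycle_automorphism_dihedral:
  assumes \<pi>: "\<pi> permutes V" and cyc: "\<And>j. j < n \<Longrightarrow> {\<pi> (vs ! j), \<pi> (vs ! (Suc j mod n))} \<in> cycle_set vs"
  shows "\<exists>c \<epsilon>. \<epsilon> \<in> {1, -1 :: int} \<and> (\<forall>v\<in>V. N dvd X (\<pi> v) - (c + \<epsilon> * X v))"
proof -
  define q where "q = (\<lambda>t. X (\<pi> (vs ! (t mod n))))"
  have tn: "t mod n < n" for t using n0 by simp
  have pV: "\<pi> (vs ! (t mod n)) \<in> V" for t using permutes_in_image[OF \<pi>] nth_V tn by blast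
  have step: "N dvd q (Suc t) - q t - 1 \<or> N dvd q (Suc t) - q t + 1" for t
  proof -
    define j where "j = t mod n"
    have j: "j < n" "Suc t mod n = Suc j mod n" using tn by (auto simp: j_def mod_Suc_eq)
    obtain a where a: "a < n" "\<pi> (vs ! j) = vs ! a" using pos pV[of t] by (auto simp: j_def)
    obtain b where b: "b < n" "\<pi> (vs ! (Suc j mod n)) = vs ! b" using pos pV[of "Suc t"] by (auto simp: j)
    have "b = Suc a mod n \<or> a = Suc b mod n" using cyc[OF j(1)] cycle_adjacent[of a b] a b by simp
    moreover have q: "q t = int a" "q (Suc t) = int b" using a b X_nth j by (auto simp: q_def j_def)
    ultimately show ?thesis
    proof (elim disjE)
      assume "b = Suc a mod n"
      then have "N dvd int b - (int a + 1)" using Suc_mod_dvd[of n a] by simp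
      then show ?thesis using q by (simp add: algebra_simps)
    next
      assume "a = Suc b mod n"
      then have "N dvd int a - (int b + 1)" using Suc_mod_dvd[of n b] by simp
      then have "N dvd - (int a - (int b + 1))" by (simp only: dvd_minus_iff)
      then show ?thesis using q by (simp add: algebra_simps)
    qed
  qed
  \<comment> \<open>Positions two apart are distinct modulo \<open>n\<close> because
    \<open>n \<ge> 3\<close>.\<close>
  have no_return: "\<not> N dvd q (Suc (Suc t)) - q t" for t
  proof
    assume "N dvd q (Suc (Suc t)) - q t"
    then have "\<pi> (vs ! (Suc (Suc t) mod n)) = \<pi> (vs ! (t mod n))" unfolding q_def using X_eq pV by blast
    then have "vs ! (Suc (Suc t) mod n) = vs ! (t mod n)" using permutes_inj[OF \<pi>] by (auto dest: injD)
    then have "Suc (Suc t) mod n = t mod n" using nth_inj tn by blast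
    then have "n dvd Suc (Suc t) - t" by (subst mod_eq_dvd_iff_nat[symmetric]) auto
    then have "n dvd 2" by simp
    then show False using n3 dvd_imp_le[of n 2] by simp
  qed
  obtain \<epsilon> where \<epsilon>: "\<epsilon> \<in> {1, -1 :: int}" "N dvd q (Suc 0) - q 0 - \<epsilon>" 
  proof (cases "N dvd q (Suc 0) - q 0 - 1")
    case True
    then show ?thesis using that[of 1] by simp
  next
    case False
    then have "N dvd q (Suc 0) - q 0 - (-1)" using step[of 0] by simp
    then show ?thesis using that[of "-1"] by simp
  qed
  have all: "N dvd q (Suc t) - q t - \<epsilon>" for t
  proof (induction t)
    case 0
    then show ?case by (rule \<epsilon>(2))
  next
    case (Suc t)
    from step[of "Suc t"] consider "N dvd q (Suc (Suc t)) - q (Suc t) - \<epsilon>" | "N dvd q (Suc (Suc t)) - q (Suc t) + \<epsilon>"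
      using \<epsilon>(1) by auto
    then show ?case
    proof cases
      case 2
      then have "N dvd (q (Suc (Suc t)) - q (Suc t) + \<epsilon>) + (q (Suc t) - q t - \<epsilon>)" using Suc by (rule dvd_add)
      then show ?thesis using no_return[of t] by simp
    qed
  qed
  have lin: "N dvd q t - (q 0 + \<epsilon> * int t)" for t
  proof (induction t)
    case (Suc t)
    have "N dvd (q t - (q 0 + \<epsilon> * int t)) + (q (Suc t) - q t - \<epsilon>)" using Suc all by (rule dvd_add)
    moreover have "(q t - (q 0 + \<epsilon> * int t)) + (q (Suc t) - q t - \<epsilon>) = q (Suc t) - (q 0 + \<epsilon> * int (Suc t))"
      by (simp add: algebra_simps)
    ultimately show ?case by simp
  qed simp
  have "N dvd X (\<pi> v) - (q 0 + \<epsilon> * X v)" if v: "v \<in> V" for v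
  proof -
    obtain i where i: "i < n" "v = vs ! i" using pos v by blast
    then show ?thesis using lin[of i] X_nth by (simp add: q_def)
  qed
  then show ?thesis using \<epsilon>(1) by blast
qed

text \<open>Marked vertices are never adjacent on the cycle, so every cycle edge has an unmarked end
  and its image is again a cycle edge: the automorphism is dihedral. The differences along chords
  are distinct up to sign, so each chord is mapped to itself. Apart from the identity, fixing or
  exchanging its ends makes twice its difference vanish, which \<open>half\<close> excludes, unless
  a reflection exchanges the ends. Then the end positions of every chord have the same sum
  \<open>c\<close>, and two chords contradict the last part of \<open>gen\<close>.\<close>

lemma generic_asymmetric:
  assumes nonadj: "\<And>a. a \<in> KP \<Longrightarrow> Suc a mod n \<notin> KP"
    and gen: "\<And>x x'. x \<in> R \<Longrightarrow> x' \<in> R \<Longrightarrow> x \<noteq> x' \<Longrightarrow>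
        \<not> N dvd (X (y x') - X x') - (X (y x) - X x) \<and> \<not> N dvd (X (y x') - X x') + (X (y x) - X x) \<and>
        \<not> N dvd (X (y x') + X x') - (X (y x) + X x)"
    and half: "\<And>x. x \<in> R \<Longrightarrow> \<not> N dvd 2 * (X (y x) - X x)"
    and two: "x1 \<in> R" "x2 \<in> R" "x1 \<noteq> x2"
  shows "asymmetric V G"
proof (rule ccontr)
  assume "\<not> asymmetric V G"
  then obtain \<pi> where \<pi>: "\<pi> \<in> automorphisms V G" "\<pi> \<noteq> id" by (rule not_asymmetric_automorphism)
  note perm = perm[OF \<pi>(1)] and inj = inj_pi[OF \<pi>(1)] and pV = pi_V[OF \<pi>(1)] and pe = pi_edge[OF \<pi>(1)] and pK = pi_K[OF \<pi>(1)]
  have cyc: "{\<pi> (vs ! j), \<pi> (vs ! (Suc j mod n))} \<in> cycle_set vs" if j: "j < n" for j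
  proof -
    have "{vs ! j, vs ! (Suc j mod n)} \<in> G" using cycle_step[OF j] by (simp add: G_def)
    then have "{\<pi> (vs ! j), \<pi> (vs ! (Suc j mod n))} \<in> G" using pe nth_V j Suc_mod_less by blast
    moreover have "\<not> {\<pi> (vs ! j), \<pi> (vs ! (Suc j mod n))} \<subseteq> K"
      using nonadj[of j] KP_iff j Suc_mod_less pK nth_V by blast
    ultimately show ?thesis by (rule unmarked_edge)
  qed
  obtain c \<epsilon> where \<epsilon>: "\<epsilon> \<in> {1, -1 :: int}" and dih: "\<And>v. v \<in> V \<Longrightarrow> N dvd X (\<pi> v) - (c + \<epsilon> * X v)"
    using cycle_automorphism_dihedral[OF perm cyc] by blast
  have RV: "x \<in> V \<and> y x \<in> V \<and> x \<in> K \<and> y x \<in> K" if "x \<in> R" for x using that KV by (auto simp: K_def)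
  have fixed: "(\<pi> x = x \<and> \<pi> (y x) = y x) \<or> (\<pi> x = y x \<and> \<pi> (y x) = x)" if x: "x \<in> R" for x
  proof -
    note xV = RV[OF x]
    have "{x, y x} \<in> G" using x by (auto simp: G_def chord_set_def)
    then have pG: "{\<pi> x, \<pi> (y x)} \<in> G" using pe xV by blast
    have pin: "\<pi> x \<in> K" "\<pi> (y x) \<in> K" using pK xV by blast+
    have "{\<pi> x, \<pi> (y x)} \<notin> cycle_set vs"
    proof
      assume "{\<pi> x, \<pi> (y x)} \<in> cycle_set vs"
      then obtain j where j: "j < n" "{\<pi> x, \<pi> (y x)} = {vs ! j, vs ! (Suc j mod n)}"
        by (auto simp: cycle_set_def cycle_edge_def n_def)
      then have "vs ! j \<in> K" "vs ! (Suc j mod n) \<in> K" using pin by (auto simp: doubleton_eq_iff)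
      then show False using nonadj[of j] KP_iff j Suc_mod_less by blast
    qed
    then have "{\<pi> x, \<pi> (y x)} \<in> chord_set R y" using pG by (simp add: G_def)
    then obtain x' where x': "x' \<in> R" "{\<pi> x, \<pi> (y x)} = {x', y x'}" by (auto simp: chord_set_def)
    note d1 = dih[of x] and d2 = dih[of "y x"]
    have diff: "N dvd (X (\<pi> (y x)) - (c + \<epsilon> * X (y x))) - (X (\<pi> x) - (c + \<epsilon> * X x))"
      using d1 d2 xV by (simp only: dvd_diff)
    have "x' = x"
    proof (rule ccontr)
      assume ne: "x' \<noteq> x"
      have g: "\<not> N dvd (X (y x') - X x') - (X (y x) - X x)" "\<not> N dvd (X (y x') - X x') + (X (y x) - X x)"
        using gen[OF x x'(1)] ne by auto
      have g': "\<not> N dvd - ((X (y x') - X x') - (X (y x) - X x))" "\<not> N dvd - ((X (y x') - X x') + (X (y x) - X x))"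
        using g by (simp_all only: dvd_minus_iff) auto
      have "\<pi> x = x' \<and> \<pi> (y x) = y x' \<or> \<pi> x = y x' \<and> \<pi> (y x) = x'" using x'(2) by (auto simp: doubleton_eq_iff)
      then show False using diff g g' \<epsilon> by (auto simp: algebra_simps)
    qed
    then show ?thesis using x'(2) by (auto simp: doubleton_eq_iff)
  qed
  have notid: "\<not> (\<epsilon> = 1 \<and> N dvd c)"
  proof
    assume a: "\<epsilon> = 1 \<and> N dvd c"
    have "\<pi> v = v" for v
    proof (cases "v \<in> V")
      case True
      have "N dvd (X (\<pi> v) - (c + \<epsilon> * X v)) + c" using dih[OF True] a by (intro dvd_add) auto
      then have "N dvd X (\<pi> v) - X v" using a by (simp add: algebra_simps)
      then show ?thesis using X_eq pV True by blast
    qed (use perm in \<open>auto simp: permutes_def\<close>)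
    then show False using \<pi>(2) by auto
  qed
  have swap: "N dvd (X (y x) + X x) - c" if x: "x \<in> R" for x
  proof -
    note xV = RV[OF x]
    have d1: "N dvd X (\<pi> x) - (c + \<epsilon> * X x)" and d2: "N dvd X (\<pi> (y x)) - (c + \<epsilon> * X (y x))"
      using dih xV by auto
    have h: "\<not> N dvd 2 * (X (y x) - X x)" using half[OF x] .
    have dd: "N dvd (X (\<pi> (y x)) - (c + \<epsilon> * X (y x))) - (X (\<pi> x) - (c + \<epsilon> * X x))"
      using d1 d2 by (rule dvd_diff[rotated])
    have h': "\<not> N dvd - (2 * (X (y x) - X x))" using h by (simp only: dvd_minus_iff) simp
    from fixed[OF x] \<epsilon> consider
        "\<pi> x = x" "\<pi> (y x) = y x" "\<epsilon> = 1" | "\<pi> x = x" "\<pi> (y x) = y x" "\<epsilon> = -1"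
      | "\<pi> x = y x" "\<pi> (y x) = x" "\<epsilon> = 1" | "\<pi> x = y x" "\<pi> (y x) = x" "\<epsilon> = -1" by auto
    then show ?thesis
    proof cases
      case 1
      then have "N dvd - c" using d1 by simp
      then show ?thesis using notid 1 by simp
    next
      case 2
      then have "N dvd 2 * (X (y x) - X x)" using dd by (simp add: algebra_simps)
      then show ?thesis using h by blast
    next
      case 3
      then have "N dvd - (2 * (X (y x) - X x))" using dd by (simp add: algebra_simps)
      then show ?thesis using h' by blast
    next
      case 4
      then show ?thesis using d1 by (simp add: algebra_simps)
    qed
  qed
  have "N dvd ((X (y x2) + X x2) - c) - ((X (y x1) + X x1) - c)" using swap[OF two(2)] swap[OF two(1)] by (rule dvd_diff)
  then show False using gen[of x1 x2] two by (simp add: algebra_simps)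
qed

end

section \<open>Coincidences among few chords\<close>

lemma card_list_pos_dvd_le:
  assumes "distinct vs"
  shows "card {v \<in> set vs. int (length vs) dvd list_pos vs v - c} \<le> 1"
proof -
  let ?N = "int (length vs)"
  have "u = v" if "u \<in> {v \<in> set vs. ?N dvd list_pos vs v - c}" "v \<in> {v \<in> set vs. ?N dvd list_pos vs v - c}" for u v
  proof -
    have "?N dvd (list_pos vs u - c) - (list_pos vs v - c)" by (rule dvd_diff) (use that in auto)
    then have "list_pos vs u = list_pos vs v"
      using that list_pos_range[OF assms] by (intro dvd_range_eq[of ?N]) auto
    then show ?thesis using that list_pos_inj[OF assms] by auto
  qed
  then show ?thesis by (auto simp: card_le_Suc0_iff_eq)
qed

lemma card_injections_value_le:
  fixes R V :: "'a set"
  assumes "finite R" "finite V" "V \<noteq> {}" "x \<in> R"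
  shows "real (card {y \<in> injections R V. y x = v}) \<le> 96 / card V * real (card (injections R V))"
proof -
  have "real (card {y \<in> injections R V. y x = v}) \<le> real (card {y \<in> injections R V. {{x, v}} \<subseteq> chord_set R y})"
    using assms finite_injections[OF assms(1,2)] by (intro of_nat_mono card_mono) (auto simp: chord_set_def)
  also have "\<dots> \<le> (96 / card V) ^ (card {{x, v}} - card {{x, v}} div 48) * real (card (injections R V))"
    using assms by (intro card_injections_containing_le) auto
  finally show ?thesis by simp
qed

text \<open>The condition \<open>v \<notin> R\<close> makes the two prescribed chords distinct:
  otherwise \<open>v\<close> would have to equal the source \<open>x'\<close>.\<close>

lemma card_injections_two_values_le:
  fixes R V :: "'a set"
  assumes "finite R" "finite V" "V \<noteq> {}" "x \<in> R" "x' \<in> R" "x \<noteq> x'" "v \<notin> R"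
  shows "real (card {y \<in> injections R V. y x = v \<and> y x' = v'}) \<le> (96 / card V)\<^sup>2 * real (card (injections R V))"
proof -
  let ?T = "{{x, v}, {x', v'}}"
  have "{x, v} \<noteq> {x', v'}" using assms by (auto simp: doubleton_eq_iff)
  then have c: "card ?T = 2" by simp
  have "real (card {y \<in> injections R V. y x = v \<and> y x' = v'}) \<le> real (card {y \<in> injections R V. ?T \<subseteq> chord_set R y})"
    using assms finite_injections[OF assms(1,2)] by (intro of_nat_mono card_mono) (auto simp: chord_set_def)
  also have "\<dots> \<le> (96 / card V) ^ (card ?T - card ?T div 48) * real (card (injections R V))"
    using assms by (intro card_injections_containing_le) auto
  finally show ?thesis unfolding c by simp
qed

text \<open>A union bound over the ways to violate genericity. At most \<open>6 * r\<close> values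
  are bad for a single source, each with probability at most \<open>96 / n\<close>; for two sources,
  \<open>5\<close> second values are bad for each of at most \<open>n\<close> first ones, each pair
  with probability at most \<open>(96 / n)\<^sup>2\<close>. This gives
  \<open>576 + 46080 = 46656\<close> times \<open>r\<^sup>2 / n\<close>.\<close>

lemma card_few_chords_symmetric_le:
  fixes vs :: "'a list"
  assumes dist: "distinct vs" and len: "3 \<le> length vs" and R: "R \<subseteq> set vs" and R2: "2 \<le> card R"
    and sel: "\<And>a. a \<in> marked_positions vs R \<Longrightarrow> Suc a mod length vs \<notin> marked_positions vs R"
  defines "n \<equiv> length vs"
  shows "real (card {y \<in> injections R (set vs). (\<forall>x\<in>R. y x \<noteq> x) \<and> chord_set R y \<inter> cycle_set vs = {} \<and>
             \<not> asymmetric (set vs) (cycle_set vs \<union> chord_set R y)})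
     \<le> 50000 * (real (card R))\<^sup>2 / n * real (card (injections R (set vs)))"
    (is "real (card ?Y) \<le> _")
proof -
  let ?V = "set vs"
  let ?I = "injections R ?V"
  let ?X = "list_pos vs"
  let ?N = "int n"
  let ?r = "card R"
  have finR: "finite R" using R finite_subset by blast
  have finI: "finite ?I" using finR finite_injections by blast
  note n_len = n_def
  have n0: "n > 0" unfolding n_def using len by linarith
  have V: "finite ?V" "card ?V = n" using dist by (auto simp: n_def distinct_card)
  moreover from this have "?V \<noteq> {}" using n0 by (metis card.empty less_irrefl)
  ultimately have V: "finite ?V" "?V \<noteq> {}" "card ?V = n" by blast+
  define D where "D = (\<lambda>c. {v \<in> ?V. ?N dvd ?X v - c})"
  have D: "finite (D c)" "card (D c) \<le> 1" for c
    using card_list_pos_dvd_le[OF dist, of c] by (auto simp: D_def n_def)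
  \<comment> \<open>Values that are a source or adjacent to one on the cycle. Avoiding them also
    makes sources and targets disjoint, as the bound for two values requires.\<close>
  define S1 where "S1 = (\<Union>z\<in>R. D (?X z) \<union> D (?X z + 1) \<union> D (?X z - 1))"
  define S2 where "S2 = (\<lambda>x. {v \<in> ?V. ?N dvd 2 * (?X v - ?X x)})"
  \<comment> \<open>With \<open>v\<close> as the value at \<open>x\<close>, these are the values at
    \<open>x'\<close> that are adjacent to \<open>v\<close>, or for which the two chords have equal
    differences, opposite differences or equal sums.\<close>
  define S3 where "S3 = (\<lambda>x x' v. D (?X v + 1) \<union> D (?X v - 1) \<union> D (?X x' + (?X v - ?X x)) \<union> D (?X x' - (?X v - ?X x)) \<union> D (?X v + ?X x - ?X x'))"
  have cU: "card (A \<union> B) \<le> a + b" if "card A \<le> a" "card B \<le> b" for A B :: "'a set" and a b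
    using that card_Un_le[of A B] by linarith
  have S1: "finite S1" "card S1 \<le> 3 * ?r"
  proof -
    show "finite S1" using finR D by (simp add: S1_def)
    have "card S1 \<le> (\<Sum>z\<in>R. card (D (?X z) \<union> D (?X z + 1) \<union> D (?X z - 1)))" unfolding S1_def using finR by (rule card_UN_le)
    also have "\<dots> \<le> (\<Sum>z\<in>R. 1 + 1 + 1)" using D by (intro sum_mono cU) auto
    finally show "card S1 \<le> 3 * ?r" by simp
  qed
  have S2: "finite (S2 x)" "card (S2 x) \<le> 3" if x: "x \<in> R" for x
  proof -
    show "finite (S2 x)" by (simp add: S2_def)
    have "S2 x \<subseteq> D (?X x) \<union> D (?X x + ?N div 2) \<union> D (?X x - ?N div 2)"
    proof
      fix v assume v: "v \<in> S2 x"
      then have vV: "v \<in> ?V" and "?N dvd 2 * (?X v - ?X x)" by (auto simp: S2_def)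
      \<comment> \<open>Positions differ by less than \<open>n\<close>, so twice the difference is
        \<open>-n\<close>, \<open>0\<close> or \<open>n\<close>: the value is the source itself or
        lies opposite to it.\<close>
      then obtain k where k: "2 * (?X v - ?X x) = ?N * k" by blast
      have rv: "0 \<le> ?X v" "?X v < ?N" "0 \<le> ?X x" "?X x < ?N"
        using list_pos_range[OF dist] vV R x by (auto simp: n_def)
      have lt: "?N * k < ?N * 2" unfolding k[symmetric] using rv by simp
      have gt: "?N * (-2) < ?N * k" unfolding k[symmetric] using rv by simp
      have "0 < ?N" using n0 by simp
      then have "k < 2" "-2 < k" using mult_less_cancel_left_pos lt gt by blast+
      then have "k = -1 \<or> k = 0 \<or> k = 1" by linarith
      then have "?X v - ?X x = 0 \<or> ?X v - ?X x = ?N div 2 \<or> ?X v - ?X x = - (?N div 2)" using k by auto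
      then have "?X v - ?X x = 0 \<or> ?X v - (?X x + ?N div 2) = 0 \<or> ?X v - (?X x - ?N div 2) = 0" by linarith
      then show "v \<in> D (?X x) \<union> D (?X x + ?N div 2) \<union> D (?X x - ?N div 2)"
        unfolding D_def using vV dvd_0_right[of ?N] by auto
    qed
    then have "card (S2 x) \<le> card (D (?X x) \<union> D (?X x + ?N div 2) \<union> D (?X x - ?N div 2))" using D by (intro card_mono) auto
    also have "\<dots> \<le> 1 + 1 + 1" by (intro cU D)
    finally show "card (S2 x) \<le> 3" by simp
  qed
  have S3: "finite (S3 x x' v)" "card (S3 x x' v) \<le> 5" for x x' v
  proof -
    show "finite (S3 x x' v)" using D by (simp add: S3_def)
    have "card (S3 x x' v) \<le> 1 + 1 + 1 + 1 + 1" unfolding S3_def by (intro cU D)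
    then show "card (S3 x x' v) \<le> 5" by simp
  qed
  let ?A = "\<Union>x\<in>R. \<Union>v\<in>S1 \<union> S2 x. {y \<in> ?I. y x = v}"
  let ?B = "\<Union>x\<in>R. \<Union>x'\<in>R - {x}. \<Union>v\<in>?V - R. \<Union>v'\<in>S3 x x' v. {y \<in> ?I. y x = v \<and> y x' = v'}"
  have sub: "?Y \<subseteq> ?A \<union> ?B"
  proof (rule subsetI, rule ccontr)
    fix y assume y: "y \<in> ?Y" and nAB: "y \<notin> ?A \<union> ?B"
    have yI: "y \<in> ?I" using y by simp
    have yV: "y x \<in> ?V" if "x \<in> R" for x using yI that by (auto simp: injections_def)
    have a1: "y x \<notin> S1" and a2: "y x \<notin> S2 x" if "x \<in> R" for x using nAB that yI by auto
    have DI: "v \<in> D (?X v)" if "v \<in> ?V" for v using that by (simp add: D_def)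
    have yR: "y x \<notin> R" if "x \<in> R" for x
      using a1[OF that] DI[OF yV[OF that]] by (auto simp: S1_def)
    have a3: "y x' \<notin> S3 x x' (y x)" if "x \<in> R" "x' \<in> R" "x \<noteq> x'" for x x'
    proof
      assume "y x' \<in> S3 x x' (y x)"
      then have "y \<in> ?B" using that yI yV yR by blast
      then show False using nAB by blast
    qed
    have cK: "card (R \<union> y ` R) = 2 * ?r"
    proof -
      have "inj_on y R" using yI by (simp add: injections_def)
      then have "card (y ` R) = ?r" by (rule card_image)
      moreover have "card (R \<union> y ` R) = card R + card (y ` R)" using finR yR by (intro card_Un_disjoint) auto
      ultimately show ?thesis by simp
    qed
    interpret chorded_cycle vs R y
      using dist len R yV y cK R2 by unfold_locales auto
    have nn: "chorded_cycle.n vs = n" by (simp add: n_def n_len)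
    have "asymmetric V G"
    proof -
      obtain x1 x2 where two: "x1 \<in> R" "x2 \<in> R" "x1 \<noteq> x2"
        using R2 finR by (metis One_nat_def Suc_1 Suc_le_lessD card_le_Suc0_iff_eq not_le)
      show ?thesis
      proof (rule generic_asymmetric[OF _ _ _ two])
        fix x x' assume x: "x \<in> R" "x' \<in> R" "x \<noteq> x'"
        show "\<not> int (chorded_cycle.n vs) dvd (?X (y x') - ?X x') - (?X (y x) - ?X x) \<and> \<not> int (chorded_cycle.n vs) dvd (?X (y x') - ?X x') + (?X (y x) - ?X x) \<and>
          \<not> int (chorded_cycle.n vs) dvd (?X (y x') + ?X x') - (?X (y x) + ?X x)"
          unfolding nn using a3[OF x] yV[OF x(2)] by (auto simp: S3_def D_def algebra_simps)
      next
        fix x assume x: "x \<in> R"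
        show "\<not> int (chorded_cycle.n vs) dvd 2 * (?X (y x) - ?X x)"
          unfolding nn using a2[OF x] yV[OF x] by (simp add: S2_def)
      next
        fix a assume a: "a \<in> KP"
        show "Suc a mod chorded_cycle.n vs \<notin> KP"
        proof
          assume s: "Suc a mod chorded_cycle.n vs \<in> KP"
          define b where "b = Suc a mod n"
          have ab: "a < n" "b < n" using a s KP_sub by (auto simp: nn b_def)
          have K: "vs ! a \<in> R \<union> y ` R" "vs ! b \<in> R \<union> y ` R"
            using a s K_image by (auto simp: K_def KP_def marked_positions_def b_def nn)
          have Xa: "?X (vs ! a) = int a" and Xb: "?X (vs ! b) = int b" using X_nth ab by (auto simp: nn)
          have d: "?N dvd int b - (int a + 1)" using Suc_mod_dvd[of n a] by (simp add: b_def)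
          have d': "?N dvd int a - (int b - 1)"
          proof -
            have "?N dvd - (int b - (int a + 1))" using d by (simp only: dvd_minus_iff)
            then show ?thesis by (simp add: algebra_simps)
          qed
          have abV: "vs ! a \<in> ?V" "vs ! b \<in> ?V" using ab by (auto simp: n_len)
          have Db: "vs ! b \<in> D (?X (vs ! a) + 1)" and Da: "vs ! a \<in> D (?X (vs ! b) - 1)"
            using d d' abV Xa Xb by (auto simp: D_def)
          have "\<not> (vs ! a \<in> R \<and> vs ! b \<in> R)"
            using sel[of a] ab by (auto simp: marked_positions_def n_len b_def)
          moreover have "\<not> (vs ! a \<in> R \<and> vs ! b \<in> y ` R)" using Db a1 by (auto simp: S1_def)
          moreover have "\<not> (vs ! a \<in> y ` R \<and> vs ! b \<in> R)" using Da a1 by (auto simp: S1_def)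
          moreover have "\<not> (vs ! a \<in> y ` R \<and> vs ! b \<in> y ` R)"
          proof
            assume "vs ! a \<in> y ` R \<and> vs ! b \<in> y ` R"
            then obtain x x' where x: "x \<in> R" "x' \<in> R" "vs ! a = y x" "vs ! b = y x'" by auto
            have "a \<noteq> b"
            proof (cases "Suc a < n")
              case False
              then have "Suc a = n" using ab by simp
              then show ?thesis using len by (auto simp: b_def n_len)
            qed (simp add: b_def)
            then have "vs ! a \<noteq> vs ! b" using dist ab by (simp add: n_len nth_eq_iff_index_eq)
            then have "x \<noteq> x'" using x by auto
            then have "y x' \<notin> S3 x x' (y x)" using a3 x by blast
            then show False using Db x by (simp add: S3_def)
          qed
          ultimately show False using K by blast
        qed
      qed
    qed
    then show False using y by (simp add: V_def G_def)
  qed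
  have val: "real (card {y \<in> ?I. y x = v}) \<le> 96 / n * real (card ?I)" if "x \<in> R" for x v
    using card_injections_value_le[OF finR V(1,2) that] V by simp
  have val2: "real (card {y \<in> ?I. y x = v \<and> y x' = v'}) \<le> (96 / n)\<^sup>2 * real (card ?I)"
    if "x \<in> R" "x' \<in> R" "x \<noteq> x'" "v \<notin> R" for x x' v v'
    using card_injections_two_values_le[OF finR V(1,2) that] V by simp
  have cA: "real (card ?A) \<le> 576 * (real ?r)\<^sup>2 / n * real (card ?I)"
  proof -
    have "card ?A \<le> (\<Sum>x\<in>R. \<Sum>v\<in>S1 \<union> S2 x. card {y \<in> ?I. y x = v})"
      using finR S1 S2 by (intro order_trans[OF card_UN_le] sum_mono order_refl) auto
    then have "real (card ?A) \<le> real (\<Sum>x\<in>R. \<Sum>v\<in>S1 \<union> S2 x. card {y \<in> ?I. y x = v})" by (rule of_nat_mono)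
    also have "\<dots> = (\<Sum>x\<in>R. \<Sum>v\<in>S1 \<union> S2 x. real (card {y \<in> ?I. y x = v}))" by simp
    also have "\<dots> \<le> (\<Sum>x\<in>R. \<Sum>v\<in>S1 \<union> S2 x. 96 / n * real (card ?I))" using val by (intro sum_mono) auto
    also have "\<dots> = (\<Sum>x\<in>R. real (card (S1 \<union> S2 x)) * (96 / n * real (card ?I)))" by simp
    also have "\<dots> \<le> (\<Sum>x\<in>R. (6 * real ?r) * (96 / n * real (card ?I)))"
    proof (intro sum_mono mult_right_mono)
      fix x assume "x \<in> R"
      then have "card (S1 \<union> S2 x) \<le> 3 * ?r + 3" by (intro cU S1 S2)
      then show "real (card (S1 \<union> S2 x)) \<le> 6 * real ?r" using R2 by linarith
    qed auto
    finally show ?thesis by (simp add: power2_eq_square field_simps)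
  qed
  have cB: "real (card ?B) \<le> 46080 * (real ?r)\<^sup>2 / n * real (card ?I)"
  proof -
    have "card ?B \<le> (\<Sum>x\<in>R. \<Sum>x'\<in>R - {x}. \<Sum>v\<in>?V - R. \<Sum>v'\<in>S3 x x' v. card {y \<in> ?I. y x = v \<and> y x' = v'})"
      using finR S3 by (intro order_trans[OF card_UN_le] sum_mono order_refl) auto
    then have "real (card ?B) \<le> real (\<Sum>x\<in>R. \<Sum>x'\<in>R - {x}. \<Sum>v\<in>?V - R. \<Sum>v'\<in>S3 x x' v. card {y \<in> ?I. y x = v \<and> y x' = v'})" by (rule of_nat_mono)
    also have "\<dots> = (\<Sum>x\<in>R. \<Sum>x'\<in>R - {x}. \<Sum>v\<in>?V - R. \<Sum>v'\<in>S3 x x' v. real (card {y \<in> ?I. y x = v \<and> y x' = v'}))" by simp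
    also have "\<dots> \<le> (\<Sum>x\<in>R. \<Sum>x'\<in>R - {x}. \<Sum>v\<in>?V - R. \<Sum>v'\<in>S3 x x' v. (96 / n)\<^sup>2 * real (card ?I))"
      using val2 by (intro sum_mono) auto
    also have "\<dots> \<le> (\<Sum>x\<in>R. \<Sum>x'\<in>R - {x}. \<Sum>v\<in>?V - R. 5 * ((96 / n)\<^sup>2 * real (card ?I)))"
    proof (intro sum_mono)
      fix x x' v
      have "real (card (S3 x x' v)) * ((96 / n)\<^sup>2 * real (card ?I)) \<le> 5 * ((96 / n)\<^sup>2 * real (card ?I))"
        using S3(2)[of x x' v] by (intro mult_right_mono) auto
      then show "(\<Sum>v'\<in>S3 x x' v. (96 / n)\<^sup>2 * real (card ?I)) \<le> 5 * ((96 / n)\<^sup>2 * real (card ?I))" by simp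
    qed
    also have "\<dots> \<le> (\<Sum>x\<in>R. \<Sum>x'\<in>R. \<Sum>v\<in>?V. 5 * ((96 / n)\<^sup>2 * real (card ?I)))"
      using finR by (intro sum_mono order_trans[OF sum_mono sum_mono2] sum_mono2) (auto intro!: sum_nonneg sum_mono2)
    also have "\<dots> = real ?r * (real ?r * (real n * (5 * ((96 / n)\<^sup>2 * real (card ?I)))))" using V by simp
    also have "\<dots> = 46080 * (real ?r)\<^sup>2 / n * real (card ?I)" using n0 by (simp add: power2_eq_square field_simps)
    finally show ?thesis .
  qed
  have "card ?Y \<le> card (?A \<union> ?B)" using sub finI by (intro card_mono) (auto intro: finite_subset[OF _ finI])
  also have "\<dots> \<le> card ?A + card ?B" by (rule card_Un_le)
  finally have "real (card ?Y) \<le> real (card ?A) + real (card ?B)" by linarith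
  also have "\<dots> \<le> 576 * (real ?r)\<^sup>2 / n * real (card ?I) + 46080 * (real ?r)\<^sup>2 / n * real (card ?I)"
    using cA cB by (rule add_mono)
  also have "\<dots> = 46656 * ((real ?r)\<^sup>2 / n * real (card ?I))" by simp
  also have "\<dots> \<le> 50000 * ((real ?r)\<^sup>2 / n * real (card ?I))" by (intro mult_right_mono) auto
  finally show ?thesis by simp
qed

section \<open>The theorem\<close>

lemma regular_graphs_zero: "regular_graphs n 0 = {{}}"
proof
  show "regular_graphs n 0 \<subseteq> {{}}"
  proof
    fix F assume F: "F \<in> regular_graphs n 0"
    then have "card F = 0" using card_regular_graph[OF F] by simp
    then show "F \<in> {{}}" using regular_graph_finite[OF F] by simp
  qed
qed (auto simp: regular_graphs_def)

text \<open>For \<open>d = 0\<close> the regular layer is empty, so a bound that holds for every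
  Hamilton cycle separately can be summed over the cycles.\<close>

lemma card_symmetric_configurations_zero_le:
  fixes b :: real
  assumes n: "n \<ge> 3" "r \<le> n"
    and b: "\<And>vs R. vs \<in> permutations_of_set {1..n} \<Longrightarrow> R = cycle_selection vs r \<Longrightarrow>
      real (card {y \<in> injections R {1..n}. (\<forall>x\<in>R. y x \<noteq> x) \<and> chord_set R y \<inter> cycle_set vs = {} \<and>
             \<not> asymmetric {1..n} (cycle_set vs \<union> chord_set R y)}) \<le> b * real (card (injections R {1..n}))"
  shows "real (card {\<omega> \<in> simple_configurations n 0 r. \<not> asymmetric {1..n} (configuration_graph r \<omega>)})
     \<le> b * real (card (configurations n 0 r))"
proof -
  let ?P = "permutations_of_set {1..n}"
  let ?R = "\<lambda>vs. cycle_selection vs r"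
  let ?I = "\<lambda>vs. injections (?R vs) {1..n}"
  let ?Y = "\<lambda>vs. {y \<in> ?I vs. (\<forall>x\<in>?R vs. y x \<noteq> x) \<and> chord_set (?R vs) y \<inter> cycle_set vs = {} \<and>
             \<not> asymmetric {1..n} (cycle_set vs \<union> chord_set (?R vs) y)}"
  have n0: "n > 0" using n by simp
  have finR: "finite (?R vs)" if "vs \<in> ?P" for vs
    using card_cycle_selection(3)[of vs r] permutation_list[OF that] n n0 by auto
  have finI: "finite (?I vs)" if "vs \<in> ?P" for vs using finR[OF that] by (intro finite_injections) auto
  have sub: "{\<omega> \<in> simple_configurations n 0 r. \<not> asymmetric {1..n} (configuration_graph r \<omega>)}
      \<subseteq> {{}} \<times> (SIGMA vs : ?P. ?Y vs)"
  proof
    fix \<omega> assume \<omega>: "\<omega> \<in> {\<omega> \<in> simple_configurations n 0 r. \<not> asymmetric {1..n} (configuration_graph r \<omega>)}"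
    obtain F vs y where e: "\<omega> = (F, vs, y)" by (cases \<omega>)
    have F: "F = {}" and vs: "vs \<in> ?P" and y: "y \<in> ?I vs" and s: "simple_multigraph (sum_multigraph F vs (?R vs) y)"
      using \<omega> by (auto simp: e simple_configurations_def configurations_def regular_graphs_zero)
    have len: "length vs \<ge> 3" using permutation_list[OF vs] n by simp
    have "(\<forall>x\<in>?R vs. y x \<noteq> x) \<and> chord_set (?R vs) y \<inter> cycle_set vs = {}"
      using s simple_sum_multigraph_iff[OF _ _ finR[OF vs] permutation_list(1)[OF vs] len, of "{}" y] F by simp
    moreover have "\<not> asymmetric {1..n} (cycle_set vs \<union> chord_set (?R vs) y)"
      using \<omega> by (simp add: e F configuration_graph_def)
    ultimately show "\<omega> \<in> {{}} \<times> (SIGMA vs : ?P. ?Y vs)" using e F vs y by simp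
  qed
  have fY: "finite (SIGMA vs : ?P. ?Y vs)" using finI by (intro finite_SigmaI) auto
  have "card {\<omega> \<in> simple_configurations n 0 r. \<not> asymmetric {1..n} (configuration_graph r \<omega>)}
      \<le> card ({{} :: nat set set} \<times> (SIGMA vs : ?P. ?Y vs))"
    by (rule card_mono[OF _ sub]) (use fY in simp)
  also have "\<dots> = (\<Sum>vs\<in>?P. card (?Y vs))" using finI by (simp add: card_cartesian_product card_SigmaI)
  finally have "real (card {\<omega> \<in> simple_configurations n 0 r. \<not> asymmetric {1..n} (configuration_graph r \<omega>)})
      \<le> real (\<Sum>vs\<in>?P. card (?Y vs))" by (rule of_nat_mono)
  also have "\<dots> = (\<Sum>vs\<in>?P. real (card (?Y vs)))" by simp
  also have "\<dots> \<le> (\<Sum>vs\<in>?P. b * real (card (?I vs)))" using b by (intro sum_mono) blast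
  also have "\<dots> = b * real (\<Sum>vs\<in>?P. card (?I vs))" by (simp add: sum_distrib_left)
  also have "(\<Sum>vs\<in>?P. card (?I vs)) = card (configurations n 0 r)"
    unfolding configurations_def regular_graphs_zero using finI by (simp add: card_SigmaI)
  finally show ?thesis .
qed

lemma selection_marked_positions:
  assumes vs: "vs \<in> permutations_of_set {1..n}"
  shows "marked_positions vs (cycle_selection vs r) = selected_positions n r"
proof -
  note p = permutation_list[OF vs]
  show ?thesis unfolding cycle_selection_eq p(2)
  proof (intro equalityI subsetI)
    fix i assume "i \<in> marked_positions vs ((!) vs ` selected_positions n r)"
    then obtain j where "i < n" "j \<in> selected_positions n r" "vs ! i = vs ! j"
      by (auto simp: marked_positions_def p)
    then show "i \<in> selected_positions n r"
      using nth_eq_iff_index_eq[OF p(1), of i j] p(2) by (auto simp: selected_positions_def)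
  qed (auto simp: marked_positions_def selected_positions_def p)
qed

text \<open>With at least \<open>n powr (1/4)\<close> chords, \<open>r powr (-1/4)\<close> is at
  most \<open>n powr (-1/16)\<close>, which also dominates the \<open>n powr (-1/4)\<close> of the
  case \<open>d > 0\<close>. With fewer chords, \<open>r\<^sup>2 / n\<close> is at most
  \<open>n powr (-1/2)\<close>.\<close>

definition symmetry_bound :: "nat \<Rightarrow> real" where
  "symmetry_bound n = 16 * exp 10 * real n powr (-1/16) + 50000 * real n powr (-1/2)"

text \<open>The degree \<open>d\<close> may vary with \<open>n\<close>. The thresholds are stated
  for an upper bound \<open>D\<close>, so that they hold for all occurring degrees at once.\<close>

lemma card_symmetric_le_symmetry_bound:
  fixes D :: nat
  assumes n: "n \<ge> 192 * (2 * D + 4) * (D + 1)" "real n \<ge> (4 * (1536 + 192 * real D * real D)) ^ 48"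
      "real n powr (1/4) \<ge> (4 * 1536) ^ 48"
    and d: "d \<le> D" and r: "2 * r < n" and dr: "d = 0 \<Longrightarrow> r \<ge> 2"
  shows "real (card {\<omega> \<in> simple_configurations n d r. \<not> asymmetric {1..n} (configuration_graph r \<omega>)})
     \<le> symmetry_bound n * real (card (configurations n d r))"
proof -
  have n3: "n \<ge> 3" "n > 0"
  proof -
    have "192 * 4 * 1 \<le> 192 * (2 * D + 4) * (D + 1)" by (intro mult_le_mono) auto
    then show "n \<ge> 3" "n > 0" using n(1) by linarith+
  qed
  have p16: "real n powr (-1/4) \<le> real n powr (-1/16)" using n3 by (intro powr_mono) auto
  show ?thesis
  proof (cases "d = 0")
    case False
    have "192 * (2 * d + 4) * (d + 1) \<le> 192 * (2 * D + 4) * (D + 1)" using d by (intro mult_le_mono) auto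
    then have n1: "n \<ge> 192 * (2 * d + 4) * (d + 1)" using n(1) by linarith
    have "real d * real d \<le> real D * real D" using d by (intro mult_mono) auto
    then have "(4 * (1536 + 192 * real d * real d)) ^ 48 \<le> (4 * (1536 + 192 * real D * real D)) ^ 48"
      by (intro power_mono) auto
    then have big: "real n \<ge> (4 * (1536 + 192 * real d * real d)) ^ 48" using n(2) by (rule order_trans)
    have rn: "2 * r \<le> n" and d1: "1 \<le> d" using r False by auto
    have "real (card {\<omega> \<in> simple_configurations n d r. \<not> asymmetric {1..n} (configuration_graph r \<omega>)})
       \<le> 16 * exp 10 * real n powr (-1/4) * real (card (configurations n d r))"
      by (rule card_symmetric_configurations_le[OF n1 rn d1 refl big])
    also have "\<dots> \<le> symmetry_bound n * real (card (configurations n d r))"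
    proof (intro mult_right_mono)
      have "16 * exp 10 * real n powr (-1/4) \<le> 16 * exp 10 * real n powr (-1/16)"
        using p16 by (intro mult_left_mono) auto
      then show "16 * exp 10 * real n powr (-1/4) \<le> symmetry_bound n"
        unfolding symmetry_bound_def by (rule order_trans) simp
    qed auto
    finally show ?thesis .
  next
    case True
    have "real (card {\<omega> \<in> simple_configurations n 0 r. \<not> asymmetric {1..n} (configuration_graph r \<omega>)})
       \<le> symmetry_bound n * real (card (configurations n 0 r))"
    proof (rule card_symmetric_configurations_zero_le)
      fix vs R assume vs: "vs \<in> permutations_of_set {1..n}" and R: "R = cycle_selection vs r"
      note p = permutation_list[OF vs]
      have len: "3 \<le> length vs" using p n3 by simp
      have RV: "R \<subseteq> set vs" and cR: "card R = r" unfolding R using card_cycle_selection[OF p(1), of r] p r n3 by auto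
      let ?Y = "{y \<in> injections R {1..n}. (\<forall>x\<in>R. y x \<noteq> x) \<and> chord_set R y \<inter> cycle_set vs = {} \<and>
             \<not> asymmetric {1..n} (cycle_set vs \<union> chord_set R y)}"
      show "real (card ?Y) \<le> symmetry_bound n * real (card (injections R {1..n}))"
      proof (cases "real r \<ge> real n powr (1/4)")
        case True
        then have big: "real (card R) \<ge> (4 * 1536) ^ 48" using n(3) cR by linarith
        have "real (card ?Y) \<le> 16 * exp 10 * real r powr (-1/4) * real (card (injections R {1..n}))"
          using card_injections_symmetric_le[OF p(1) len RV big] p(3) cR by simp
        also have "\<dots> \<le> symmetry_bound n * real (card (injections R {1..n}))"
        proof (intro mult_right_mono)
          have "real r powr (-1/4) \<le> (real n powr (1/4)) powr (-1/4)"
            using True n3 by (intro powr_mono2') auto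
          also have "\<dots> = real n powr (-1/16)" by (simp add: powr_powr)
          finally have "16 * exp 10 * real r powr (-1/4) \<le> 16 * exp 10 * real n powr (-1/16)"
            by (intro mult_left_mono) auto
          then show "16 * exp 10 * real r powr (-1/4) \<le> symmetry_bound n"
            unfolding symmetry_bound_def by (rule order_trans) simp
        qed auto
        finally show ?thesis .
      next
        case False
        have sel: "Suc a mod length vs \<notin> marked_positions vs R" if "a \<in> marked_positions vs R" for a
          using selected_not_adjacent[OF r, of a] that selection_marked_positions[OF vs, of r] p R by simp
        have "real (card ?Y) \<le> 50000 * (real r)\<^sup>2 / n * real (card (injections R {1..n}))"
          using card_few_chords_symmetric_le[OF p(1) len RV _ sel] p cR dr \<open>d = 0\<close> by simp
        also have "\<dots> \<le> symmetry_bound n * real (card (injections R {1..n}))"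
        proof (intro mult_right_mono)
          have "(real r)\<^sup>2 \<le> (real n powr (1/4))\<^sup>2" using False by (intro power_mono) auto
          also have "\<dots> = real n powr (1/2)" by (simp add: power2_eq_square powr_add[symmetric])
          finally have "(real r)\<^sup>2 / n \<le> real n powr (1/2) / n" by (intro divide_right_mono) auto
          also have "\<dots> = real n powr (1/2) / real n powr 1" using n3 by simp
          also have "\<dots> = real n powr (1/2 - 1)" by (rule powr_diff[symmetric])
          also have "\<dots> = real n powr (-1/2)" by simp
          finally have "50000 * ((real r)\<^sup>2 / n) \<le> 50000 * real n powr (-1/2)" by (intro mult_left_mono) auto
          then show "50000 * (real r)\<^sup>2 / n \<le> symmetry_bound n"
            unfolding symmetry_bound_def by (simp add: add_increasing)
        qed auto
        finally show ?thesis .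
      qed
    qed (use n3 r in auto)
    then show ?thesis using True by simp
  qed
qed

lemma configurations_nonempty:
  assumes "even n" "n \<ge> 3" "2 * d \<le> n" "r \<le> n"
  shows "configurations n d r \<noteq> {}"
proof -
  obtain F where F: "F \<in> regular_graphs n d" using regular_graphs_nonempty[of n d] assms by auto
  have "permutations_of_set {1..n} \<noteq> {}" by simp
  then obtain vs where vs: "vs \<in> permutations_of_set {1..n}" by blast
  note p = permutation_list[OF vs]
  have "injections (cycle_selection vs r) {1..n} \<noteq> {}"
    using card_cycle_selection[OF p(1), of r] p assms by (intro injections_nonempty) auto
  then show ?thesis using F vs by (auto simp: configurations_def)
qed

lemma asymmetric_prob_ge:
  fixes D n m :: nat
  assumes n: "n \<ge> 192 * (2 * D + 4) * (D + 1)" "real n \<ge> (4 * (1536 + 192 * real D * real D)) ^ 48"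
      "real n powr (1/4) \<ge> (4 * 1536) ^ 48" "even n"
    and m: "n + 2 \<le> m" "2 * m \<le> D * n"
  shows "1 - (\<Sum>d\<le>D. simple_constant d) * symmetry_bound n \<le> measure_pmf.prob (balanced_graph n m) {E. asymmetric {1..n} E}"
proof -
  define h where "h = n div 2"
  define r where "r = m mod (n div 2)"
  define d where "d = m div (n div 2) - 2"
  have D4: "192 * (D + 4) \<le> n"
  proof -
    have "192 * (D + 4) * 1 \<le> 192 * (2 * D + 4) * (D + 1)" by (intro mult_le_mono) auto
    then show ?thesis using n(1) by linarith
  qed
  have nh: "n = 2 * h" "h > 0" using n(4) D4 by (auto simp: h_def)
  have q2: "2 \<le> m div h" using m(1) nh by (simp add: less_eq_div_iff_mult_less_eq)
  have r: "2 * r < n" using nh by (simp add: r_def)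
  have meq: "m = (m div h) * h + r" by (simp add: r_def h_def[symmetric])
  have dD: "d \<le> D"
  proof -
    have "(m div h) * h \<le> m" by (rule div_times_less_eq_dividend)
    moreover have "m \<le> D * h" using m(2) nh by simp
    ultimately have "(m div h) * h \<le> D * h" by linarith
    then have "m div h \<le> D" using nh by simp
    then show ?thesis by (simp add: d_def h_def[symmetric])
  qed
  \<comment> \<open>For \<open>q = 2\<close> the number of chords is \<open>m - n\<close>, so this
    is exactly the hypothesis \<open>n + 2 \<le> m\<close>.\<close>
  have dr: "r \<ge> 2" if "d = 0"
  proof -
    have "m div h = 2" using that q2 by (simp add: d_def h_def[symmetric])
    then have "m = 2 * h + r" using meq by simp
    then show ?thesis using m(1) nh by simp
  qed
  let ?S = "simple_configurations n d r"
  let ?C = "configurations n d r"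
  let ?B = "{\<omega> \<in> ?S. \<not> asymmetric {1..n} (configuration_graph r \<omega>)}"
  have n3: "n \<ge> 3" "n \<ge> 96" "n \<ge> 4 * (d + 4)" "2 * d \<le> n" "r \<le> n" using D4 dD r by auto
  have finC: "finite ?C" using finite_configurations n3 by simp
  have finS: "finite ?S" by (rule finite_subset[OF _ finC]) (auto simp: simple_configurations_def)
  have "?C \<noteq> {}" using configurations_nonempty n(4) n3 by blast
  then have C0: "real (card ?C) > 0" using finC by (simp add: card_gt_0_iff)
  have CS: "real (card ?C) \<le> simple_constant d * real (card ?S)"
    using n3 r by (intro card_simple_configurations_ge) auto
  have sc: "simple_constant d \<ge> 0" for d by (simp add: simple_constant_def)
  have S0: "card ?S > 0" using CS C0 by (cases "card ?S = 0") auto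
  then have Sne: "?S \<noteq> {}" by auto
  \<comment> \<open>Here the unconditioned count is transferred to simple configurations. Summing
    \<open>simple_constant\<close> over all degrees up to \<open>D\<close> makes the cost
    independent of \<open>n\<close>.\<close>
  have "real (card ?B) \<le> symmetry_bound n * real (card ?C)"
    using n dD r dr by (intro card_symmetric_le_symmetry_bound) auto
  also have "\<dots> \<le> symmetry_bound n * ((\<Sum>d\<le>D. simple_constant d) * real (card ?S))"
  proof (intro mult_left_mono)
    have "simple_constant d \<le> (\<Sum>d\<le>D. simple_constant d)" using dD sc by (intro member_le_sum) auto
    then have "simple_constant d * real (card ?S) \<le> (\<Sum>d\<le>D. simple_constant d) * real (card ?S)"
      by (intro mult_right_mono) auto
    then show "real (card ?C) \<le> (\<Sum>d\<le>D. simple_constant d) * real (card ?S)" using CS by linarith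
    show "0 \<le> symmetry_bound n" by (simp add: symmetry_bound_def)
  qed
  finally have bad: "real (card ?B) / real (card ?S) \<le> (\<Sum>d\<le>D. simple_constant d) * symmetry_bound n"
    using S0 by (simp add: field_simps)
  have split: "card {\<omega> \<in> ?S. configuration_graph r \<omega> \<in> {E. asymmetric {1..n} E}} + card ?B = card ?S"
  proof -
    have "card ({\<omega> \<in> ?S. configuration_graph r \<omega> \<in> {E. asymmetric {1..n} E}} \<union> ?B)
        = card {\<omega> \<in> ?S. configuration_graph r \<omega> \<in> {E. asymmetric {1..n} E}} + card ?B"
      using finS by (intro card_Un_disjoint) auto
    moreover have "{\<omega> \<in> ?S. configuration_graph r \<omega> \<in> {E. asymmetric {1..n} E}} \<union> ?B = ?S" by auto
    ultimately show ?thesis by simp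
  qed
  have "measure_pmf.prob (balanced_graph n m) {E. asymmetric {1..n} E}
      = real (card {\<omega> \<in> ?S. configuration_graph r \<omega> \<in> {E. asymmetric {1..n} E}}) / real (card ?S)"
    using n3 Sne by (intro balanced_graph_prob) (auto simp: r_def d_def)
  also have "\<dots> = 1 - real (card ?B) / real (card ?S)"
  proof -
    have "real (card {\<omega> \<in> ?S. configuration_graph r \<omega> \<in> {E. asymmetric {1..n} E}}) = real (card ?S) - real (card ?B)"
      using split by linarith
    then show ?thesis using S0 by (simp add: diff_divide_distrib)
  qed
  finally show ?thesis using bad by linarith
qed

lemma symmetry_bound_tendsto: "symmetry_bound \<longlonglongrightarrow> 0"
proof -
  have "((\<lambda>n. real n powr (-1/16)) \<longlongrightarrow> 0) sequentially" "((\<lambda>n. real n powr (-1/2)) \<longlongrightarrow> 0) sequentially"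
    by (auto intro!: tendsto_neg_powr filterlim_real_sequentially)
  then have "((\<lambda>n. 16 * exp 10 * real n powr (-1/16) + 50000 * real n powr (-1/2)) \<longlongrightarrow> 16 * exp 10 * 0 + 50000 * 0) sequentially"
    by (intro tendsto_intros)
  then show ?thesis by (simp add: symmetry_bound_def[abs_def])
qed

theorem theorem7:
  fixes c :: real and m :: "nat \<Rightarrow> nat"
  assumes "c > 1"
    and "\<forall>\<^sub>F n in inf sequentially (principal {n. even n}).
           n + 2 \<le> m n \<and> real (m n) \<le> c * real n"
  shows "((\<lambda>n. measure_pmf.prob (balanced_graph n (m n)) {E. asymmetric {1..n} E})
           \<longlongrightarrow> 1) (inf sequentially (principal {n. even n}))"
proof -
  let ?F = "inf sequentially (principal {n. even n}) :: nat filter"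
  \<comment> \<open>Since \<open>q\<close> is at most \<open>2 * m / n \<le> 2 * c\<close>, this
    bounds the degree of the regular layer for all \<open>n\<close>.\<close>
  define D where "D = nat \<lceil>2 * c\<rceil>"
  have D: "2 * c \<le> real D" unfolding D_def by linarith
  let ?C = "\<Sum>d\<le>D. simple_constant d"
  have "((\<lambda>n. 1 - ?C * symmetry_bound n) \<longlongrightarrow> 1 - ?C * 0) sequentially"
    by (intro tendsto_intros symmetry_bound_tendsto)
  then have lower: "((\<lambda>n. 1 - ?C * symmetry_bound n) \<longlongrightarrow> 1) ?F"
    by (intro tendsto_mono[OF inf_le1]) simp
  have seq: "eventually P ?F" if "eventually P sequentially" for P
    using that by (rule filter_leD[OF inf_le1])
  have big: "\<forall>\<^sub>F n in ?F. real n \<ge> a" for a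
    by (rule seq) (rule filterlim_real_sequentially[unfolded filterlim_at_top, rule_format])
  have bigp: "\<forall>\<^sub>F n in ?F. real n powr (1/4) \<ge> a" for a
  proof -
    have "filterlim (\<lambda>n. real n powr (1/4)) at_top sequentially" by real_asymp
    then show ?thesis using seq by (simp add: filterlim_at_top)
  qed
  have ev: "\<forall>\<^sub>F n in ?F. even n" by (simp add: eventually_inf_principal)
  have "\<forall>\<^sub>F n in ?F. 1 - ?C * symmetry_bound n \<le> measure_pmf.prob (balanced_graph n (m n)) {E. asymmetric {1..n} E}"
    using assms(2) ev big[of "real (192 * (2 * D + 4) * (D + 1))"]
      big[of "(4 * (1536 + 192 * real D * real D)) ^ 48"] bigp[of "(4 * 1536) ^ 48"]
  proof eventually_elim
    case (elim n)
    have "2 * real (m n) \<le> (2 * c) * real n" using elim by simp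
    also have "\<dots> \<le> real D * real n" using D by (intro mult_right_mono) auto
    finally have "real (2 * m n) \<le> real (D * n)" by simp
    then have "2 * m n \<le> D * n" by (simp only: of_nat_le_iff)
    moreover have "n \<ge> 192 * (2 * D + 4) * (D + 1)" using elim(3) by (simp only: of_nat_le_iff)
    ultimately show ?case using elim by (intro asymmetric_prob_ge) auto
  qed
  then show ?thesis
    by (intro tendsto_sandwich[OF _ _ lower tendsto_const]) auto
qed

end
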